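(* Let $\mathcal{G}$ be a generalized metric on a manifold $M^{2n}$ with real closed 3-form $H$, let $\mathcal{I}_+$ and $\mathcal{I}_-$ be a positive and a negative almost Hermitian structure compatible with $\mathcal{G}$, and let $\mathcal{J}_1=\mathcal{I}_++\mathcal{I}_-$. Let $N_1,\dots,N_4,N_\pm$ be the components of the intrinsic torsion of $(\mathcal{G},\mathcal{J}_1)$. Then $(\mathcal{G},\mathcal{I}_+)$ is a positive SKT structure if and only if $N_2,N_3$ and $N_+$ vanish, and $(\mathcal{G},\mathcal{I}_-)$ is a negative SKT structure if and only if $N_1,N_4$ and $N_-$ vanish.
   Context: Let $\mathbb{T}M=TM\oplus T^*M$ with pairing $\langle X+\xi,Y+\eta\rangle=\frac12(\eta(X)+\xi(Y))$ and Courant bracket $[\![X+\xi,Y+\eta]\!]_H=[X,Y]+\mathcal{L}_X\eta-i_Yd\xi-i_Yi_XH$. Sections of $\mathbb{T}M$ act on forms by the Clifford action $(X+\xi)\cdot\varphi=i_X\varphi+\xi\wedge\varphi$, and $d^H=d+H\wedge$. A generalized metric is an orthogonal, self-adjoint bundle automorphism $\mathcal{G}$ of $\mathbb{T}M$ with $\langle\mathcal{G}v,w\rangle$ positive definite; $V_\pm$ are its $\pm1$-eigenbundles. A positive (resp. negative) almost Hermitian structure compatible with $\mathcal{G}$ is a complex structure $\mathcal{I}_+$ on $V_+$ (resp. $\mathcal{I}_-$ on $V_-$) orthogonal for the pairing; its $+i$-eigenbundle is $V_+^{1,0}$ (resp. $V_-^{1,0}$). It is a positive (resp. negative) SKT structure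 if this $+i$-eigenbundle is involutive with respect to the Courant bracket $[\![\cdot,\cdot]\!]_H$. $\mathcal{J}_1=\mathcal{I}_++\mathcal{I}_-$ (acting as $\mathcal{I}_\pm$ on $V_\pm$) and $\mathcal{J}_2=\mathcal{G}\mathcal{J}_1$ are orthogonal complex structures on $\mathbb{T}M$. For such a $\mathcal{J}$ with $+i$-eigenbundle $L$, $U^n_{\mathcal{J}}\subset\wedge^\bullet T^*_{\mathbb{C}}M$ is the line bundle of forms annihilated by $L$, $U^{n-k}_{\mathcal{J}}=\wedge^k\overline{L}\cdot U^n_{\mathcal{J}}$, and $U^{p,q}=U^p_{\mathcal{J}_1}\cap U^q_{\mathcal{J}_2}$ with sheaf of sections $\mathcal{U}^{p,q}$. The operator $d^H$ decomposes as the sum of the following eight components and their complex conjugates: $\delta_+,\delta_-,N_+,N_-,N_1,N_2,N_3,N_4$, which map $\mathcal{U}^{p,q}$ respectively to $\mathcal{U}^{p+1,q+1},\mathcal{U}^{p+1,q-1},\mathcal{U}^{p+3,q+3},\mathcal{U}^{p+3,q-3},\mathcal{U}^{p-1,q+3},\mathcal{U}^{p+1,q+3},\mathcal{U}^{p+3,q+1},\mathcal{U}^{p+3,q-1}$. The tensorial components $N_1,\dots,N_4,N_\pm$ are the intrinsic torsion. *)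

theory Defs
  imports "HOL-Analysis.Analysis"
begin

section \<open>Smooth manifolds\<close>

primrec Ck_on :: "nat \<Rightarrow> 'v::real_normed_vector set \<Rightarrow> ('v \<Rightarrow> 'w::real_normed_vector) \<Rightarrow> bool" where
  "Ck_on 0 S f \<longleftrightarrow> continuous_on S f"
| "Ck_on (Suc k) S f \<longleftrightarrow> (\<forall>x\<in>S. f differentiable at x) \<and>
     (\<forall>v. Ck_on k S (\<lambda>x. frechet_derivative f (at x) v))"

text \<open>Only used on open subsets of finite-dimensional spaces.\<close>

definition smooth_on :: "'v::real_normed_vector set \<Rightarrow> ('v \<Rightarrow> 'w::real_normed_vector) \<Rightarrow> bool" where
  "smooth_on S f \<longleftrightarrow> (\<forall>k. Ck_on k S f)"

type_synonym ('a, 'n) chart = "'a set \<times> ('a \<Rightarrow> real^'n)"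

definition chart_inv :: "('a, 'n) chart \<Rightarrow> real^'n \<Rightarrow> 'a" where
  "chart_inv c = inv_into (fst c) (snd c)"

text \<open>The manifold is the whole type \<open>'a\<close>; its dimension is \<open>CARD('n)\<close>.\<close>

definition smooth_atlas ::
  "('a::{t2_space,second_countable_topology}, 'n::finite) chart set \<Rightarrow> bool" where
  "smooth_atlas A \<longleftrightarrow>
     (\<forall>c\<in>A. open (fst c) \<and> open (snd c ` fst c) \<and>
        homeomorphism (fst c) (snd c ` fst c) (snd c) (chart_inv c)) \<and>
     (\<Union>c\<in>A. fst c) = UNIV \<and>
     (\<forall>c\<in>A. \<forall>c'\<in>A. smooth_on (snd c ` (fst c \<inter> fst c')) (snd c' \<circ> chart_inv c))"

text \<open>The tangent space at \<open>p\<close> is \<open>real^'n\<close>, a vector being represented by its components in the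
  chart \<open>chart_at A p\<close> chosen at \<open>p\<close>; likewise covectors, by their components in the dual
  coordinate basis, so that \<open>\<xi>(X) = (\<Sum>i. \<xi> $ i * X $ i)\<close>. The choice of chart varies
  arbitrarily with \<open>p\<close>: smoothness and derivatives of sections always refer to their components
  in one fixed chart, obtained by the usual transformation laws.\<close>

definition chart_at :: "('a, 'n) chart set \<Rightarrow> 'a \<Rightarrow> ('a, 'n) chart" where
  "chart_at A p = (SOME c. c \<in> A \<and> p \<in> fst c)"

text \<open>Jacobian at \<open>p\<close> of the change of coordinates from \<open>c\<close> to \<open>c'\<close>.\<close>

definition jacobian :: "('a, 'n::finite) chart \<Rightarrow> ('a, 'n) chart \<Rightarrow> 'a \<Rightarrow> real^'n^'n" where
  "jacobian c c' p = matrix (frechet_derivative (snd c' \<circ> chart_inv c) (at (snd c p)))"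


section \<open>The generalized tangent bundle\<close>

text \<open>Fibres of \<open>TM \<oplus> T\<^sup>*M\<close> (for \<open>'k = real\<close>) and of its complexification (for
  \<open>'k = complex\<close>).\<close>

type_synonym ('k, 'n) gtan = "('k^'n) \<times> ('k^'n)"

definition sec_coord ::
  "('a, 'n::finite) chart set \<Rightarrow> ('a, 'n) chart \<Rightarrow> ('a \<Rightarrow> ('k::real_normed_field, 'n) gtan)
    \<Rightarrow> real^'n \<Rightarrow> ('k, 'n) gtan" where
  "sec_coord A c v y =
     (let p = chart_inv c y; k = chart_at A p in
       (map_matrix of_real (jacobian k c p) *v fst (v p),
        map_matrix of_real (transpose (jacobian c k p)) *v snd (v p)))"

definition smooth_section ::
  "('a::topological_space, 'n::finite) chart set \<Rightarrow> 'a set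
    \<Rightarrow> ('a \<Rightarrow> ('k::real_normed_field, 'n) gtan) \<Rightarrow> bool" where
  "smooth_section A W v \<longleftrightarrow> (\<forall>c\<in>A. smooth_on (snd c ` (fst c \<inter> W)) (sec_coord A c v))"

definition pairing :: "(real, 'n::finite) gtan \<Rightarrow> (real, 'n) gtan \<Rightarrow> real" where
  "pairing v w = (snd w \<bullet> fst v + snd v \<bullet> fst w) / 2"

definition Re_vec :: "complex^'n::finite \<Rightarrow> real^'n" where "Re_vec X = (\<chi> i. Re (X $ i))"
definition Im_vec :: "complex^'n::finite \<Rightarrow> real^'n" where "Im_vec X = (\<chi> i. Im (X $ i))"

definition Re_gt :: "(complex, 'n::finite) gtan \<Rightarrow> (real, 'n) gtan" where
  "Re_gt z = (Re_vec (fst z), Re_vec (snd z))"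
definition Im_gt :: "(complex, 'n::finite) gtan \<Rightarrow> (real, 'n) gtan" where
  "Im_gt z = (Im_vec (fst z), Im_vec (snd z))"
definition of_real_gt :: "(real, 'n::finite) gtan \<Rightarrow> (complex, 'n) gtan" where
  "of_real_gt v = (\<chi> i. of_real (fst v $ i), \<chi> i. of_real (snd v $ i))"
definition cnj_gt :: "(complex, 'n::finite) gtan \<Rightarrow> (complex, 'n) gtan" where
  "cnj_gt z = (\<chi> i. cnj (fst z $ i), \<chi> i. cnj (snd z $ i))"
definition cscale_gt :: "complex \<Rightarrow> (complex, 'n::finite) gtan \<Rightarrow> (complex, 'n) gtan" where
  "cscale_gt a z = (a *s fst z, a *s snd z)"

definition complexify ::
  "((real, 'n) gtan \<Rightarrow> (real, 'n) gtan) \<Rightarrow> (complex, 'n::finite) gtan \<Rightarrow> (complex, 'n) gtan" where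
  "complexify T z = of_real_gt (T (Re_gt z)) + cscale_gt \<i> (of_real_gt (T (Im_gt z)))"

text \<open>The \<open>+i\<close>-eigenspace, inside \<open>V \<otimes> \<complex>\<close>, of an endomorphism \<open>T\<close> of a real subspace \<open>V\<close>.\<close>

definition i_eigenspace ::
  "(real, 'n) gtan set \<Rightarrow> ((real, 'n) gtan \<Rightarrow> (real, 'n) gtan) \<Rightarrow> (complex, 'n::finite) gtan set" where
  "i_eigenspace V T = {z. Re_gt z \<in> V \<and> Im_gt z \<in> V \<and> complexify T z = cscale_gt \<i> z}"


section \<open>Differential forms\<close>

text \<open>An element of \<open>\<And>\<^sup>\<bullet>T\<^sup>*\<^sub>p\<otimes>\<complex>\<close>, not necessarily homogeneous, is a function that is
  multilinear and alternating on lists of tangent vectors of each length; its value on lists of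
  length \<open>k\<close> is its component of degree \<open>k\<close>.\<close>

type_synonym 'n mform = "(real^'n) list \<Rightarrow> complex"

definition alt_form :: "'n::finite mform \<Rightarrow> bool" where
  "alt_form \<phi> \<longleftrightarrow> (\<forall>us vs. linear (\<lambda>x. \<phi> (us @ x # vs))) \<and>
     (\<forall>us vs ws x. \<phi> (us @ x # vs @ x # ws) = 0)"

definition homogeneous :: "nat \<Rightarrow> 'n mform \<Rightarrow> bool" where
  "homogeneous k \<phi> \<longleftrightarrow> (\<forall>vs. length vs \<noteq> k \<longrightarrow> \<phi> vs = 0)"

text \<open>Sum over shuffles: \<open>I\<close> is the set of positions of the vectors fed to \<open>\<alpha>\<close>.\<close>

definition wedge :: "'n mform \<Rightarrow> 'n mform \<Rightarrow> 'n mform" where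
  "wedge \<alpha> \<beta> vs = (\<Sum>I\<in>Pow {..<length vs}.
     (-1) ^ card {(i, j). i \<in> I \<and> j \<in> {..<length vs} - I \<and> j < i}
       * \<alpha> (nths vs I) * \<beta> (nths vs (- I)))"

definition contract :: "complex^'n::finite \<Rightarrow> 'n mform \<Rightarrow> 'n mform" where
  "contract X \<phi> vs = \<phi> (Re_vec X # vs) + \<i> * \<phi> (Im_vec X # vs)"

definition covec_form :: "complex^'n \<Rightarrow> 'n::finite mform" where
  "covec_form \<xi> vs = (case vs of [v] \<Rightarrow> (\<Sum>i\<in>UNIV. \<xi> $ i * of_real (v $ i)) | _ \<Rightarrow> 0)"

definition form_covec :: "'n::finite mform \<Rightarrow> complex^'n" where
  "form_covec \<alpha> = (\<chi> i. \<alpha> [axis i 1])"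

definition clifford :: "(complex, 'n) gtan \<Rightarrow> 'n::finite mform \<Rightarrow> 'n mform" where
  "clifford z \<phi> vs = contract (fst z) \<phi> vs + wedge (covec_form (snd z)) \<phi> vs"

definition form_coord ::
  "('a, 'n::finite) chart set \<Rightarrow> ('a, 'n) chart \<Rightarrow> ('a \<Rightarrow> 'n mform) \<Rightarrow> real^'n \<Rightarrow> 'n mform" where
  "form_coord A c \<phi> y vs =
     (let p = chart_inv c y in \<phi> p (map ((*v) (jacobian c (chart_at A p) p)) vs))"

definition smooth_form ::
  "('a::topological_space, 'n::finite) chart set \<Rightarrow> 'a set \<Rightarrow> ('a \<Rightarrow> 'n mform) \<Rightarrow> bool" where
  "smooth_form A W \<phi> \<longleftrightarrow> (\<forall>p\<in>W. alt_form (\<phi> p)) \<and>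
     (\<forall>c\<in>A. \<forall>vs. smooth_on (snd c ` (fst c \<inter> W)) (\<lambda>y. form_coord A c \<phi> y vs))"

text \<open>The coordinate formula in the chart chosen at \<open>p\<close>, with the normalisation
  \<open>d\<phi>(v\<^sub>0,\<dots>,v\<^sub>k) = \<Sum>\<^sub>i (-1)\<^sup>i D\<^sub>v\<^sub>i \<phi>(v\<^sub>0,\<dots>,v\<^sub>i omitted,\<dots>,v\<^sub>k)\<close> for constant \<open>v\<^sub>j\<close>.\<close>

definition ext_d ::
  "('a, 'n::finite) chart set \<Rightarrow> ('a \<Rightarrow> 'n mform) \<Rightarrow> 'a \<Rightarrow> 'n mform" where
  "ext_d A \<phi> p vs = (let c = chart_at A p in
     \<Sum>i<length vs. (-1) ^ i *
       frechet_derivative (\<lambda>y. form_coord A c \<phi> y (take i vs @ drop (Suc i) vs))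
         (at (snd c p)) (vs ! i))"

definition real_closed_3form ::
  "('a::topological_space, 'n::finite) chart set \<Rightarrow> ('a \<Rightarrow> 'n mform) \<Rightarrow> bool" where
  "real_closed_3form A H \<longleftrightarrow> smooth_form A UNIV H \<and> (\<forall>p. homogeneous 3 (H p)) \<and>
     (\<forall>p vs. H p vs \<in> \<real>) \<and> (\<forall>p vs. ext_d A H p vs = 0)"

definition twisted_d ::
  "('a, 'n::finite) chart set \<Rightarrow> ('a \<Rightarrow> 'n mform) \<Rightarrow> ('a \<Rightarrow> 'n mform) \<Rightarrow> 'a \<Rightarrow> 'n mform" where
  "twisted_d A H \<phi> p vs = ext_d A \<phi> p vs + wedge (H p) (\<phi> p) vs"


section \<open>The Courant bracket\<close>

definition cderiv :: "(real^'n \<Rightarrow> complex^'n) \<Rightarrow> real^'n \<Rightarrow> complex^'n \<Rightarrow> complex^'n::finite" where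
  "cderiv f y Z = frechet_derivative f (at y) (Re_vec Z) + \<i> *s frechet_derivative f (at y) (Im_vec Z)"

text \<open>\<open>[X, Y]\<close> for the vector parts of \<open>v\<close> and \<open>w\<close>. In the chart chosen at \<open>p\<close> the components of
  \<open>X\<close> at \<open>p\<close> are \<open>fst (v p)\<close>.\<close>

definition lie_bracket ::
  "('a, 'n::finite) chart set \<Rightarrow> ('a \<Rightarrow> (complex, 'n) gtan) \<Rightarrow> ('a \<Rightarrow> (complex, 'n) gtan)
    \<Rightarrow> 'a \<Rightarrow> complex^'n" where
  "lie_bracket A v w p = (let c = chart_at A p in
     cderiv (\<lambda>y. fst (sec_coord A c w y)) (snd c p) (fst (v p)) -
     cderiv (\<lambda>y. fst (sec_coord A c v y)) (snd c p) (fst (w p)))"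

text \<open>Cartan's formula, which makes sense for complex vector fields.\<close>

definition lie_deriv ::
  "('a, 'n::finite) chart set \<Rightarrow> ('a \<Rightarrow> complex^'n) \<Rightarrow> ('a \<Rightarrow> 'n mform) \<Rightarrow> 'a \<Rightarrow> 'n mform" where
  "lie_deriv A X \<phi> p vs =
     contract (X p) (ext_d A \<phi> p) vs + ext_d A (\<lambda>q. contract (X q) (\<phi> q)) p vs"

definition courant ::
  "('a, 'n::finite) chart set \<Rightarrow> ('a \<Rightarrow> 'n mform) \<Rightarrow> ('a \<Rightarrow> (complex, 'n) gtan)
    \<Rightarrow> ('a \<Rightarrow> (complex, 'n) gtan) \<Rightarrow> 'a \<Rightarrow> (complex, 'n) gtan" where
  "courant A H v w p =
     (let X = (\<lambda>q. fst (v q)); \<xi> = (\<lambda>q. covec_form (snd (v q)));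
          Y = (\<lambda>q. fst (w q)); \<eta> = (\<lambda>q. covec_form (snd (w q)))
      in (lie_bracket A v w p,
          form_covec (\<lambda>vs. lie_deriv A X \<eta> p vs - contract (Y p) (ext_d A \<xi> p) vs
            - contract (Y p) (contract (X p) (H p)) vs)))"

definition involutive ::
  "('a::topological_space, 'n::finite) chart set \<Rightarrow> ('a \<Rightarrow> 'n mform)
    \<Rightarrow> ('a \<Rightarrow> (complex, 'n) gtan set) \<Rightarrow> bool" where
  "involutive A H E \<longleftrightarrow> (\<forall>W v w. open W \<longrightarrow>
     smooth_section A W v \<longrightarrow> (\<forall>p\<in>W. v p \<in> E p) \<longrightarrow>
     smooth_section A W w \<longrightarrow> (\<forall>p\<in>W. w p \<in> E p) \<longrightarrow>
     (\<forall>p\<in>W. courant A H v w p \<in> E p))"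


section \<open>Generalized metrics and SKT structures\<close>

text \<open>A bundle map on the subbundle \<open>V\<close> is smooth if it maps smooth local sections to smooth
  local sections; its values off \<open>V\<close> are irrelevant.\<close>

definition smooth_endo_on ::
  "('a::topological_space, 'n::finite) chart set \<Rightarrow> ('a \<Rightarrow> (real, 'n) gtan set)
    \<Rightarrow> ('a \<Rightarrow> (real, 'n) gtan \<Rightarrow> (real, 'n) gtan) \<Rightarrow> bool" where
  "smooth_endo_on A V T \<longleftrightarrow>
     (\<forall>p. \<forall>v\<in>V p. T p v \<in> V p) \<and>
     (\<forall>p. \<forall>v\<in>V p. \<forall>w\<in>V p. T p (v + w) = T p v + T p w) \<and>
     (\<forall>p. \<forall>v\<in>V p. \<forall>a. T p (a *\<^sub>R v) = a *\<^sub>R T p v) \<and>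
     (\<forall>W v. open W \<longrightarrow> smooth_section A W v \<longrightarrow> (\<forall>p\<in>W. v p \<in> V p) \<longrightarrow>
        smooth_section A W (\<lambda>p. T p (v p)))"

definition generalized_metric ::
  "('a::topological_space, 'n::finite) chart set
    \<Rightarrow> ('a \<Rightarrow> (real, 'n) gtan \<Rightarrow> (real, 'n) gtan) \<Rightarrow> bool" where
  "generalized_metric A G \<longleftrightarrow> smooth_endo_on A (\<lambda>_. UNIV) G \<and> (\<forall>p. bij (G p)) \<and>
     (\<forall>p v w. pairing (G p v) (G p w) = pairing v w) \<and>
     (\<forall>p v w. pairing (G p v) w = pairing v (G p w)) \<and>
     (\<forall>p v. v \<noteq> 0 \<longrightarrow> pairing (G p v) v > 0)"

definition V_plus :: "('a \<Rightarrow> (real, 'n) gtan \<Rightarrow> (real, 'n::finite) gtan) \<Rightarrow> 'a \<Rightarrow> (real, 'n) gtan set" where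
  "V_plus G p = {v. G p v = v}"

definition V_minus :: "('a \<Rightarrow> (real, 'n) gtan \<Rightarrow> (real, 'n::finite) gtan) \<Rightarrow> 'a \<Rightarrow> (real, 'n) gtan set" where
  "V_minus G p = {v. G p v = - v}"

definition orthogonal_complex_structure_on ::
  "('a::topological_space, 'n::finite) chart set \<Rightarrow> ('a \<Rightarrow> (real, 'n) gtan set)
    \<Rightarrow> ('a \<Rightarrow> (real, 'n) gtan \<Rightarrow> (real, 'n) gtan) \<Rightarrow> bool" where
  "orthogonal_complex_structure_on A V I \<longleftrightarrow> smooth_endo_on A V I \<and>
     (\<forall>p. \<forall>v\<in>V p. I p (I p v) = - v) \<and>
     (\<forall>p. \<forall>v\<in>V p. \<forall>w\<in>V p. pairing (I p v) (I p w) = pairing v w)"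

definition positive_almost_hermitian where
  "positive_almost_hermitian A G I \<longleftrightarrow> orthogonal_complex_structure_on A (V_plus G) I"

definition negative_almost_hermitian where
  "negative_almost_hermitian A G I \<longleftrightarrow> orthogonal_complex_structure_on A (V_minus G) I"

definition positive_SKT where
  "positive_SKT A H G I \<longleftrightarrow> generalized_metric A G \<and> positive_almost_hermitian A G I \<and>
     involutive A H (\<lambda>p. i_eigenspace (V_plus G p) (I p))"

definition negative_SKT where
  "negative_SKT A H G I \<longleftrightarrow> generalized_metric A G \<and> negative_almost_hermitian A G I \<and>
     involutive A H (\<lambda>p. i_eigenspace (V_minus G p) (I p))"

text \<open>\<open>\<I>\<^sub>+ + \<I>\<^sub>-\<close>, evaluated on the \<open>V\<^sub>\<plusminus>\<close>-components \<open>(v \<plusminus> G v) / 2\<close> of \<open>v\<close>.\<close>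

definition sum_structure ::
  "('a \<Rightarrow> (real, 'n) gtan \<Rightarrow> (real, 'n) gtan) \<Rightarrow> ('a \<Rightarrow> (real, 'n) gtan \<Rightarrow> (real, 'n) gtan)
    \<Rightarrow> ('a \<Rightarrow> (real, 'n) gtan \<Rightarrow> (real, 'n) gtan) \<Rightarrow> 'a \<Rightarrow> (real, 'n::finite) gtan \<Rightarrow> (real, 'n) gtan" where
  "sum_structure G I I' p v =
     I p ((1/2) *\<^sub>R (v + G p v)) + I' p ((1/2) *\<^sub>R (v - G p v))"


section \<open>The decomposition of forms and the intrinsic torsion\<close>

definition cspan :: "'n mform set \<Rightarrow> 'n mform set" where
  "cspan S = {\<lambda>vs. \<Sum>i<m. a i * f i vs | (m::nat) a f. \<forall>i<m. f i \<in> S}"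

text \<open>The fibre of \<open>U\<^sup>k\<^sub>J\<close> for an orthogonal complex structure \<open>J\<close> of a single fibre, with
  \<open>CARD('n) = 2 n\<close>: \<open>U\<^sup>n\<close> is annihilated by \<open>L\<close>, and \<open>U\<^sup>n\<^sup>-\<^sup>k\<close> is the image of the action of
  \<open>\<And>\<^sup>k\<close> of the conjugate of \<open>L\<close>, on which (by isotropy) the exterior and Clifford products agree.\<close>

definition spin_top :: "((real, 'n) gtan \<Rightarrow> (real, 'n) gtan) \<Rightarrow> 'n::finite mform set" where
  "spin_top J = {\<phi>. alt_form \<phi> \<and> (\<forall>z \<in> i_eigenspace UNIV J. \<forall>vs. clifford z \<phi> vs = 0)}"

definition spin_grade :: "((real, 'n) gtan \<Rightarrow> (real, 'n) gtan) \<Rightarrow> int \<Rightarrow> 'n::finite mform set" where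
  "spin_grade J k =
     (let n = int (CARD('n) div 2) in
      if k \<le> n then
        cspan {foldr clifford zs \<phi> | zs \<phi>. length zs = nat (n - k) \<and>
                 set zs \<subseteq> cnj_gt ` i_eigenspace UNIV J \<and> \<phi> \<in> spin_top J}
      else {\<lambda>vs. 0})"

text \<open>The fibre at \<open>x\<close> of \<open>U\<^sup>p\<^sup>,\<^sup>q\<close>, with \<open>J\<^sub>1 = J\<close> and \<open>J\<^sub>2 = G J\<^sub>1\<close>.\<close>

definition spin_bigrade ::
  "('a \<Rightarrow> (real, 'n) gtan \<Rightarrow> (real, 'n) gtan) \<Rightarrow> ('a \<Rightarrow> (real, 'n) gtan \<Rightarrow> (real, 'n) gtan)
    \<Rightarrow> 'a \<Rightarrow> int \<Rightarrow> int \<Rightarrow> 'n::finite mform set" where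
  "spin_bigrade G J x p q = spin_grade (J x) p \<inter> spin_grade (G x \<circ> J x) q"

text \<open>Projection of \<open>\<psi>\<close> to \<open>U\<^sup>p\<^sup>,\<^sup>q\<close> along the other summands of
  \<open>\<And>\<^sup>\<bullet>T\<^sup>*\<otimes>\<complex> = \<Oplus>\<^sub>a\<^sub>,\<^sub>b U\<^sup>a\<^sup>,\<^sup>b\<close>; the summands with \<open>\<bar>a\<bar> > n\<close> or \<open>\<bar>b\<bar> > n\<close> are zero.\<close>

definition spin_proj ::
  "('a \<Rightarrow> (real, 'n) gtan \<Rightarrow> (real, 'n) gtan) \<Rightarrow> ('a \<Rightarrow> (real, 'n) gtan \<Rightarrow> (real, 'n) gtan)
    \<Rightarrow> 'a \<Rightarrow> int \<Rightarrow> int \<Rightarrow> 'n::finite mform \<Rightarrow> 'n mform" where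
  "spin_proj G J x p q \<psi> =
     (let n = int (CARD('n) div 2) in
      THE \<theta>. \<exists>f. (\<forall>a b. f a b \<in> spin_bigrade G J x a b) \<and>
        (\<forall>vs. \<psi> vs = (\<Sum>a\<in>{-n..n}. \<Sum>b\<in>{-n..n}. f a b vs)) \<and> \<theta> = f p q)"

definition bigrade_sections ::
  "('a::topological_space, 'n::finite) chart set
    \<Rightarrow> ('a \<Rightarrow> (real, 'n) gtan \<Rightarrow> (real, 'n) gtan) \<Rightarrow> ('a \<Rightarrow> (real, 'n) gtan \<Rightarrow> (real, 'n) gtan)
    \<Rightarrow> int \<Rightarrow> int \<Rightarrow> 'a set \<Rightarrow> ('a \<Rightarrow> 'n mform) set" where
  "bigrade_sections A G J p q W =
     {\<phi>. smooth_form A W \<phi> \<and> (\<forall>x\<in>W. \<phi> x \<in> spin_bigrade G J x p q)}"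

text \<open>The component of \<open>d\<^sup>H\<close> that maps sections of \<open>U\<^sup>p\<^sup>,\<^sup>q\<close> to sections of \<open>U\<^sup>p\<^sup>+\<^sup>r\<^sup>,\<^sup>q\<^sup>+\<^sup>s\<close>.\<close>

definition dH_component where
  "dH_component r s A H G J p q \<phi> x = spin_proj G J x (p + r) (q + s) (twisted_d A H \<phi> x)"

definition "N_plus = dH_component 3 3"
definition "N_minus = dH_component 3 (-3)"
definition "N_1 = dH_component (-1) 3"
definition "N_2 = dH_component 1 3"
definition "N_3 = dH_component 3 1"
definition "N_4 = dH_component 3 (-1)"

text \<open>\<open>N\<close> is one of the operators above; it vanishes if it is zero on all local sections of all
  \<open>U\<^sup>p\<^sup>,\<^sup>q\<close>.\<close>

definition torsion_vanishes where
  "torsion_vanishes N A H G J \<longleftrightarrow>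
     (\<forall>p q W. open W \<longrightarrow> (\<forall>\<phi> \<in> bigrade_sections A G J p q W.
        \<forall>x\<in>W. \<forall>vs. N A H G J p q \<phi> x vs = 0))"

end

theory Submission
  imports Defs "HOL-Library.Function_Algebras"
begin

text \<open>Write \<open>E\<close> for \<open>V\<^sub>+\<^sup>1\<^sup>,\<^sup>0\<close> or \<open>V\<^sub>-\<^sup>1\<^sup>,\<^sup>0\<close>, with \<open>s = 1\<close> or \<open>s = - 1\<close>. Clifford multiplication by \<open>E\<close> maps
  \<open>U\<^sup>p\<^sup>,\<^sup>q\<close> to \<open>U\<^sup>p\<^sup>+\<^sup>1\<^sup>,\<^sup>q\<^sup>+\<^sup>s\<close>, and \<open>\<lbrakk>v, w\<rbrakk>\<^sub>H\<close> acts on forms as the derived bracket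
  \<open>[{d\<^sup>H, v}, w]\<close>. If \<open>E\<close> is involutive, the latter shifts the bidegree by \<open>(1, s)\<close> only when
  \<open>v, w \<in> E\<close>. Comparing components, a downward induction on \<open>p + s q\<close> shows that the components of
  \<open>d\<^sup>H\<close> that lower the \<open>E\<close>-degree by at least two are killed by \<open>w v\<close> for all \<open>v, w \<in> E\<close>. They land
  at least two steps below the top of the \<open>E\<close>-grading, where this forces them to vanish. Without
  involutivity \<open>\<lbrakk>v, w\<rbrakk>\<^sub>H\<close> still shifts the bidegree only by \<open>(\<plusminus>1, \<plusminus>1)\<close>, and the same induction leaves
  exactly three lowering components; up to complex conjugation they are the torsion components of
  the theorem. Conversely, if these vanish then \<open>\<lbrakk>v, w\<rbrakk>\<^sub>H\<close> can only raise the \<open>E\<close>-degree, so it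
  lies in \<open>E\<close> because the Clifford action is faithful.

  The grading is handled through number operators \<open>N = \<Sum>\<^sub>k Q b\<^sub>k \<cdot> P b'\<^sub>k\<close> of a pair of mutually
  adjoint projections and dual frames \<open>b, b'\<close>. They satisfy \<open>[N, z] = Q z - P z\<close>, do not depend on
  the frame, and their eigenspaces are the spaces \<open>U\<^sup>k\<close>.\<close>

section \<open>Wedge products and alternating forms\<close>

text \<open>Put \<nu> = n - p - s q. On a nonzero U^{p,q} it is twice an eigenvalue of the number
  operator of \<open>E\<close>, hence an even natural number. This rests on tr G = 0; otherwise the
  eigenvalue would carry a further constant. An element of \<open>E\<close> lowers \<nu> by 2, and a
  component of d^H with shift (r, r') changes it by -(r + s r'). The threshold r + s r' \<le> -3
  thus leaves \<nu> \<ge> 3 behind, which by parity is at least two steps from the top; the shift -2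
  leaves only one and cannot be excluded this way.

  The obstacle is the passage between fibres and sections. Vanishing of a component of d^H is a
  statement about local sections, so the converse requires every vector of a fibre of U^{a,b} to
  extend to a local section of the same bidegree. Instead of local frames of the eigenbundles, the
  spectral decomposition of the number operators is used: a product of factors N - j annihilates
  every form, and this splits a smooth field of forms into smooth fields of eigenvectors. For this
  reason the eigenvalue lemmas are stated for an abstract scalar multiplication and cover single
  forms as well as fields.\<close>

lemma sum_fun_apply: "(\<Sum>i\<in>I. f i) x = (\<Sum>i\<in>I. f i x)"
  by (induction I rule: infinite_finite_induct) auto

definition cscale_form :: "complex \<Rightarrow> 'n mform \<Rightarrow> 'n mform" (infixr "*\<^sub>f" 75) where
  "a *\<^sub>f \<phi> = (\<lambda>vs. a * \<phi> vs)"

lemma cscale_form_apply [simp]: "(a *\<^sub>f \<phi>) vs = a * \<phi> vs"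
  by (simp add: cscale_form_def)

text \<open>Contraction with a real vector. A form is determined by its slots and its value on the
  empty list, so identities between forms are proved by peeling vectors off the front of the
  list.\<close>

definition slot :: "real^'n \<Rightarrow> 'n mform \<Rightarrow> 'n mform" where
  "slot v \<phi> = (\<lambda>vs. \<phi> (v # vs))"

lemma slot_apply: "slot v \<phi> vs = \<phi> (v # vs)"
  by (simp add: slot_def)

text \<open>The main involution of the exterior algebra. It carries the sign of the graded Leibniz
  rule, so inhomogeneous forms need not be split by degree.\<close>

definition grade_inv :: "'n mform \<Rightarrow> 'n mform" where
  "grade_inv \<phi> = (\<lambda>vs. (-1) ^ length vs * \<phi> vs)"

lemma form_eqI: "\<phi> [] = \<psi> [] \<Longrightarrow> (\<And>v. slot v \<phi> = slot v \<psi>) \<Longrightarrow> \<phi> = \<psi>"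
proof (rule ext)
  fix vs assume "\<phi> [] = \<psi> []" and s: "\<And>v. slot v \<phi> = slot v \<psi>"
  then show "\<phi> vs = \<psi> vs"
  proof (cases vs)
    case (Cons v ws)
    then show ?thesis using fun_cong[OF s[of v], of ws] by (simp add: slot_apply)
  qed auto
qed

lemma slot_linear [simp]:
  "slot v (\<phi> + \<psi>) = slot v \<phi> + slot v \<psi>" "slot v (\<phi> - \<psi>) = slot v \<phi> - slot v \<psi>"
  "slot v (a *\<^sub>f \<phi>) = a *\<^sub>f slot v \<phi>" "slot v (- \<phi>) = - slot v \<phi>" "slot v 0 = 0"
  by (auto simp: slot_def fun_eq_iff)

lemma slot_grade_inv: "slot v (grade_inv \<phi>) = - grade_inv (slot v \<phi>)"
  by (auto simp: slot_def grade_inv_def fun_eq_iff)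

lemma grade_inv_grade_inv [simp]: "grade_inv (grade_inv \<phi>) = \<phi>"
  by (auto simp: grade_inv_def fun_eq_iff simp flip: mult.assoc power_add)

lemma wedge_Nil [simp]: "wedge \<alpha> \<beta> [] = \<alpha> [] * \<beta> []"
  by (simp add: wedge_def)

lemma Pow_lessThan_Suc:
  "Pow {..<Suc m} = (\<lambda>I. insert 0 (Suc ` I)) ` Pow {..<m} \<union> (`) Suc ` Pow {..<m}"
proof -
  have "Pow (Suc ` {..<m}) = (`) Suc ` Pow {..<m}"
    by (simp add: image_Pow_surj)
  then show ?thesis
    by (simp add: lessThan_Suc_eq_insert_0 Pow_insert image_image Un_commute)
qed

text \<open>The graded Leibniz rule for contraction. The shuffles are split by whether
  \<open>v\<close> is fed to \<open>\<alpha>\<close> or to \<open>\<beta>\<close>. In the second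
  case position 0 forms an inversion with each position in \<open>I\<close>, and these
  \<open>card I\<close> extra signs are what \<open>grade_inv\<close> records.\<close>

lemma wedge_Cons:
  "wedge \<alpha> \<beta> (v # vs) = wedge (slot v \<alpha>) \<beta> vs + wedge (grade_inv \<alpha>) (slot v \<beta>) vs"
proof -
  let ?m = "length vs"
  define T where "T = (\<lambda>us I. (-1::complex) ^ card {(i, j). i \<in> I \<and> j \<in> {..<length us} - I \<and> j < i}
       * \<alpha> (nths us I) * \<beta> (nths us (- I)))"
  let ?f = "\<lambda>I. insert 0 (Suc ` I)" and ?g = "(`) Suc"
  have inj: "inj_on ?f (Pow {..<?m})" "inj_on ?g (Pow {..<?m})"
  proof -
    have "?f I = ?f J \<Longrightarrow> I = J" for I J :: "nat set"
      by (metis Diff_insert_absorb image_iff inj_Suc inj_image_eq_iff nat.distinct(1))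
    then show "inj_on ?f (Pow {..<?m})" by (rule inj_onI)
    show "inj_on ?g (Pow {..<?m})" by (rule inj_onI) (simp add: inj_image_eq_iff)
  qed
  have "wedge \<alpha> \<beta> (v # vs) = (\<Sum>I\<in>Pow {..<Suc ?m}. T (v # vs) I)"
    unfolding wedge_def T_def by simp
  also have "\<dots> = (\<Sum>I\<in>?f ` Pow {..<?m}. T (v # vs) I) + (\<Sum>I\<in>?g ` Pow {..<?m}. T (v # vs) I)"
    unfolding Pow_lessThan_Suc by (rule sum.union_disjoint) auto
  also have "\<dots> = (\<Sum>I\<in>Pow {..<?m}. T (v # vs) (?f I)) + (\<Sum>I\<in>Pow {..<?m}. T (v # vs) (?g I))"
    by (simp only: sum.reindex[OF inj(1)] sum.reindex[OF inj(2)] o_def)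
  also have "(\<Sum>I\<in>Pow {..<?m}. T (v # vs) (?f I)) = wedge (slot v \<alpha>) \<beta> vs"
    unfolding wedge_def
  proof (rule sum.cong)
    fix I assume "I \<in> Pow {..<?m}"
    have 1: "{(i, j). i \<in> ?f I \<and> j \<in> {..<Suc ?m} - ?f I \<and> j < i} =
      (\<lambda>(i,j). (Suc i, Suc j)) ` {(i, j). i \<in> I \<and> j \<in> {..<?m} - I \<and> j < i}" (is "?A = ?h ` ?B")
    proof (rule set_eqI, clarify)
      fix i j show "(i, j) \<in> ?A \<longleftrightarrow> (i, j) \<in> ?h ` ?B"
        by (cases i; cases j) (auto simp: image_iff)
    qed
    have 2: "card ?A = card ?B"
      unfolding 1 by (rule card_image) (auto simp: inj_on_def)
    have 3: "nths (v # vs) (?f I) = v # nths vs I"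
    proof -
      have "{j. Suc j \<in> ?f I} = I" by auto
      then show ?thesis by (simp add: nths_Cons)
    qed
    have 4: "nths (v # vs) (- ?f I) = nths vs (- I)"
    proof -
      have "{j. Suc j \<in> - ?f I} = - I" by auto
      then show ?thesis by (simp add: nths_Cons)
    qed
    show "T (v # vs) (?f I) = (-1) ^ card {(i, j). i \<in> I \<and> j \<in> {..<?m} - I \<and> j < i}
       * slot v \<alpha> (nths vs I) * \<beta> (nths vs (- I))"
      unfolding T_def 3 4 using 2 by (simp add: slot_apply)
  qed simp
  also have "(\<Sum>I\<in>Pow {..<?m}. T (v # vs) (?g I)) = wedge (grade_inv \<alpha>) (slot v \<beta>) vs"
    unfolding wedge_def
  proof (rule sum.cong)
    fix I assume I: "I \<in> Pow {..<?m}"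
    then have fin: "finite I" by (auto intro: finite_subset)
    let ?B = "{(i, j). i \<in> I \<and> j \<in> {..<?m} - I \<and> j < i}"
    let ?A = "{(i, j). i \<in> Suc ` I \<and> j \<in> {..<Suc ?m} - Suc ` I \<and> j < i}"
    let ?h = "\<lambda>(i,j). (Suc i, Suc j)"
    have 1: "?A = ?h ` ?B \<union> (\<lambda>i. (Suc i, 0)) ` I"
    proof (rule set_eqI, clarify)
      fix i j show "(i, j) \<in> ?A \<longleftrightarrow> (i, j) \<in> ?h ` ?B \<union> (\<lambda>i. (Suc i, 0)) ` I"
        by (cases i; cases j) (auto simp: image_iff)
    qed
    have finB: "finite ?B"
      by (rule finite_subset[of _ "I \<times> {..<?m}"]) (use fin in auto)
    have 2: "card ?A = card ?B + card I"
    proof -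
      have "card ?A = card (?h ` ?B) + card ((\<lambda>i. (Suc i, 0::nat)) ` I)"
        unfolding 1 by (rule card_Un_disjoint[OF finite_imageI[OF finB] finite_imageI[OF fin]]) auto
      also have "card (?h ` ?B) = card ?B"
        by (rule card_image) (auto simp: inj_on_def)
      also have "card ((\<lambda>i. (Suc i, 0::nat)) ` I) = card I"
        by (rule card_image) (auto simp: inj_on_def)
      finally show ?thesis .
    qed
    have 3: "nths (v # vs) (?g I) = nths vs I"
    proof -
      have "{j. Suc j \<in> ?g I} = I" by auto
      then show ?thesis by (simp add: nths_Cons)
    qed
    have 4: "nths (v # vs) (- ?g I) = v # nths vs (- I)"
    proof -
      have "{j. Suc j \<in> - ?g I} = - I" by auto
      then show ?thesis by (auto simp: nths_Cons)
    qed
    have 5: "length (nths vs I) = card I"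
      unfolding length_nths by (rule arg_cong[where f=card]) (use I in auto)
    show "T (v # vs) (?g I) = (-1) ^ card ?B
       * grade_inv \<alpha> (nths vs I) * slot v \<beta> (nths vs (- I))"
      unfolding T_def 3 4 using 2 5 by (simp add: slot_apply grade_inv_def power_add)
  qed simp
  finally show ?thesis .
qed

lemma slot_wedge: "slot v (wedge \<alpha> \<beta>) = wedge (slot v \<alpha>) \<beta> + wedge (grade_inv \<alpha>) (slot v \<beta>)"
  by (auto simp: fun_eq_iff slot_apply wedge_Cons)

lemma wedge_linear:
  "wedge \<alpha> (\<phi> + \<psi>) = wedge \<alpha> \<phi> + wedge \<alpha> \<psi>" "wedge \<alpha> (\<phi> - \<psi>) = wedge \<alpha> \<phi> - wedge \<alpha> \<psi>"
  "wedge \<alpha> (- \<phi>) = - wedge \<alpha> \<phi>"  "wedge \<alpha> (a *\<^sub>f \<phi>) = a *\<^sub>f wedge \<alpha> \<phi>"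
  "wedge (\<alpha> + \<beta>) \<phi> = wedge \<alpha> \<phi> + wedge \<beta> \<phi>" "wedge (\<alpha> - \<beta>) \<phi> = wedge \<alpha> \<phi> - wedge \<beta> \<phi>"
  "wedge (- \<alpha>) \<phi> = - wedge \<alpha> \<phi>" "wedge (a *\<^sub>f \<alpha>) \<phi> = a *\<^sub>f wedge \<alpha> \<phi>"
  "wedge 0 \<phi> = 0" "wedge \<alpha> 0 = 0"
  by (auto simp: fun_eq_iff wedge_def algebra_simps sum.distrib sum_subtractf sum_distrib_left sum_negf)

definition covec_app :: "complex^'n \<Rightarrow> real^'n::finite \<Rightarrow> complex" where
  "covec_app \<xi> v = (\<Sum>i\<in>UNIV. \<xi> $ i * of_real (v $ i))"

abbreviation wed :: "complex^'n \<Rightarrow> 'n::finite mform \<Rightarrow> 'n mform" where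
  "wed \<xi> \<phi> \<equiv> wedge (covec_form \<xi>) \<phi>"

text \<open>The constant function 1 as a form of degree zero, the unit of the wedge product.\<close>

definition one_form0 :: "'n mform" where "one_form0 vs = (if vs = [] then 1 else 0)"

lemma slot_one_form0 [simp]: "slot v one_form0 = 0"
  by (auto simp: slot_def one_form0_def fun_eq_iff)

lemma grade_inv_one_form0 [simp]: "grade_inv one_form0 = one_form0"
  by (auto simp: grade_inv_def one_form0_def fun_eq_iff)

lemma slot_covec_form: "slot v (covec_form \<xi>) = covec_app \<xi> v *\<^sub>f one_form0"
  by (auto simp: slot_def covec_form_def one_form0_def covec_app_def fun_eq_iff split: list.splits)

lemma covec_form_Nil [simp]: "covec_form \<xi> [] = 0"
  by (simp add: covec_form_def)

lemma grade_inv_covec_form: "grade_inv (covec_form \<xi>) = - covec_form \<xi>"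
  by (auto simp: grade_inv_def covec_form_def fun_eq_iff split: list.splits)

lemma wedge_one_form0: "wedge one_form0 (\<phi> :: 'n::finite mform) = \<phi>"
proof
  fix vs show "wedge one_form0 \<phi> vs = \<phi> vs"
  proof (induction vs arbitrary: \<phi>)
    case Nil show ?case by (simp add: one_form0_def)
  next
    case (Cons v vs) then show ?case by (simp add: wedge_Cons wedge_linear slot_apply)
  qed
qed

lemma slot_wed: "slot v (wed \<xi> \<phi>) = covec_app \<xi> v *\<^sub>f \<phi> - wed \<xi> (slot v \<phi>)"
  by (simp add: slot_wedge slot_covec_form grade_inv_covec_form wedge_linear wedge_one_form0)

text \<open>Carrying a covector across \<open>\<alpha>\<close> costs one sign per degree of
  \<open>\<alpha>\<close>. Both sides obey the same Leibniz rule, so they agree by induction on the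
  argument list.\<close>

lemma wedge_wed: "wedge \<alpha> (wed \<xi> \<phi>) = wed \<xi> (wedge (grade_inv \<alpha>) \<phi>)"
proof
  fix vs show "wedge \<alpha> (wed \<xi> \<phi>) vs = wed \<xi> (wedge (grade_inv \<alpha>) \<phi>) vs"
  proof (induction vs arbitrary: \<alpha> \<phi>)
    case Nil show ?case by simp
  next
    case (Cons v vs)
    show ?case
      using Cons[of "slot v \<alpha>" \<phi>] Cons[of "grade_inv \<alpha>" "slot v \<phi>"]
      by (simp add: wedge_Cons slot_wed slot_wedge slot_covec_form grade_inv_covec_form
          slot_grade_inv wedge_linear wedge_one_form0)
  qed
qed

lemma wed_anticomm: "wed \<xi> (wed \<eta> \<phi>) = - wed \<eta> (wed \<xi> \<phi>)"
  by (subst wedge_wed) (simp add: grade_inv_covec_form wedge_linear)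

section \<open>Alternating forms, tested on their first arguments\<close>

lemma alt_formD:
  assumes "alt_form \<phi>"
  shows "linear (\<lambda>x. \<phi> (x # vs))" "\<phi> (x # y # vs) = - \<phi> (y # x # vs)" "alt_form (slot v \<phi>)"
proof -
  have lin: "linear (\<lambda>x. \<phi> (us @ x # vs))" and z: "\<phi> (us @ x # vs @ x # ws) = 0" for us vs ws x
    using assms unfolding alt_form_def by blast+
  show l: "linear (\<lambda>x. \<phi> (x # vs))" for vs using lin[of "[]" vs] by simp
  have l2: "linear (\<lambda>y. \<phi> (x # y # vs))" for vs x using lin[of "[x]" vs] by simp
  have z2: "\<phi> (x # x # vs) = 0" for x vs using z[of "[]" x "[]" vs] by simp
  have "\<phi> ((x + y) # (x + y) # vs) = \<phi> (x # x # vs) + \<phi> (x # y # vs) + (\<phi> (y # x # vs) + \<phi> (y # y # vs))"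
    by (simp only: linear_add[OF l] linear_add[OF l2] add_ac)
  then have "\<phi> (x # y # vs) + \<phi> (y # x # vs) = 0"
    by (simp only: z2) simp
  then show "\<phi> (x # y # vs) = - \<phi> (y # x # vs)" by (simp add: add_eq_0_iff)
  show "alt_form (slot v \<phi>)"
    unfolding alt_form_def slot_apply using lin[of "v # _"] z[of "v # _"] by auto
qed

text \<open>Inserting vectors at the front moves any position of the argument list to the first or
  second place. If a class of forms is stable under this operation, linearity in the first argument
  and antisymmetry in the first two suffice; two equal vectors far apart are brought together by
  transpositions.\<close>

lemma alt_form_coinduct:
  assumes "X \<phi>"
    and "\<And>\<phi> v. X \<phi> \<Longrightarrow> X (slot v \<phi>)" and lin: "\<And>\<phi> vs. X \<phi> \<Longrightarrow> linear (\<lambda>x. \<phi> (x # vs))"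
    and anti: "\<And>\<phi> x y vs. X \<phi> \<Longrightarrow> \<phi> (x # y # vs) = - \<phi> (y # x # vs)"
  shows "alt_form \<phi>"
proof -
  have 1: "linear (\<lambda>x. \<phi> (us @ x # vs))" if "X \<phi>" for us vs \<phi>
    using that
  proof (induction us arbitrary: \<phi>)
    case Nil then show ?case by (simp add: lin)
  next
    case (Cons a us) then show ?case using Cons.IH[OF assms(2)[OF Cons.prems, of a]] by (simp add: slot_apply)
  qed
  have 2: "\<phi> (x # vs @ x # ws) = 0" if "X \<phi>" for x vs ws \<phi>
    using that
  proof (induction vs arbitrary: \<phi>)
    case Nil then show ?case using anti[of \<phi> x x ws] by simp
  next
    case (Cons a us) then show ?case
      using Cons.IH[OF assms(2)[OF Cons.prems, of a]] anti[OF Cons.prems, of x a] by (simp add: slot_apply)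
  qed
  have 3: "\<phi> (us @ x # vs @ x # ws) = 0" if "X \<phi>" for us x vs ws \<phi>
    using that
  proof (induction us arbitrary: \<phi>)
    case Nil then show ?case by (simp add: 2)
  next
    case (Cons a us) then show ?case using Cons.IH[OF assms(2)[OF Cons.prems, of a]] by (simp add: slot_apply)
  qed
  show ?thesis unfolding alt_form_def using 1 3 assms(1) by blast
qed

lemma alt_form_0 [simp]: "alt_form 0"
  by (auto simp: alt_form_def linear_iff)

lemma alt_form_linear:
  assumes "alt_form \<phi>" "alt_form \<psi>"
  shows "alt_form (\<phi> + \<psi>)" "alt_form (\<phi> - \<psi>)" "alt_form (a *\<^sub>f \<phi>)" "alt_form (- \<phi>)"
  using assms
  by (auto simp: alt_form_def linear_iff algebra_simps)

lemma alt_form_sum: "(\<And>i. i \<in> I \<Longrightarrow> alt_form (f i)) \<Longrightarrow> alt_form (\<Sum>i\<in>I. f i)"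
  by (induction I rule: infinite_finite_induct) (auto intro: alt_form_linear)

lemma slot_add: "alt_form \<phi> \<Longrightarrow> slot (x + y) \<phi> = slot x \<phi> + slot y \<phi>"
  by (auto simp: fun_eq_iff slot_apply linear_add[OF alt_formD(1)])

lemma slot_scale: "alt_form \<phi> \<Longrightarrow> slot (r *\<^sub>R x) \<phi> = of_real r *\<^sub>f slot x \<phi>"
  using linear_scale[OF alt_formD(1)]
  by (auto simp: fun_eq_iff slot_apply scaleR_conv_of_real)

lemma slot_slot: "alt_form \<phi> \<Longrightarrow> slot x (slot y \<phi>) = - slot y (slot x \<phi>)"
  using alt_formD(2) by (auto simp: fun_eq_iff slot_apply)

text \<open>Applies the previous criterion to the class consisting of \<open>\<phi>\<close> and all
  alternating forms, which is stable because every slot of \<open>\<phi>\<close> alternates.\<close>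

lemma alt_form_slotI:
  assumes "\<And>v. alt_form (slot v \<phi>)" "\<And>x y. slot (x + y) \<phi> = slot x \<phi> + slot y \<phi>"
    "\<And>r x. slot (r *\<^sub>R x) \<phi> = of_real r *\<^sub>f slot x \<phi>"
    "\<And>x y. slot x (slot y \<phi>) = - slot y (slot x \<phi>)"
  shows "alt_form \<phi>"
proof (rule alt_form_coinduct[where X = "\<lambda>\<psi>. \<psi> = \<phi> \<or> alt_form \<psi>"])
  show "linear (\<lambda>x. \<psi> (x # vs))" if "\<psi> = \<phi> \<or> alt_form \<psi>" for \<psi> vs
    using that alt_formD(1) fun_cong[OF assms(2), of _ _ vs] fun_cong[OF assms(3), of _ _ vs]
    by (auto simp: linear_iff slot_apply scaleR_conv_of_real)
  show "\<psi> (x # y # vs) = - \<psi> (y # x # vs)" if "\<psi> = \<phi> \<or> alt_form \<psi>" for \<psi> vs x y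
    using that alt_formD(2) fun_cong[OF assms(4), of y x vs] by (auto simp: slot_apply)
  show "slot v \<psi> = \<phi> \<or> alt_form (slot v \<psi>)" if "\<psi> = \<phi> \<or> alt_form \<psi>" for \<psi> v
    using that assms(1) alt_formD(3) by blast
qed simp

lemma covec_app_linear: "covec_app \<xi> (x + y) = covec_app \<xi> x + covec_app \<xi> y"
  "covec_app \<xi> (r *\<^sub>R x) = of_real r * covec_app \<xi> x"
  by (auto simp: covec_app_def algebra_simps sum.distrib sum_distrib_left)

lemma cscale_form_simps:
  "(a + b) *\<^sub>f \<phi> = a *\<^sub>f \<phi> + b *\<^sub>f \<phi>" "a *\<^sub>f (\<phi> + \<psi>) = a *\<^sub>f \<phi> + a *\<^sub>f \<psi>"
  "(a - b) *\<^sub>f \<phi> = a *\<^sub>f \<phi> - b *\<^sub>f \<phi>" "a *\<^sub>f (\<phi> - \<psi>) = a *\<^sub>f \<phi> - a *\<^sub>f \<psi>"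
  "a *\<^sub>f (b *\<^sub>f \<phi>) = (a * b) *\<^sub>f \<phi>" "1 *\<^sub>f \<phi> = \<phi>" "0 *\<^sub>f \<phi> = 0" "a *\<^sub>f 0 = 0" "a *\<^sub>f (- \<phi>) = - (a *\<^sub>f \<phi>)"
  "(- a) *\<^sub>f \<phi> = - (a *\<^sub>f \<phi>)"
  by (auto simp: fun_eq_iff algebra_simps)

lemma cscale_form_sum: "a *\<^sub>f (\<Sum>i\<in>I. f i) = (\<Sum>i\<in>I. a *\<^sub>f f i)"
  by (auto simp: fun_eq_iff sum_fun_apply sum_distrib_left)

text \<open>A slot of a wedge product is a sum of two wedge products, so single products are not a
  stable class; finite sums of products of alternating forms are.\<close>

lemma alt_form_wedge:
  assumes "alt_form \<alpha>" "alt_form \<phi>"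
  shows "alt_form (wedge \<alpha> \<phi>)"
proof (rule alt_form_coinduct[where X =
    "\<lambda>\<psi>. \<exists>(m::nat) a f. (\<forall>i<m. alt_form (a i) \<and> alt_form (f i)) \<and> \<psi> = (\<Sum>i<m. wedge (a i) (f i))"])
  have gi: "alt_form (grade_inv \<psi>)" if "alt_form \<psi>" for \<psi> :: "'a mform"
    using that unfolding alt_form_def grade_inv_def linear_iff
    by (auto simp: algebra_simps)
  show "\<exists>(m::nat) a f. (\<forall>i<m. alt_form (a i) \<and> alt_form (f i)) \<and> wedge \<alpha> \<phi> = (\<Sum>i<m. wedge (a i) (f i))"
    by (rule exI[of _ 1], rule exI[of _ "\<lambda>_. \<alpha>"], rule exI[of _ "\<lambda>_. \<phi>"]) (use assms in auto)
  fix \<psi> :: "'a mform"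
  assume "\<exists>(m::nat) a f. (\<forall>i<m. alt_form (a i) \<and> alt_form (f i)) \<and> \<psi> = (\<Sum>i<m. wedge (a i) (f i))"
  then obtain m :: nat and a f where af: "\<And>i. i < m \<Longrightarrow> alt_form (a i)" "\<And>i. i < m \<Longrightarrow> alt_form (f i)"
    and psi: "\<psi> = (\<Sum>i<m. wedge (a i) (f i))" by blast
  have sl: "slot v \<psi> = (\<Sum>i<m. wedge (slot v (a i)) (f i) + wedge (grade_inv (a i)) (slot v (f i)))" for v
    by (auto simp: psi fun_eq_iff slot_apply sum_fun_apply wedge_Cons)
  show "\<exists>(m::nat) a f. (\<forall>i<m. alt_form (a i) \<and> alt_form (f i)) \<and> slot v \<psi> = (\<Sum>i<m. wedge (a i) (f i))" for v
  proof (intro exI conjI)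
    let ?a = "\<lambda>i. if i < m then slot v (a i) else grade_inv (a (i - m))"
    let ?f = "\<lambda>i. if i < m then f i else slot v (f (i - m))"
    show "\<forall>i<m + m. alt_form (?a i) \<and> alt_form (?f i)"
      using af alt_formD(3) gi by auto
    have "(\<Sum>i<m + m. wedge (?a i) (?f i)) =
      (\<Sum>i<m. wedge (?a i) (?f i)) + (\<Sum>i\<in>{m..<m + m}. wedge (?a i) (?f i))"
      using sum.atLeastLessThan_concat[of 0 m "m + m" "\<lambda>i. wedge (?a i) (?f i)"] by (simp add: atLeast0LessThan)
    also have "(\<Sum>i\<in>{m..<m + m}. wedge (?a i) (?f i)) = (\<Sum>i<m. wedge (grade_inv (a i)) (slot v (f i)))"
      using sum.shift_bounds_nat_ivl[of "\<lambda>i. wedge (?a i) (?f i)" 0 m m] by (simp add: atLeast0LessThan)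
    also have "(\<Sum>i<m. wedge (?a i) (?f i)) = (\<Sum>i<m. wedge (slot v (a i)) (f i))"
      by (intro sum.cong) auto
    finally show "slot v \<psi> = (\<Sum>i<m + m. wedge (?a i) (?f i))"
      by (simp only: sl sum.distrib)
  qed
  show "linear (\<lambda>x. \<psi> (x # vs))" for vs
  proof -
    have "linear (\<lambda>x. slot x \<psi> vs)"
      unfolding sl sum_fun_apply plus_fun_apply
    proof (rule linear_compose_sum, rule ballI, rule linear_compose_add)
      fix i assume "i \<in> {..<m}"
      then have "alt_form (a i)" "alt_form (f i)" using af by auto
      then show "linear (\<lambda>x. wedge (slot x (a i)) (f i) vs)"
        "linear (\<lambda>x. wedge (grade_inv (a i)) (slot x (f i)) vs)"
        by (auto intro!: linearI simp: slot_add slot_scale wedge_linear scaleR_conv_of_real[where 'a = complex])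
    qed
    then show ?thesis by (simp add: slot_apply)
  qed
  show "\<psi> (x # y # vs) = - \<psi> (y # x # vs)" for x y vs
  proof -
    have "slot y (slot x \<psi>) vs = - slot x (slot y \<psi>) vs"
    proof -
      have s: "slot v (\<Sum>i<m. g i) = (\<Sum>i<m. slot v (g i))" for v and g :: "nat \<Rightarrow> 'a mform"
        by (auto simp: fun_eq_iff slot_apply sum_fun_apply)
      \<comment> \<open>The two mixed terms trade places with opposite sign when \<open>x\<close>
        and \<open>y\<close> are exchanged; the outer terms change sign because the factors
        themselves alternate.\<close>
      have "slot y (slot x \<psi>) = (\<Sum>i<m. wedge (slot y (slot x (a i))) (f i)
         + wedge (grade_inv (slot x (a i))) (slot y (f i)) - wedge (grade_inv (slot y (a i))) (slot x (f i))
         + wedge (a i) (slot y (slot x (f i))))" for x y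
        unfolding sl s by (intro sum.cong) (auto simp: slot_wedge slot_grade_inv wedge_linear algebra_simps fun_eq_iff)
      note e = this
      have "slot y (slot x \<psi>) + slot x (slot y \<psi>) = 0"
        unfolding e sum.distrib[symmetric]
      proof (rule sum.neutral, rule ballI)
        fix i assume "i \<in> {..<m}"
        then have "alt_form (a i)" "alt_form (f i)" using af by auto
        then show "wedge (slot y (slot x (a i))) (f i)
         + wedge (grade_inv (slot x (a i))) (slot y (f i)) - wedge (grade_inv (slot y (a i))) (slot x (f i))
         + wedge (a i) (slot y (slot x (f i))) +
         (wedge (slot x (slot y (a i))) (f i)
         + wedge (grade_inv (slot y (a i))) (slot x (f i)) - wedge (grade_inv (slot x (a i))) (slot y (f i))
         + wedge (a i) (slot x (slot y (f i)))) = 0"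
          by (simp add: slot_slot[of _ y x] wedge_linear fun_eq_iff)
      qed
      then show ?thesis by (metis add_eq_0_iff fun_Compl_def minus_apply uminus_apply add.commute)
    qed
    then show ?thesis by (simp add: slot_apply)
  qed
qed

section \<open>The Clifford action\<close>

text \<open>Inside inductions the simplifier eta-expands equations between forms; with these rules active it
  would then evaluate both sides pointwise.\<close>

lemmas form_pt = plus_fun_apply zero_fun_apply minus_apply uminus_apply cscale_form_apply

declare form_pt [simp del]

lemma contract_eq: "contract X \<phi> = slot (Re_vec X) \<phi> + \<i> *\<^sub>f slot (Im_vec X) \<phi>"
  by (auto simp: contract_def fun_eq_iff form_pt slot_apply)

lemma clifford_eq: "clifford z \<phi> = contract (fst z) \<phi> + wed (snd z) \<phi>"
  by (auto simp: clifford_def fun_eq_iff form_pt)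

lemma Re_vec_simps:
  "Re_vec (X + Y) = Re_vec X + Re_vec Y" "Im_vec (X + Y) = Im_vec X + Im_vec Y"
  "Re_vec (a *s X) = Re a *\<^sub>R Re_vec X + (- Im a) *\<^sub>R Im_vec X"
  "Im_vec (a *s X) = Im a *\<^sub>R Re_vec X + Re a *\<^sub>R Im_vec X"
  by (auto simp: Re_vec_def Im_vec_def vec_eq_iff)

text \<open>Twice the complex bilinear extension of \<open>pairing\<close>; with this normalisation
  the anticommutator of two Clifford multiplications is exactly the scalar
  \<open>cpair z w\<close>.\<close>

definition cpair :: "(complex, 'n) gtan \<Rightarrow> (complex, 'n::finite) gtan \<Rightarrow> complex" where
  "cpair z w = (\<Sum>i\<in>UNIV. snd w $ i * fst z $ i + snd z $ i * fst w $ i)"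

lemma cpair_commute: "cpair z w = cpair w z"
  by (simp add: cpair_def add.commute)

lemma cpair_linear:
  "cpair (z + w) u = cpair z u + cpair w u" "cpair u (z + w) = cpair u z + cpair u w"
  "cpair (z - w) u = cpair z u - cpair w u" "cpair u (z - w) = cpair u z - cpair u w"
  "cpair (- w) u = - cpair w u" "cpair u (- w) = - cpair u w"
  "cpair 0 u = 0" "cpair u 0 = 0"
  "cpair (cscale_gt a z) u = a * cpair z u" "cpair u (cscale_gt a z) = a * cpair u z"
  by (auto simp: cpair_def cscale_gt_def algebra_simps sum.distrib sum_distrib_left sum_subtractf sum_negf)

lemma cscale_gt_simps:
  "cscale_gt (a + b) z = cscale_gt a z + cscale_gt b z" "cscale_gt a (z + w) = cscale_gt a z + cscale_gt a w"
  "cscale_gt (a - b) z = cscale_gt a z - cscale_gt b z" "cscale_gt a (z - w) = cscale_gt a z - cscale_gt a w"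
  "cscale_gt a (cscale_gt b z) = cscale_gt (a * b) z" "cscale_gt 1 z = z" "cscale_gt 0 z = 0" "cscale_gt a 0 = 0"
  "cscale_gt a (- z) = - cscale_gt a z" "cscale_gt (- a) z = - cscale_gt a z"
  by (auto simp: cscale_gt_def prod_eq_iff vec_eq_iff algebra_simps)

lemma clifford_linear:
  "clifford z (\<phi> + \<psi>) = clifford z \<phi> + clifford z \<psi>" "clifford z (\<phi> - \<psi>) = clifford z \<phi> - clifford z \<psi>"
  "clifford z (a *\<^sub>f \<phi>) = a *\<^sub>f clifford z \<phi>" "clifford z (- \<phi>) = - clifford z \<phi>" "clifford z 0 = 0"
  by (auto simp: clifford_eq contract_eq wedge_linear cscale_form_simps fun_eq_iff form_pt algebra_simps)

lemma clifford_sum: "clifford z (\<Sum>i\<in>I. f i) = (\<Sum>i\<in>I. clifford z (f i))"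
  by (induction I rule: infinite_finite_induct) (auto simp: clifford_linear)

lemma covec_form_linear: "covec_form (\<xi> + \<eta>) = covec_form \<xi> + covec_form \<eta>"
  "covec_form (a *s \<xi>) = a *\<^sub>f covec_form \<xi>"
  by (auto simp: covec_form_def fun_eq_iff form_pt algebra_simps sum.distrib sum_distrib_left split: list.splits)

lemma contract_linear_left:
  assumes "alt_form \<phi>"
  shows "contract (X + Y) \<phi> = contract X \<phi> + contract Y \<phi>" "contract (a *s X) \<phi> = a *\<^sub>f contract X \<phi>"
  by (simp_all only: contract_eq Re_vec_simps slot_add[OF assms] slot_scale[OF assms])
    (simp_all add: fun_eq_iff form_pt algebra_simps complex_eq_iff)

lemma clifford_linear_left:
  assumes "alt_form \<phi>"
  shows "clifford (z + w) \<phi> = clifford z \<phi> + clifford w \<phi>"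
    "clifford (cscale_gt a z) \<phi> = a *\<^sub>f clifford z \<phi>"
    "clifford 0 \<phi> = 0"
    "clifford (- z) \<phi> = - clifford z \<phi>"
    "clifford (z - w) \<phi> = clifford z \<phi> - clifford w \<phi>"
proof -
  show 1: "clifford (z + w) \<phi> = clifford z \<phi> + clifford w \<phi>" for z w
    by (simp add: clifford_eq contract_linear_left[OF assms] covec_form_linear wedge_linear cscale_form_simps algebra_simps)
  show 2: "clifford (cscale_gt a z) \<phi> = a *\<^sub>f clifford z \<phi>" for a z
    by (simp add: clifford_eq contract_linear_left[OF assms] covec_form_linear wedge_linear
        cscale_gt_def cscale_form_simps)
  show "clifford 0 \<phi> = 0"
    using 2[of 0 0] by (simp add: cscale_form_simps cscale_gt_simps)
  show 4: "clifford (- z) \<phi> = - clifford z \<phi>" for z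
    using 2[of "-1" z] by (simp add: cscale_form_simps cscale_gt_simps)
  show "clifford (z - w) \<phi> = clifford z \<phi> - clifford w \<phi>"
    using 1[of z "- w"] 4[of w] by simp
qed

lemma clifford_sum_left:
  "alt_form \<phi> \<Longrightarrow> clifford (\<Sum>i\<in>I. f i) \<phi> = (\<Sum>i\<in>I. clifford (f i) \<phi>)"
  by (induction I rule: infinite_finite_induct) (auto simp: clifford_linear_left)

lemma alt_form_covec_form [simp]: "alt_form (covec_form \<xi>)"
proof (rule alt_form_slotI)
  have one: "alt_form one_form0"
    by (auto simp: alt_form_def one_form0_def linear_iff)
  show "alt_form (slot v (covec_form \<xi>))" for v
    unfolding slot_covec_form by (rule alt_form_linear(3)[OF one one])
qed (auto simp: slot_covec_form covec_app_linear cscale_form_simps)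

lemma alt_form_clifford [simp]: "alt_form \<phi> \<Longrightarrow> alt_form (clifford z \<phi>)"
  unfolding clifford_eq contract_eq
  by (intro alt_form_linear(1,3) alt_formD(3) alt_form_wedge alt_form_covec_form) auto

lemma covec_app_Re_Im: "covec_app \<xi> (Re_vec X) + \<i> * covec_app \<xi> (Im_vec X) = (\<Sum>i\<in>UNIV. \<xi> $ i * X $ i)"
proof -
  have "\<xi> $ i * of_real (Re_vec X $ i) + \<i> * (\<xi> $ i * of_real (Im_vec X $ i)) = \<xi> $ i * X $ i" for i
    by (simp add: Re_vec_def Im_vec_def complex_eq_iff)
  then show ?thesis
    by (simp add: covec_app_def sum_distrib_left flip: sum.distrib)
qed

lemma contract_wed:
  "contract X (wed \<xi> \<phi>) = (\<Sum>i\<in>UNIV. \<xi> $ i * X $ i) *\<^sub>f \<phi> - wed \<xi> (contract X \<phi>)"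
  unfolding covec_app_Re_Im[symmetric]
  by (simp add: contract_eq slot_wed wedge_linear cscale_form_simps algebra_simps)

lemma contract_linear:
  "contract X (\<phi> + \<psi>) = contract X \<phi> + contract X \<psi>" "contract X (\<phi> - \<psi>) = contract X \<phi> - contract X \<psi>"
  "contract X (a *\<^sub>f \<phi>) = a *\<^sub>f contract X \<phi>" "contract X (- \<phi>) = - contract X \<phi>"
  by (auto simp: contract_eq fun_eq_iff form_pt algebra_simps)

lemma contract_contract:
  assumes "alt_form \<phi>"
  shows "contract X (contract Y \<phi>) = - contract Y (contract X \<phi>)"
  by (simp add: contract_eq slot_slot[OF assms, of "Re_vec X"] slot_slot[OF assms, of "Im_vec X"]
      cscale_form_simps algebra_simps)

text \<open>Contractions anticommute with each other, and so do covectors; a contraction passes a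
  covector leaving behind the evaluation, so only the two mixed terms survive.\<close>

theorem clifford_relation:
  assumes "alt_form \<phi>"
  shows "clifford z (clifford w \<phi>) + clifford w (clifford z \<phi>) = cpair z w *\<^sub>f \<phi>"
proof -
  have 1: "wed \<xi> (wed \<eta> \<phi>) + wed \<eta> (wed \<xi> \<phi>) = 0" for \<xi> \<eta>
    by (simp add: wed_anticomm[of \<xi> \<eta>])
  have 2: "contract X (contract Y \<phi>) + contract Y (contract X \<phi>) = 0" for X Y
    by (simp add: contract_contract[OF assms, of X Y])
  have "clifford z (clifford w \<phi>) + clifford w (clifford z \<phi>) =
    (contract (fst z) (contract (fst w) \<phi>) + contract (fst w) (contract (fst z) \<phi>)) +
    (wed (snd z) (wed (snd w) \<phi>) + wed (snd w) (wed (snd z) \<phi>)) +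
    ((\<Sum>i\<in>UNIV. snd w $ i * fst z $ i) *\<^sub>f \<phi> + (\<Sum>i\<in>UNIV. snd z $ i * fst w $ i) *\<^sub>f \<phi>)"
    by (simp add: clifford_eq contract_linear wedge_linear contract_wed algebra_simps)
  also have "\<dots> = cpair z w *\<^sub>f \<phi>"
    by (simp only: 1 2 cpair_def sum.distrib cscale_form_simps) simp
  finally show ?thesis .
qed

lemma clifford_swap:
  "alt_form \<phi> \<Longrightarrow> clifford z (clifford w \<phi>) = cpair z w *\<^sub>f \<phi> - clifford w (clifford z \<phi>)"
  using clifford_relation[of \<phi> z w] by (simp add: eq_diff_eq)

text \<open>Acting on the constant 1 exhibits the covector part; acting on the coordinate one-forms
  then exhibits the components of the vector part in degree zero.\<close>

lemma clifford_faithful: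
  assumes "\<And>\<phi>. alt_form \<phi> \<Longrightarrow> clifford z \<phi> = 0"
  shows "z = 0"
proof -
  have one: "alt_form one_form0"
    by (auto simp: alt_form_def one_form0_def linear_iff)
  have cl0: "clifford z one_form0 = covec_form (snd z)"
  proof -
    have "wedge (covec_form \<xi>) one_form0 = covec_form \<xi>" for \<xi> :: "complex^'n"
      by (rule form_eqI) (auto simp: slot_wed slot_covec_form wedge_linear)
    then show ?thesis by (simp add: clifford_eq contract_eq cscale_form_simps)
  qed
  have "snd z $ i = 0" for i
  proof -
    have "covec_form (snd z) [axis i 1] = 0" using cl0 assms[OF one] by (simp add: zero_fun_apply)
    then have "(\<Sum>j\<in>UNIV. snd z $ j * of_real (axis i 1 $ j)) = 0" by (simp add: covec_form_def)
    moreover have "snd z $ j * of_real (axis i 1 $ j) = (if j = i then snd z $ i else 0)" for j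
      by (simp add: axis_def)
    ultimately show ?thesis by simp
  qed
  then have s: "snd z = 0" by (simp add: vec_eq_iff)
  have "fst z $ i = 0" for i
  proof -
    have "clifford z (covec_form (axis i 1)) [] = 0" using assms[OF alt_form_covec_form] by (simp add: zero_fun_apply)
    then have "covec_app (axis i 1) (Re_vec (fst z)) + \<i> * covec_app (axis i 1) (Im_vec (fst z)) = 0"
      by (simp add: clifford_eq contract_eq slot_covec_form one_form0_def form_pt)
    then have "(\<Sum>j\<in>UNIV. axis i 1 $ j * fst z $ j) = 0" by (simp only: covec_app_Re_Im)
    moreover have "axis i 1 $ j * fst z $ j = (if j = i then fst z $ i else 0)" for j
      by (simp add: axis_def)
    ultimately show ?thesis by simp
  qed
  then show ?thesis using s by (simp add: prod_eq_iff vec_eq_iff)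
qed


section \<open>Number operators\<close>

type_synonym 'n gframe = "bool \<times> 'n \<Rightarrow> (complex, 'n) gtan"

definition gt_basis :: "'n::finite gframe" where
  "gt_basis k = (if fst k then (axis (snd k) 1, 0) else (0, axis (snd k) 1))"

text \<open>The frame dual to \<open>gt_basis\<close> for \<open>cpair\<close>, which pairs each
  coordinate vector with its own coordinate covector.\<close>

definition gt_cobasis :: "'n::finite gframe" where
  "gt_cobasis k = gt_basis (\<not> fst k, snd k)"

definition dual_frames :: "'n::finite gframe \<Rightarrow> 'n gframe \<Rightarrow> bool" where
  "dual_frames b b' \<longleftrightarrow> (\<forall>z. (\<Sum>k\<in>UNIV. cscale_gt (cpair (b' k) z) (b k)) = z \<and>
     (\<Sum>k\<in>UNIV. cscale_gt (cpair (b k) z) (b' k)) = z)"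

lemma dual_framesD:
  assumes "dual_frames b b'"
  shows "(\<Sum>k\<in>UNIV. cscale_gt (cpair (b' k) z) (b k)) = z" "(\<Sum>k\<in>UNIV. cscale_gt (cpair (b k) z) (b' k)) = z"
  using assms unfolding dual_frames_def by blast+

lemma dual_frames_swap: "dual_frames b b' \<Longrightarrow> dual_frames b' b"
  by (auto simp: dual_frames_def)

lemma sum_bool_prod: "(\<Sum>k\<in>UNIV. f k) = (\<Sum>i\<in>UNIV. f (True, i) + f (False, i))"
  for f :: "bool \<times> 'n::finite \<Rightarrow> 'b::comm_monoid_add"
proof -
  have "(\<Sum>k\<in>UNIV. f k) = (\<Sum>b\<in>UNIV. \<Sum>i\<in>UNIV. f (b, i))"
    by (simp add: sum.cartesian_product flip: UNIV_Times_UNIV)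
  also have "\<dots> = (\<Sum>i\<in>UNIV. f (True, i)) + (\<Sum>i\<in>UNIV. f (False, i))"
    by (simp add: UNIV_bool add.commute)
  finally show ?thesis by (simp add: sum.distrib)
qed

lemma sum_fst_snd: "fst (\<Sum>i\<in>I. f i) = (\<Sum>i\<in>I. fst (f i))" "snd (\<Sum>i\<in>I. f i) = (\<Sum>i\<in>I. snd (f i))"
  by (induction I rule: infinite_finite_induct) auto

lemma cpair_gt_basis: "cpair (gt_basis (True, i)) z = snd z $ i" "cpair (gt_basis (False, i)) z = fst z $ i"
proof -
  have 1: "y * axis i 1 $ j = (if j = i then y else 0)" "axis i 1 $ j * y = (if j = i then y else 0)"
    for y :: complex and j by (auto simp: axis_def)
  show "cpair (gt_basis (True, i)) z = snd z $ i" "cpair (gt_basis (False, i)) z = fst z $ i"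
    by (simp_all add: cpair_def gt_basis_def 1)
qed

lemma sum_axis: "(\<Sum>i\<in>UNIV. c i * axis i 1 $ j) = (c j :: 'b::comm_semiring_1)"
proof -
  have "c i * axis i 1 $ j = (if i = j then c j else 0)" for i by (auto simp: axis_def)
  then show ?thesis by simp
qed

lemma dual_frames_gt_basis: "dual_frames gt_basis gt_cobasis"
  unfolding dual_frames_def sum_bool_prod gt_cobasis_def fst_conv snd_conv cpair_gt_basis simp_thms
  by (auto simp: prod_eq_iff sum_fst_snd vec_eq_iff gt_basis_def cscale_gt_def sum_axis)

definition clin :: "((complex, 'n) gtan \<Rightarrow> (complex, 'n::finite) gtan) \<Rightarrow> bool" where
  "clin P \<longleftrightarrow> (\<forall>z w. P (z + w) = P z + P w) \<and> (\<forall>a z. P (cscale_gt a z) = cscale_gt a (P z))"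

lemma clinD:
  assumes "clin P"
  shows "P (z + w) = P z + P w" "P (cscale_gt a z) = cscale_gt a (P z)" "P 0 = 0"
    "P (- z) = - P z" "P (z - w) = P z - P w" "P (\<Sum>i\<in>I. f i) = (\<Sum>i\<in>I. P (f i))"
proof -
  show 1: "P (z + w) = P z + P w" for z w using assms unfolding clin_def by blast
  show 2: "P (cscale_gt a z) = cscale_gt a (P z)" for a z using assms unfolding clin_def by blast
  show 3: "P 0 = 0" using 2[of 0 0] by (simp add: cscale_gt_simps)
  show 4: "P (- z) = - P z" for z using 2[of "-1" z] by (simp add: cscale_gt_simps)
  show "P (z - w) = P z - P w" using 1[of z "- w"] 4[of w] by simp
  show "P (\<Sum>i\<in>I. f i) = (\<Sum>i\<in>I. P (f i))"
    by (induction I rule: infinite_finite_induct) (auto simp: 1 3)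
qed

text \<open>The fermionic number operator in normal order: \<open>P\<close> supplies the
  annihilators, which act first, and \<open>Q\<close> the matching creators.\<close>

definition number_op ::
  "'n gframe \<Rightarrow> 'n gframe \<Rightarrow> ((complex, 'n) gtan \<Rightarrow> (complex, 'n) gtan) \<Rightarrow>
   ((complex, 'n) gtan \<Rightarrow> (complex, 'n) gtan) \<Rightarrow> 'n::finite mform \<Rightarrow> 'n mform" where
  "number_op b b' P Q \<phi> = (\<Sum>k\<in>UNIV. clifford (Q (b k)) (clifford (P (b' k)) \<phi>))"

abbreviation "number \<equiv> number_op gt_basis gt_cobasis"

definition ctrace :: "((complex, 'n) gtan \<Rightarrow> (complex, 'n::finite) gtan) \<Rightarrow> complex" where
  "ctrace P = (\<Sum>k\<in>UNIV. cpair (P (gt_basis k)) (gt_cobasis k))"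

lemma number_op_linear:
  "number_op b b' P Q (\<phi> + \<psi>) = number_op b b' P Q \<phi> + number_op b b' P Q \<psi>"
  "number_op b b' P Q (a *\<^sub>f \<phi>) = a *\<^sub>f number_op b b' P Q \<phi>"
  "number_op b b' P Q 0 = 0"
  "number_op b b' P Q (\<phi> - \<psi>) = number_op b b' P Q \<phi> - number_op b b' P Q \<psi>"
  by (auto simp: number_op_def clifford_linear sum.distrib cscale_form_sum sum_subtractf)

lemma alt_form_number_op [simp]: "alt_form \<phi> \<Longrightarrow> alt_form (number_op b b' P Q \<phi>)"
  by (auto simp: number_op_def intro: alt_form_sum)

text \<open>The operator is the image of the canonical element, the sum of b_k \<otimes> b'_k, which
  is the same for all pairs of dual frames. On the manifold this permits a smooth coordinate frame
  in place of the frame of the arbitrarily chosen chart at each point.\<close>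

lemma tensor_frame_indep:
  assumes fr: "dual_frames b b'" "dual_frames c c'" and lin: "clin P" "clin Q" and alt: "alt_form \<phi>"
  shows "number_op b b' P Q \<phi> = number_op c c' P Q \<phi>"
proof -
  have e1: "b' k = (\<Sum>j\<in>UNIV. cscale_gt (cpair (c j) (b' k)) (c' j))" for k
    using dual_framesD(2)[OF fr(2)] by simp
  have e2: "(\<Sum>k\<in>UNIV. cscale_gt (cpair (b' k) (c j)) (b k)) = c j" for j
    using dual_framesD(1)[OF fr(1)] by simp
  have "number_op b b' P Q \<phi> = (\<Sum>k\<in>UNIV. \<Sum>j\<in>UNIV. cpair (c j) (b' k) *\<^sub>f clifford (Q (b k)) (clifford (P (c' j)) \<phi>))"
    unfolding number_op_def
    by (subst e1) (simp add: clinD[OF lin(1)] clifford_sum_left[OF alt] clifford_linear_left[OF alt]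
        clifford_sum clifford_linear)
  also have "\<dots> = (\<Sum>j\<in>UNIV. \<Sum>k\<in>UNIV. cpair (c j) (b' k) *\<^sub>f clifford (Q (b k)) (clifford (P (c' j)) \<phi>))"
    by (rule sum.swap)
  also have "\<dots> = (\<Sum>j\<in>UNIV. clifford (Q (\<Sum>k\<in>UNIV. cscale_gt (cpair (b' k) (c j)) (b k))) (clifford (P (c' j)) \<phi>))"
    by (simp add: clinD[OF lin(2)] clifford_sum_left alt clifford_linear_left cpair_commute)
  finally show ?thesis by (simp add: e2 number_op_def)
qed

text \<open>Projections onto an isotropic subspace and onto one dual to it. The two images need not
  span the fibre: the same locale covers the full eigenspaces of a complex structure and the smaller
  pair formed by \<open>E\<close> and its conjugate.\<close>

locale adj_pair =
  fixes P Q :: "(complex, 'n::finite) gtan \<Rightarrow> (complex, 'n) gtan"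
  assumes lin: "clin P" "clin Q"
    and adj: "cpair (P z) w = cpair z (Q w)"
    and idem: "P (P z) = P z" "Q (Q z) = Q z" and PQ: "P (Q z) = 0" and QP: "Q (P z) = 0"
begin

lemma swap: "adj_pair Q P"
proof
  show "cpair (Q z) w = cpair z (P w)" for z w
    using adj[of w z] by (simp add: cpair_commute)
qed (use lin idem PQ QP in auto)

lemma isotropic: "cpair (P z) (P w) = 0"
  by (simp add: adj QP cpair_linear)

text \<open>Moving \<open>z\<close> past the creator and the annihilator leaves one scalar
  contraction each; the dual frames resum these to \<open>Q (Q z)\<close> and
  \<open>P (P z)\<close>.\<close>

lemma number_clifford:
  assumes fr: "dual_frames b b'" and alt: "alt_form \<phi>"
  shows "number_op b b' P Q (clifford z \<phi>) = clifford z (number_op b b' P Q \<phi>) + clifford (Q z) \<phi> - clifford (P z) \<phi>"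
proof -
  have "clifford (Q (b k)) (clifford (P (b' k)) (clifford z \<phi>)) =
     clifford z (clifford (Q (b k)) (clifford (P (b' k)) \<phi>)) +
     clifford (cscale_gt (cpair (b' k) (Q z)) (Q (b k))) \<phi> - clifford (cscale_gt (cpair (b k) (P z)) (P (b' k))) \<phi>" for k
  proof -
    have "cpair (Q (b k)) z = cpair (b k) (P z)" using adj[of z "b k"] by (simp add: cpair_commute)
    then show ?thesis
      by (simp add: clifford_swap[OF alt, of "P (b' k)" z] clifford_swap[of "clifford (P (b' k)) \<phi>" "Q (b k)" z] alt
        clifford_linear clifford_linear_left[OF alt] adj algebra_simps)
  qed
  then have "number_op b b' P Q (clifford z \<phi>) = clifford z (number_op b b' P Q \<phi>)
     + clifford (\<Sum>k\<in>UNIV. cscale_gt (cpair (b' k) (Q z)) (Q (b k))) \<phi>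
     - clifford (\<Sum>k\<in>UNIV. cscale_gt (cpair (b k) (P z)) (P (b' k))) \<phi>"
    by (simp only: number_op_def clifford_sum clifford_sum_left[OF alt] sum.distrib sum_subtractf)
  also have "(\<Sum>k\<in>UNIV. cscale_gt (cpair (b' k) (Q z)) (Q (b k))) = Q (Q z)"
  proof -
    have "Q (Q z) = Q (\<Sum>k\<in>UNIV. cscale_gt (cpair (b' k) (Q z)) (b k))"
      using dual_framesD(1)[OF fr] by simp
    then show ?thesis by (simp add: clinD[OF lin(2)])
  qed
  also have "(\<Sum>k\<in>UNIV. cscale_gt (cpair (b k) (P z)) (P (b' k))) = P (P z)"
  proof -
    have "P (P z) = P (\<Sum>k\<in>UNIV. cscale_gt (cpair (b k) (P z)) (b' k))"
      using dual_framesD(2)[OF fr] by simp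
    then show ?thesis by (simp add: clinD[OF lin(1)])
  qed
  finally show ?thesis by (simp add: idem)
qed

text \<open>Exchanging the roles of the two frames in the first sum makes the two sums combine into
  anticommutators, which are scalars adding up to the trace. This controls the grading from the
  other end and explains its behaviour under conjugation.\<close>

lemma number_sum_swap:
  assumes "alt_form \<phi>"
  shows "number P Q \<phi> + number Q P \<phi> = ctrace P *\<^sub>f \<phi>"
proof -
  have "number P Q \<phi> = number_op gt_cobasis gt_basis P Q \<phi>"
    by (rule tensor_frame_indep[OF dual_frames_gt_basis dual_frames_swap[OF dual_frames_gt_basis] lin assms])
  then have "number P Q \<phi> + number Q P \<phi> = (\<Sum>k\<in>UNIV. cpair (P (gt_basis k)) (Q (gt_cobasis k)) *\<^sub>f \<phi>)"
    by (simp add: number_op_def clifford_relation[OF assms, symmetric] sum.distrib add.commute)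
  also have "\<dots> = ctrace P *\<^sub>f \<phi>"
    by (auto simp: ctrace_def fun_eq_iff form_pt sum_fun_apply sum_distrib_right adj[symmetric] idem)
  finally show ?thesis .
qed

lemma word_number:
  assumes fr: "dual_frames b b'" and "\<And>z. z \<in> set zs \<Longrightarrow> P z = z" and alt: "alt_form \<phi>"
  shows "alt_form (foldr clifford zs \<phi>) \<and>
    foldr clifford zs (number_op b b' P Q \<phi>) =
      number_op b b' P Q (foldr clifford zs \<phi>) + of_nat (length zs) *\<^sub>f foldr clifford zs \<phi>"
  using assms(2)
proof (induction zs)
  case Nil
  then show ?case by (simp add: cscale_form_simps alt)
next
  case (Cons z zs)
  then have z: "P z = z" "Q z = 0" using QP[of z] by auto
  have a: "alt_form (foldr clifford zs \<phi>)" using Cons by auto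
  show ?case
    using Cons a
    by (simp add: number_clifford[OF fr] z clifford_linear clifford_linear_left cscale_form_simps)
qed

lemma clifford_word_anticomm:
  assumes "\<And>z. z \<in> set zs \<Longrightarrow> P z = z" "P y = y" and alt: "alt_form \<phi>"
  shows "alt_form (foldr clifford zs \<phi>) \<and>
    clifford y (foldr clifford zs \<phi>) = (-1) ^ length zs *\<^sub>f foldr clifford zs (clifford y \<phi>)"
  using assms(1)
proof (induction zs)
  case Nil
  then show ?case by (simp add: cscale_form_simps alt)
next
  case (Cons z zs)
  then have z: "P z = z" by auto
  have a: "alt_form (foldr clifford zs \<phi>)" using Cons by auto
  have "cpair y z = 0" using isotropic[of y z] assms(2) z by simp
  then show ?case using Cons a
    by (simp add: clifford_swap[OF a, of y z] clifford_linear cscale_form_simps)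
qed

lemma clifford_nilpotent: "P y = y \<Longrightarrow> alt_form \<phi> \<Longrightarrow> clifford y (clifford y \<phi>) = 0"
  using clifford_relation[of \<phi> y y] isotropic[of y y] by (auto simp: fun_eq_iff form_pt)

lemma foldr_clifford_0: "foldr clifford zs 0 = 0"
  by (induction zs) (auto simp: clifford_linear)

lemma alt_form_foldr_clifford: "alt_form \<phi> \<Longrightarrow> alt_form (foldr clifford zs \<phi>)"
  by (induction zs) auto

text \<open>Pigeonhole: the letters come from a set no larger than the index set, so some letter
  repeats. Its two copies anticommute past the letters between them, and the square of an isotropic
  element is zero.\<close>

lemma long_word_zero:
  fixes b' :: "'n gframe"
  assumes "set zs \<subseteq> range (\<lambda>k. P (b' k))" "length zs > card (UNIV :: (bool \<times> 'n) set)" "alt_form \<phi>"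
  shows "foldr clifford zs \<phi> = 0"
proof -
  have "card (set zs) \<le> card (UNIV :: (bool \<times> 'n) set)"
  proof -
    have "card (set zs) \<le> card (range (\<lambda>k. P (b' k)))"
      by (rule card_mono) (use assms(1) in auto)
    also have "\<dots> \<le> card (UNIV :: (bool \<times> 'n) set)"
      by (rule card_image_le) simp
    finally show ?thesis .
  qed
  then have "\<not> distinct zs" using assms(2) distinct_card[of zs] by auto
  then obtain us ys ws y where zs: "zs = us @ [y] @ ys @ [y] @ ws"
    using not_distinct_decomp by blast
  have Pz: "P z = z" if mem: "z \<in> set zs" for z
  proof -
    obtain k where "z = P (b' k)" using assms(1) mem by blast
    then show ?thesis by (simp only: idem)
  qed
  have a: "alt_form (clifford y (foldr clifford ws \<phi>))" by (simp add: alt_form_foldr_clifford assms(3))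
  have "clifford y (foldr clifford ys (clifford y (foldr clifford ws \<phi>))) = 0"
    using clifford_word_anticomm[of ys y "clifford y (foldr clifford ws \<phi>)"] Pz a
      clifford_nilpotent[of y "foldr clifford ws \<phi>"]
    by (simp add: zs foldr_clifford_0 alt_form_foldr_clifford assms(3) cscale_form_simps)
  then show ?thesis by (simp add: zs foldr_clifford_0)
qed

end

text \<open>The product of the factors T - j for j < m, applied to \<open>x\<close>. The scalar
  multiplication is a parameter because both forms at a point and fields of forms are to be
  decomposed.\<close>

primrec kill :: "(complex \<Rightarrow> 'v \<Rightarrow> 'v) \<Rightarrow> ('v \<Rightarrow> 'v::ab_group_add) \<Rightarrow> nat \<Rightarrow> 'v \<Rightarrow> 'v" where
  "kill sc T 0 x = x"
| "kill sc T (Suc m) x = kill sc T m (T x - sc (of_nat m) x)"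

abbreviation "number_bound (t :: 'n::finite itself) \<equiv> card (UNIV :: (bool \<times> 'n) set)"

text \<open>If all words of length \<open>m + 1\<close> in the \<open>P b'\<^sub>k\<close> annihilate \<open>\<phi>\<close>, then those of length \<open>m\<close>
  annihilate \<open>(N - m) \<phi>\<close>; long words vanish by isotropy.\<close>

lemma (in adj_pair) kill_number:
  assumes fr: "dual_frames b b'" and "alt_form \<phi>"
  shows "kill (*\<^sub>f) (number_op b b' P Q) (Suc (number_bound TYPE('n))) \<phi> = 0"
proof -
  have K: "alt_form \<phi> \<Longrightarrow> (\<And>zs. set zs \<subseteq> range (\<lambda>k. P (b' k)) \<Longrightarrow> length zs = m \<Longrightarrow> foldr clifford zs \<phi> = 0)
    \<Longrightarrow> kill (*\<^sub>f) (number_op b b' P Q) m \<phi> = 0" for m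
  proof (induction m arbitrary: \<phi>)
    case 0
    from "0.prems"(2)[of "[]"] show ?case by simp
  next
    case (Suc m)
    have "kill (*\<^sub>f) (number_op b b' P Q) m (number_op b b' P Q \<phi> - of_nat m *\<^sub>f \<phi>) = 0"
    proof (rule Suc.IH)
      show "alt_form (number_op b b' P Q \<phi> - of_nat m *\<^sub>f \<phi>)"
        using Suc.prems(1) by (intro alt_form_linear) auto
      fix zs assume zs: "set zs \<subseteq> range (\<lambda>k. P (b' k))" "length zs = m"
      have Pz: "P z = z" if mem: "z \<in> set zs" for z
      proof -
        obtain k where "z = P (b' k)" using zs(1) mem by blast
        then show ?thesis by (simp only: idem)
      qed
      have lin: "foldr clifford zs (\<chi>' - a *\<^sub>f \<psi>) = foldr clifford zs \<chi>' - a *\<^sub>f foldr clifford zs \<psi>" for \<chi>' \<psi> a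
        by (induction zs) (auto simp: clifford_linear)
      have "clifford (P (b' k)) (foldr clifford zs \<phi>) = 0" for k
        using Suc.prems(2)[of "P (b' k) # zs"] zs by auto
      then have "number_op b b' P Q (foldr clifford zs \<phi>) = 0"
        by (simp add: number_op_def clifford_linear)
      then show "foldr clifford zs (number_op b b' P Q \<phi> - of_nat m *\<^sub>f \<phi>) = 0"
        using word_number[OF fr Pz Suc.prems(1)] zs(2) by (simp add: lin)
    qed
    then show ?case by simp
  qed
  show ?thesis
  proof (rule K[OF assms(2)])
    fix zs assume "set zs \<subseteq> range (\<lambda>k. P (b' k))" "length zs = Suc (number_bound TYPE('n))"
    then show "foldr clifford zs \<phi> = 0"
      by (intro long_word_zero[of zs b'] assms(2)) simp_all
  qed
qed

text \<open>On an eigenvector the product acts as the scalar \<Prod> (c - j), which is nonzero when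
  \<open>c\<close> is none of the roots.\<close>

lemma kill_eigen_0:
  assumes "vector_space sc" and "T x = sc c x" "kill sc T m x = 0" "\<And>j. j < m \<Longrightarrow> c \<noteq> of_nat j"
    and T: "\<And>a x. T (sc a x) = sc a (T x)"
  shows "x = 0"
  using assms(2-4)
proof (induction m arbitrary: x)
  case 0 then show ?case by simp
next
  case (Suc m)
  interpret vector_space sc by fact
  have e: "T x - sc (of_nat m) x = sc (c - of_nat m) x"
    using Suc.prems(1) by (simp add: scale_left_diff_distrib)
  have "sc (c - of_nat m) x = 0"
  proof (rule Suc.IH)
    show "T (sc (c - of_nat m) x) = sc c (sc (c - of_nat m) x)"
      by (simp add: T Suc.prems(1) mult.commute)
    show "kill sc T m (sc (c - of_nat m) x) = 0" using Suc.prems(2) e by simp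
    show "c \<noteq> of_nat j" if "j < m" for j using Suc.prems(3) that by simp
  qed
  then show ?case using Suc.prems(3)[of m] by simp
qed

text \<open>Induction on the number of factors. By hypothesis (T - m) x splits into eigenvectors
  \<open>g j\<close> with j < m; dividing \<open>g j\<close> by j - m gives a preimage under T - m,
  and what remains of \<open>x\<close> is an eigenvector for m. Linearity of \<open>T\<close> is
  demanded on \<open>X\<close> only, and all summands stay in \<open>X\<close>.\<close>

lemma kill_decomp:
  assumes "vector_space sc" and X: "module.subspace sc X" and x: "x \<in> X"
    and TX: "\<And>x. x \<in> X \<Longrightarrow> T x \<in> X"
    and T: "\<And>a x. x \<in> X \<Longrightarrow> T (sc a x) = sc a (T x)" "\<And>x y. x \<in> X \<Longrightarrow> y \<in> X \<Longrightarrow> T (x - y) = T x - T y"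
    and "kill sc T m x = 0"
  shows "\<exists>f. (\<forall>j. f j \<in> X \<and> T (f j) = sc (of_nat j) (f j)) \<and> x = (\<Sum>j<m. f j)"
  using x assms(7)
proof (induction m arbitrary: x)
  interpret vector_space sc by fact
  have T0: "T 0 = 0" using T(1)[OF subspace_0[OF X], of 0] by simp
  case 0 then show ?case by (intro exI[of _ "\<lambda>_. 0"]) (auto simp: T0 subspace_0[OF X])
next
  case (Suc m)
  interpret vector_space sc by fact
  have T0: "T 0 = 0" using T(1)[OF subspace_0[OF X], of 0] by simp
  have Tsum: "T (\<Sum>j\<in>I. g j) = (\<Sum>j\<in>I. T (g j))" if "\<And>j. g j \<in> X" for g and I :: "nat set"
  proof (induction I rule: infinite_finite_induct)
    case (insert i F)
    have sX: "sum g F \<in> X" by (rule subspace_sum[OF X that])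
    have "T (g i + sum g F) = T (g i - (0 - sum g F))" by simp
    also have "\<dots> = T (g i) - T (0 - sum g F)"
      by (rule T(2)[OF that subspace_diff[OF X subspace_0[OF X] sX]])
    also have "T (0 - sum g F) = T 0 - T (sum g F)"
      by (rule T(2)[OF subspace_0[OF X] sX])
    finally show ?case using insert by (simp add: T0)
  qed (auto simp: T0)
  have X1: "T x - sc (of_nat m) x \<in> X"
    by (intro subspace_diff[OF X] TX subspace_scale[OF X] Suc.prems)
  then obtain g where g: "\<And>j. g j \<in> X" "\<And>j. T (g j) = sc (of_nat j) (g j)"
    and ge: "T x - sc (of_nat m) x = (\<Sum>j<m. g j)"
    using Suc.IH[OF X1 Suc.prems(2)[unfolded kill.simps]] by blast
  \<comment> \<open>For \<open>j = m\<close> the denominator is zero and so is \<open>h m\<close>;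
    this index is assigned to the remainder \<open>y\<close> in the end.\<close>
  define h where "h j = sc (1 / (of_nat j - of_nat m)) (g j)" for j
  have hX: "h j \<in> X" for j unfolding h_def by (intro subspace_scale[OF X] g)
  have hT: "T (h j) = sc (of_nat j) (h j)" for j
    by (simp add: h_def T(1)[OF g(1)] g(2) mult.commute)
  define y where "y = x - (\<Sum>j<m. h j)"
  have yX: "y \<in> X" unfolding y_def by (intro subspace_diff[OF X] Suc.prems subspace_sum[OF X] hX)
  have "T y - sc (of_nat m) y = (\<Sum>j<m. g j) - (\<Sum>j<m. T (h j) - sc (of_nat m) (h j))"
  proof -
    have "T y = T x - (\<Sum>j<m. T (h j))"
      unfolding y_def by (simp add: T(2)[OF Suc.prems(1) subspace_sum[OF X hX]] Tsum[OF hX])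
    then show ?thesis
      unfolding ge[symmetric] by (simp add: y_def scale_right_diff_distrib scale_sum_right sum_subtractf)
  qed
  also have "(\<Sum>j<m. T (h j) - sc (of_nat m) (h j)) = (\<Sum>j<m. g j)"
  proof (rule sum.cong)
    fix j assume "j \<in> {..<m}"
    then have "(of_nat j :: complex) - of_nat m \<noteq> 0" by simp
    moreover have "T (h j) - sc (of_nat m) (h j) = sc (of_nat j - of_nat m) (h j)"
      by (simp add: hT scale_left_diff_distrib)
    ultimately show "T (h j) - sc (of_nat m) (h j) = g j" by (simp add: h_def)
  qed simp
  finally have yT: "T y = sc (of_nat m) y" by simp
  show ?case
  proof (intro exI[of _ "\<lambda>j. if j = m then y else h j"] conjI allI)
    have "(\<Sum>j<m. (if j = m then y else h j)) = (\<Sum>j<m. h j)" by (intro sum.cong) auto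
    then show "x = (\<Sum>j<Suc m. (if j = m then y else h j))" by (simp add: y_def)
  qed (use yX yT hX hT in auto)
qed

lemma eigen_unique:
  fixes f :: "'i \<Rightarrow> 'v::ab_group_add"
  assumes "vector_space sc" and "finite I" and "inj_on c I"
    and T: "\<And>a x. T (sc a x) = sc a (T x)" "\<And>x y. T (x + y) = T x + T y"
    and "\<And>i. i \<in> I \<Longrightarrow> T (f i) = sc (c i) (f i)" "(\<Sum>i\<in>I. f i) = 0" "i \<in> I"
  shows "f i = 0"
  using assms(2,3,6-8)
proof (induction I arbitrary: f i rule: finite_induct)
  case (insert k F)
  interpret vector_space sc by fact
  have T0: "T 0 = 0" using T(1)[of 0 0] by simp
  have Tsum: "T (\<Sum>j\<in>I. g j) = (\<Sum>j\<in>I. T (g j))" for g and I :: "'i set"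
    by (induction I rule: infinite_finite_induct) (auto simp: T0 T(2))
  have s: "f k = - (\<Sum>i\<in>F. f i)" using insert by (simp add: add_eq_0_iff2)
  have "(\<Sum>i\<in>insert k F. sc (c i) (f i)) = (\<Sum>i\<in>insert k F. T (f i))"
    using insert.prems(2) by (intro sum.cong) auto
  also have "\<dots> = T (\<Sum>i\<in>insert k F. f i)" by (rule Tsum[symmetric])
  also have "\<dots> = 0" using insert.prems(3) by (simp only: T0)
  finally have "(\<Sum>i\<in>F. sc (c i) (f i)) + sc (c k) (f k) = 0"
    using insert.hyps by (simp add: add.commute)
  \<comment> \<open>Subtracting \<open>c k\<close> times the original relation removes the summand
    with index \<open>k\<close>.\<close>
  then have "(\<Sum>i\<in>F. sc (c i - c k) (f i)) = 0"
    by (simp add: s scale_left_diff_distrib sum_subtractf scale_sum_right)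
  then have z: "sc (c j - c k) (f j) = 0" if "j \<in> F" for j
    using insert.IH[of "\<lambda>i. sc (c i - c k) (f i)" j] insert.prems that
    by (auto simp: T(1) mult.commute)
  have F0: "f j = 0" if "j \<in> F" for j
  proof -
    have "c j \<noteq> c k" using insert.prems(1) insert.hyps that by (auto simp: inj_on_def)
    then show ?thesis using z[OF that] by simp
  qed
  show ?case
  proof (cases "i = k")
    case True
    then show ?thesis using s F0 by simp
  next
    case False
    then show ?thesis using F0 insert.prems by auto
  qed
qed simp

section \<open>Orthogonal complex structures on a fibre\<close>

lemma gt_eq_iff: "z = w \<longleftrightarrow> Re_gt z = Re_gt w \<and> Im_gt z = Im_gt w"
  by (auto simp: Re_gt_def Im_gt_def Re_vec_def Im_vec_def prod_eq_iff vec_eq_iff complex_eq_iff)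

lemma Re_gt_simps:
  "Re_gt (z + w) = Re_gt z + Re_gt w" "Re_gt (z - w) = Re_gt z - Re_gt w" "Re_gt (- z) = - Re_gt z"
  "Re_gt 0 = 0" "Re_gt (cscale_gt a z) = Re a *\<^sub>R Re_gt z - Im a *\<^sub>R Im_gt z"
  "Re_gt (of_real_gt v) = v" "Re_gt (cnj_gt z) = Re_gt z"
  and Im_gt_simps:
  "Im_gt (z + w) = Im_gt z + Im_gt w" "Im_gt (z - w) = Im_gt z - Im_gt w" "Im_gt (- z) = - Im_gt z"
  "Im_gt 0 = 0" "Im_gt (cscale_gt a z) = Im a *\<^sub>R Re_gt z + Re a *\<^sub>R Im_gt z"
  "Im_gt (of_real_gt v) = 0" "Im_gt (cnj_gt z) = - Im_gt z"
  by (auto simp: Re_gt_def Im_gt_def Re_vec_def Im_vec_def prod_eq_iff vec_eq_iff cscale_gt_def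
      of_real_gt_def cnj_gt_def)

lemma complexify_Re_Im: "Re_gt (complexify T z) = T (Re_gt z)" "Im_gt (complexify T z) = T (Im_gt z)"
  by (simp_all add: complexify_def Re_gt_simps Im_gt_simps)

lemma complexify_o: "complexify (S \<circ> T) z = complexify S (complexify T z)"
  by (simp add: gt_eq_iff complexify_Re_Im)

lemma clin_complexify: "linear T \<Longrightarrow> clin (complexify T)"
  unfolding clin_def
  by (simp add: gt_eq_iff complexify_Re_Im Re_gt_simps Im_gt_simps linear_add linear_diff linear_scale)

lemma complexify_cnj: "linear T \<Longrightarrow> complexify T (cnj_gt z) = cnj_gt (complexify T z)"
  by (simp add: gt_eq_iff complexify_Re_Im Re_gt_simps Im_gt_simps linear_neg)

lemma cnj_gt_cnj_gt [simp]: "cnj_gt (cnj_gt z) = z"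
  by (simp add: gt_eq_iff Re_gt_simps Im_gt_simps)

lemma cnj_gt_simps: "cnj_gt (z + w) = cnj_gt z + cnj_gt w" "cnj_gt (cscale_gt a z) = cscale_gt (cnj a) (cnj_gt z)"
  "cnj_gt (z - w) = cnj_gt z - cnj_gt w"
  by (simp_all add: gt_eq_iff Re_gt_simps Im_gt_simps)

lemma pairing_double: "2 * pairing v w = snd w \<bullet> fst v + snd v \<bullet> fst w"
  by (simp add: pairing_def)

lemma cpair_Re_Im:
  "cpair z w = Complex (2 * pairing (Re_gt z) (Re_gt w) - 2 * pairing (Im_gt z) (Im_gt w))
     (2 * pairing (Re_gt z) (Im_gt w) + 2 * pairing (Im_gt z) (Re_gt w))"
  unfolding pairing_double
  by (simp add: complex_eq_iff cpair_def inner_vec_def Re_gt_def Im_gt_def Re_vec_def Im_vec_def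
      sum.distrib sum_subtractf algebra_simps)

lemma pairing_commute: "pairing v w = pairing w v"
  by (simp add: pairing_def)

lemma pairing_linear:
  "pairing (u + v) w = pairing u w + pairing v w" "pairing w (u + v) = pairing w u + pairing w v"
  "pairing (u - v) w = pairing u w - pairing v w" "pairing w (u - v) = pairing w u - pairing w v"
  "pairing (- v) w = - pairing v w" "pairing w (- v) = - pairing w v"
  "pairing (a *\<^sub>R v) w = a * pairing v w" "pairing w (a *\<^sub>R v) = a * pairing w v"
  "pairing 0 w = 0" "pairing w 0 = 0"
  by (simp_all add: pairing_def inner_add_left inner_add_right inner_diff_left inner_diff_right field_simps)

lemma pairing_nondegenerate:
  assumes "\<And>w. pairing v w = pairing v' w"
  shows "v = v'"
proof -
  have "(fst v - fst v') \<bullet> x = 0" "(snd v - snd v') \<bullet> x = 0" for x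
    using assms[of "(0, x)"] assms[of "(x, 0)"] by (simp_all add: pairing_def inner_diff_left inner_diff_right inner_commute)
  from this(1)[of "fst v - fst v'"] this(2)[of "snd v - snd v'"] show ?thesis
    by (simp add: prod_eq_iff)
qed

lemma complexify_adjoint:
  assumes "\<And>v w. pairing (T v) w = c * pairing v (S w)"
  shows "cpair (complexify T z) w = of_real c * cpair z (complexify S w)"
  by (simp add: cpair_Re_Im complexify_Re_Im assms complex_eq_iff algebra_simps)

definition orth_cs :: "((real, 'n) gtan \<Rightarrow> (real, 'n::finite) gtan) \<Rightarrow> bool" where
  "orth_cs J \<longleftrightarrow> linear J \<and> (\<forall>v. J (J v) = - v) \<and> (\<forall>v w. pairing (J v) (J w) = pairing v w)"

definition hol_part :: "((real, 'n) gtan \<Rightarrow> (real, 'n) gtan) \<Rightarrow> (complex, 'n) gtan \<Rightarrow> (complex, 'n::finite) gtan" where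
  "hol_part J z = cscale_gt (1/2) (z - cscale_gt \<i> (complexify J z))"

definition ahol_part :: "((real, 'n) gtan \<Rightarrow> (real, 'n) gtan) \<Rightarrow> (complex, 'n) gtan \<Rightarrow> (complex, 'n::finite) gtan" where
  "ahol_part J z = cscale_gt (1/2) (z + cscale_gt \<i> (complexify J z))"

text \<open>Its commutator with Clifford multiplication by z is S z minus the adjoint of S applied
  to z, so it quantises the skew part of \<open>S\<close> up to a scalar. Being linear in
  \<open>S\<close>, it relates the number operators of different splittings: each of them is
  \<open>tau\<close> of its \<open>Q\<close>.\<close>

definition tau :: "((complex, 'n) gtan \<Rightarrow> (complex, 'n) gtan) \<Rightarrow> 'n::finite mform \<Rightarrow> 'n mform" where
  "tau S \<phi> = number_op gt_basis gt_cobasis (\<lambda>z. z) S \<phi>"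

lemma tau_add: "alt_form \<phi> \<Longrightarrow> tau (\<lambda>z. S z + R z) \<phi> = tau S \<phi> + tau R \<phi>"
  by (simp add: tau_def number_op_def clifford_linear_left sum.distrib)

lemma tau_scale: "alt_form \<phi> \<Longrightarrow> tau (\<lambda>z. cscale_gt a (S z)) \<phi> = a *\<^sub>f tau S \<phi>"
  by (simp add: tau_def number_op_def clifford_linear_left cscale_form_sum)

text \<open>Expanding \<open>P (b' k)\<close> in the dual frame and resumming over \<open>k\<close>
  transfers \<open>P\<close> to the other tensor factor as its adjoint.\<close>

lemma number_op_adjoint:
  assumes fr: "dual_frames b b'" and lin: "clin P" "clin Q" and adj: "\<And>z w. cpair (P z) w = cpair z (Q w)"
    and alt: "alt_form \<phi>" and S: "clin S"
  shows "number_op b b' P S \<phi> = number_op b b' (\<lambda>z. z) (\<lambda>z. S (Q z)) \<phi>"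
proof -
  have e1: "P (b' k) = (\<Sum>j\<in>UNIV. cscale_gt (cpair (b j) (P (b' k))) (b' j))" for k
    using dual_framesD(2)[OF fr] by simp
  have e2: "(\<Sum>k\<in>UNIV. cscale_gt (cpair (b j) (P (b' k))) (b k)) = Q (b j)" for j
  proof -
    have "cpair (b j) (P (b' k)) = cpair (b' k) (Q (b j))" for k by (metis adj cpair_commute)
    then show ?thesis using dual_framesD(1)[OF fr, of "Q (b j)"] by simp
  qed
  have "number_op b b' P S \<phi> = (\<Sum>k\<in>UNIV. \<Sum>j\<in>UNIV. cpair (b j) (P (b' k)) *\<^sub>f clifford (S (b k)) (clifford (b' j) \<phi>))"
    unfolding number_op_def
    by (subst e1) (simp add: clifford_sum_left[OF alt] clifford_linear_left[OF alt] clifford_sum clifford_linear)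
  also have "\<dots> = (\<Sum>j\<in>UNIV. \<Sum>k\<in>UNIV. cpair (b j) (P (b' k)) *\<^sub>f clifford (S (b k)) (clifford (b' j) \<phi>))"
    by (rule sum.swap)
  also have "\<dots> = (\<Sum>j\<in>UNIV. clifford (S (\<Sum>k\<in>UNIV. cscale_gt (cpair (b j) (P (b' k))) (b k))) (clifford (b' j) \<phi>))"
    by (simp add: clinD[OF S] clifford_sum_left alt clifford_linear_left)
  finally show ?thesis by (simp add: e2 number_op_def)
qed

lemma (in adj_pair) number_tau: "alt_form \<phi> \<Longrightarrow> number P Q \<phi> = tau Q \<phi>"
  using number_op_adjoint[OF dual_frames_gt_basis lin adj _ lin(2)] by (simp add: tau_def idem)

text \<open>A self-adjoint \<open>S\<close> may act on either factor, and the frames may be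
  exchanged, so twice \<open>tau S\<close> is a sum of anticommutators and hence the scalar
  \<open>ctrace S\<close>.\<close>

lemma tau_selfadjoint:
  assumes lin: "clin S" and adj: "\<And>z w. cpair (S z) w = cpair z (S w)" and alt: "alt_form \<phi>"
  shows "tau S \<phi> = (ctrace S / 2) *\<^sub>f \<phi>"
proof -
  have id: "clin (\<lambda>z. z)" by (simp add: clin_def)
  have "tau S \<phi> = number S (\<lambda>z. z) \<phi>"
    using number_op_adjoint[OF dual_frames_gt_basis lin lin adj alt id] by (simp add: tau_def)
  also have "\<dots> = number_op gt_cobasis gt_basis S (\<lambda>z. z) \<phi>"
    by (rule tensor_frame_indep[OF dual_frames_gt_basis dual_frames_swap[OF dual_frames_gt_basis] lin id alt])
  finally have "tau S \<phi> + tau S \<phi> = (\<Sum>k\<in>UNIV. cpair (S (gt_basis k)) (gt_cobasis k) *\<^sub>f \<phi>)"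
    by (simp add: number_op_def clifford_relation[OF alt, symmetric] sum.distrib tau_def)
  also have "\<dots> = ctrace S *\<^sub>f \<phi>"
    by (auto simp: ctrace_def fun_eq_iff form_pt sum_fun_apply sum_distrib_right)
  finally have "(1/2) *\<^sub>f (tau S \<phi> + tau S \<phi>) = (1/2) *\<^sub>f (ctrace S *\<^sub>f \<phi>)"
    by (rule arg_cong)
  moreover have "(1/2) *\<^sub>f (\<psi> + \<psi>) = \<psi>" for \<psi> :: "'a mform"
    by (simp add: fun_eq_iff form_pt)
  ultimately show ?thesis by (simp add: cscale_form_simps(5))
qed

lemma clin_comps:
  "clin S \<Longrightarrow> clin T \<Longrightarrow> clin (\<lambda>z. S z + T z)" "clin S \<Longrightarrow> clin T \<Longrightarrow> clin (\<lambda>z. S z - T z)"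
  "clin S \<Longrightarrow> clin (\<lambda>z. cscale_gt a (S z))" "clin (\<lambda>z. z)"
  unfolding clin_def by (auto simp: cscale_gt_simps mult.commute algebra_simps)

context
  fixes J :: "(real, 'n::finite) gtan \<Rightarrow> (real, 'n) gtan"
  assumes J: "orth_cs J"
begin

lemma linJ: "linear J" and JJ: "J (J v) = - v" and J_orth: "pairing (J v) (J w) = pairing v w"
  using J unfolding orth_cs_def by blast+

lemma clinJ: "clin (complexify J)"
  by (rule clin_complexify[OF linJ])

lemma complexify_JJ: "complexify J (complexify J z) = - z"
  by (simp add: gt_eq_iff complexify_Re_Im JJ Re_gt_simps Im_gt_simps)

lemma J_skew: "pairing (J v) w = - pairing v (J w)"
  using J_orth[of v "J w"] by (simp add: JJ pairing_linear)

lemma cpair_J: "cpair (complexify J z) w = - cpair z (complexify J w)"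
  using complexify_adjoint[of J "-1" J] J_skew by simp

lemma adj_pair_hol: "adj_pair (hol_part J) (ahol_part J)"
proof
  have h: "hol_part J = (\<lambda>z. cscale_gt (1/2) (z - cscale_gt \<i> (complexify J z)))"
    "ahol_part J = (\<lambda>z. cscale_gt (1/2) (z + cscale_gt \<i> (complexify J z)))"
    by (auto simp: fun_eq_iff hol_part_def ahol_part_def)
  show "clin (hol_part J)" "clin (ahol_part J)"
    unfolding h by (intro clin_comps clinJ)+
  show "cpair (hol_part J z) w = cpair z (ahol_part J w)" for z w
    by (simp add: h cpair_linear cpair_J)
  note s = h clinD[OF clinJ] complexify_JJ cscale_gt_simps
  show "hol_part J (hol_part J z) = hol_part J z" "ahol_part J (ahol_part J z) = ahol_part J z"
    "hol_part J (ahol_part J z) = 0" "ahol_part J (hol_part J z) = 0" for z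
    by (simp_all add: gt_eq_iff s complexify_Re_Im Re_gt_simps Im_gt_simps linear_add[OF linJ] linear_diff[OF linJ]
        linear_scale[OF linJ] linear_neg[OF linJ] JJ algebra_simps flip: scaleR_left_distrib scaleR_left_diff_distrib)
qed

lemma hol_part_iff: "hol_part J z = z \<longleftrightarrow> complexify J z = cscale_gt \<i> z"
  "ahol_part J z = z \<longleftrightarrow> complexify J z = cscale_gt (- \<i>) z"
proof -
  have a: "z = cscale_gt (1/2) w \<longleftrightarrow> z + z = w" for z w :: "(complex, 'n) gtan"
    by (auto simp: cscale_gt_def prod_eq_iff vec_eq_iff field_simps)
  have i: "cscale_gt \<i> w = v \<longleftrightarrow> w = cscale_gt (- \<i>) v" for v w :: "(complex, 'n) gtan"
    by (auto simp: cscale_gt_simps)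
  have "hol_part J z = z \<longleftrightarrow> z + z = z - cscale_gt \<i> (complexify J z)"
    unfolding hol_part_def using a[of z] by metis
  also have "\<dots> \<longleftrightarrow> cscale_gt \<i> (complexify J z) = - z"
    by (auto simp: eq_neg_iff_add_eq_0 add.commute eq_diff_eq)
  finally show "hol_part J z = z \<longleftrightarrow> complexify J z = cscale_gt \<i> z" by (simp add: i cscale_gt_simps)
  have "ahol_part J z = z \<longleftrightarrow> z + z = z + cscale_gt \<i> (complexify J z)"
    unfolding ahol_part_def using a[of z] by metis
  also have "\<dots> \<longleftrightarrow> cscale_gt \<i> (complexify J z) = z" by auto
  finally show "ahol_part J z = z \<longleftrightarrow> complexify J z = cscale_gt (- \<i>) z" by (simp add: i cscale_gt_simps)
qed

lemma i_eigenspace_UNIV: "i_eigenspace UNIV J = {z. hol_part J z = z}"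
  by (simp add: i_eigenspace_def hol_part_iff)

lemma cnj_i_eigenspace_UNIV: "cnj_gt ` i_eigenspace UNIV J = {z. ahol_part J z = z}"
proof -
  have "complexify J (cnj_gt z) = cscale_gt \<i> (cnj_gt z) \<longleftrightarrow> complexify J z = cscale_gt (- \<i>) z" for z
  proof -
    have "complexify J (cnj_gt z) = cscale_gt \<i> (cnj_gt z) \<longleftrightarrow>
      cnj_gt (complexify J (cnj_gt z)) = cnj_gt (cscale_gt \<i> (cnj_gt z))" by (metis cnj_gt_cnj_gt)
    then show ?thesis by (simp add: complexify_cnj[OF linJ] cnj_gt_simps)
  qed
  moreover have "z \<in> cnj_gt ` S \<longleftrightarrow> cnj_gt z \<in> S" for z and S :: "(complex, 'n) gtan set"
    by (metis cnj_gt_cnj_gt imageE image_eqI)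
  ultimately show ?thesis
    by (simp only: set_eq_iff i_eigenspace_UNIV hol_part_iff mem_Collect_eq) simp
qed

section \<open>The number operator of one complex structure and the spaces U^k\<close>

interpretation adj_pair "hol_part J" "ahol_part J" by (rule adj_pair_hol)

abbreviation "NJ \<equiv> number (hol_part J) (ahol_part J)"

text \<open>The product of factors N - j annihilates all forms, so N has only natural eigenvalues;
  in particular no negative ones.\<close>

lemma NJ_negative:
  assumes "alt_form \<phi>" "NJ \<phi> = c *\<^sub>f \<phi>" "\<And>j. c \<noteq> of_nat j"
  shows "\<phi> = 0"
proof (rule kill_eigen_0[where T = NJ and sc = "(*\<^sub>f)"])
  show "vector_space ((*\<^sub>f) :: complex \<Rightarrow> 'n mform \<Rightarrow> 'n mform)"
    by standard (simp_all add: cscale_form_simps)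
  show "kill (*\<^sub>f) NJ (Suc (number_bound TYPE('n))) \<phi> = 0"
    by (rule kill_number[OF dual_frames_gt_basis assms(1)])
qed (rule assms number_op_linear)+

text \<open>For the converse: if N annihilates \<phi>, then multiplying by an element of the
  +i-eigenspace produces an eigenvector for -1, which must be zero.\<close>

lemma spin_top_iff: "\<phi> \<in> spin_top J \<longleftrightarrow> alt_form \<phi> \<and> NJ \<phi> = 0"
proof
  assume "\<phi> \<in> spin_top J"
  then have a: "alt_form \<phi>" and b: "\<forall>z\<in>{z. hol_part J z = z}. \<forall>vs. clifford z \<phi> vs = 0"
    unfolding spin_top_def i_eigenspace_UNIV by blast+
  have z: "clifford z \<phi> = 0" if "hol_part J z = z" for z
  proof
    fix vs show "clifford z \<phi> vs = 0 vs" using b that unfolding zero_fun_apply by blast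
  qed
  have "clifford (hol_part J w) \<phi> = 0" for w by (rule z) (rule idem)
  then show "alt_form \<phi> \<and> NJ \<phi> = 0" using a by (simp add: number_op_def clifford_linear)
next
  assume a: "alt_form \<phi> \<and> NJ \<phi> = 0"
  have "clifford z \<phi> = 0" if z: "hol_part J z = z" for z
  proof (rule NJ_negative[where c = "-1"])
    have "ahol_part J z = 0" using QP[of z] z by simp
    then show "NJ (clifford z \<phi>) = -1 *\<^sub>f clifford z \<phi>"
      using number_clifford[OF dual_frames_gt_basis, of \<phi> z] a z
      by (simp add: clifford_linear clifford_linear_left cscale_form_simps)
    show "- 1 \<noteq> (of_nat j :: complex)" for j
      by (metis of_int_eq_iff of_int_minus of_int_of_nat_eq of_int_1 zero_le_one neg_0_le_iff_le not_one_le_zero of_nat_0_le_iff)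
  qed (use a in auto)
  then have "\<forall>z\<in>{z. hol_part J z = z}. \<forall>vs. clifford z \<phi> vs = 0"
    by (metis (mono_tags) mem_Collect_eq zero_fun_apply)
  then show "\<phi> \<in> spin_top J"
    using a unfolding spin_top_def i_eigenspace_UNIV by blast
qed

lemma cspan_base: "f \<in> S \<Longrightarrow> f \<in> cspan S"
  unfolding cspan_def
  by (rule CollectI, rule exI[of _ 1], rule exI[of _ "\<lambda>_. 1"], rule exI[of _ "\<lambda>_. f"]) auto

lemma cspan_scale: "\<phi> \<in> cspan S \<Longrightarrow> c *\<^sub>f \<phi> \<in> cspan S"
proof -
  assume "\<phi> \<in> cspan S"
  then obtain m :: nat and a f where *: "\<phi> = (\<lambda>vs. \<Sum>i<m. a i * f i vs)" "\<forall>i<m. f i \<in> S"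
    unfolding cspan_def by blast
  have "c *\<^sub>f \<phi> = (\<lambda>vs. \<Sum>i<m. (c * a i) * f i vs)"
    by (simp add: * fun_eq_iff form_pt sum_distrib_left mult.assoc)
  with *(2) show ?thesis unfolding cspan_def
    by (intro CollectI exI[of _ m] exI[of _ "\<lambda>i. c * a i"] exI[of _ f] conjI)
qed

lemma cspan_zero: "0 \<in> cspan S"
  unfolding cspan_def by (rule CollectI, rule exI[of _ 0]) (auto simp: fun_eq_iff form_pt)

lemma cspan_add: "\<phi> \<in> cspan S \<Longrightarrow> \<psi> \<in> cspan S \<Longrightarrow> \<phi> + \<psi> \<in> cspan S"
proof -
  assume "\<phi> \<in> cspan S" "\<psi> \<in> cspan S"
  then obtain m m' :: nat and a f a' f' where *: "\<phi> = (\<lambda>vs. \<Sum>i<m. a i * f i vs)" "\<forall>i<m. f i \<in> S"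
    "\<psi> = (\<lambda>vs. \<Sum>i<m'. a' i * f' i vs)" "\<forall>i<m'. f' i \<in> S"
    unfolding cspan_def by blast
  let ?a = "\<lambda>i. if i < m then a i else a' (i - m)" and ?f = "\<lambda>i. if i < m then f i else f' (i - m)"
  have "(\<Sum>i<m + m'. ?a i * ?f i vs) = (\<Sum>i<m. a i * f i vs) + (\<Sum>i<m'. a' i * f' i vs)" for vs
  proof -
    have "(\<Sum>i<m + m'. ?a i * ?f i vs) = (\<Sum>i<m. ?a i * ?f i vs) + (\<Sum>i\<in>{m..<m + m'}. ?a i * ?f i vs)"
      using sum.atLeastLessThan_concat[of 0 m "m + m'" "\<lambda>i. ?a i * ?f i vs"] by (simp add: atLeast0LessThan)
    also have "(\<Sum>i\<in>{m..<m + m'}. ?a i * ?f i vs) = (\<Sum>i<m'. a' i * f' i vs)"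
      using sum.shift_bounds_nat_ivl[of "\<lambda>i. ?a i * ?f i vs" 0 m m'] by (simp add: atLeast0LessThan add.commute)
    finally show ?thesis by simp
  qed
  then have "\<phi> + \<psi> = (\<lambda>vs. \<Sum>i<m + m'. ?a i * ?f i vs)"
    by (simp add: * fun_eq_iff form_pt)
  moreover have "\<forall>i<m + m'. ?f i \<in> S" using * by auto
  ultimately show ?thesis unfolding cspan_def
    by (intro CollectI exI[of _ "m + m'"] exI[of _ ?a] exI[of _ ?f] conjI)
qed

lemma cspan_sum: "(\<And>i. i \<in> I \<Longrightarrow> f i \<in> cspan S) \<Longrightarrow> (\<Sum>i\<in>I. f i) \<in> cspan S"
  by (induction I rule: infinite_finite_induct) (auto intro: cspan_zero cspan_add)

lemma cspan_induct [consumes 1, case_names zero add]: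
  assumes "\<phi> \<in> cspan S" "X 0" "\<And>f a \<psi>. f \<in> S \<Longrightarrow> X \<psi> \<Longrightarrow> X (\<psi> + a *\<^sub>f f)"
  shows "X \<phi>"
proof -
  obtain m :: nat and a f where *: "\<phi> = (\<lambda>vs. \<Sum>i<m. a i * f i vs)" "\<forall>i<m. f i \<in> S"
    using assms(1) unfolding cspan_def by blast
  have "\<forall>i<m. f i \<in> S \<Longrightarrow> X (\<Sum>i<m. a i *\<^sub>f f i)"
    by (induction m) (use assms in auto)
  moreover have "\<phi> = (\<Sum>i<m. a i *\<^sub>f f i)"
    by (simp add: * fun_eq_iff form_pt sum_fun_apply)
  ultimately show ?thesis using *(2) by simp
qed

definition "words m = {foldr clifford zs \<phi> | zs \<phi>. length zs = m \<and>
                 set zs \<subseteq> cnj_gt ` i_eigenspace UNIV J \<and> \<phi> \<in> spin_top J}"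

lemma word_eigen:
  assumes "set zs \<subseteq> {z. ahol_part J z = z}" "alt_form \<phi>" "NJ \<phi> = 0"
  shows "alt_form (foldr clifford zs \<phi>) \<and> NJ (foldr clifford zs \<phi>) = of_nat (length zs) *\<^sub>f foldr clifford zs \<phi>"
  using assms(1)
proof (induction zs)
  case Nil then show ?case using assms by (simp add: cscale_form_simps)
next
  case (Cons z zs)
  then have z: "ahol_part J z = z" "hol_part J z = 0" using PQ[of z] by auto
  have a: "alt_form (foldr clifford zs \<phi>)" using Cons by auto
  show ?case using Cons a
    by (simp add: number_clifford[OF dual_frames_gt_basis] z clifford_linear clifford_linear_left cscale_form_simps)
qed

lemma clifford_words:
  assumes "ahol_part J z = z" "\<phi> \<in> cspan (words m)"
  shows "clifford z \<phi> \<in> cspan (words (Suc m))"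
  using assms(2)
proof (induction rule: cspan_induct)
  case zero then show ?case by (simp add: clifford_linear cspan_zero)
next
  case (add f a \<psi>)
  from \<open>f \<in> words m\<close> obtain zs \<chi>' where f: "f = foldr clifford zs \<chi>'" "length zs = m"
    "set zs \<subseteq> cnj_gt ` i_eigenspace UNIV J" "\<chi>' \<in> spin_top J" unfolding words_def by blast
  have "clifford z f = foldr clifford (z # zs) \<chi>'" using f by simp
  moreover have "set (z # zs) \<subseteq> cnj_gt ` i_eigenspace UNIV J"
    using assms(1) f(3) by (simp add: cnj_i_eigenspace_UNIV)
  ultimately have "clifford z f \<in> words (Suc m)" using f unfolding words_def
    by (metis (mono_tags, lifting) length_Cons mem_Collect_eq)
  then show ?case using add by (auto simp: clifford_linear intro: cspan_add cspan_scale cspan_base)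
qed

text \<open>Euler's trick: for eigenvalue m + 1 the form is N \<phi> / (m + 1), and N \<phi> is a
  sum of creators applied to forms \<open>clifford (hol_part J w) \<phi>\<close> of eigenvalue m,
  which are combinations of words by induction.\<close>

lemma eigen_words: "alt_form \<phi> \<Longrightarrow> NJ \<phi> = of_nat m *\<^sub>f \<phi> \<Longrightarrow> \<phi> \<in> cspan (words m)"
proof (induction m arbitrary: \<phi>)
  case 0
  then have "\<phi> \<in> spin_top J" by (simp add: spin_top_iff cscale_form_simps)
  then have "\<phi> \<in> words 0" unfolding words_def by force
  then show ?case by (rule cspan_base)
next
  case (Suc m)
  have "clifford (hol_part J w) \<phi> \<in> cspan (words m)" for w
  proof (rule Suc.IH)
    have "NJ (clifford (hol_part J w) \<phi>) = of_nat (Suc m) *\<^sub>f clifford (hol_part J w) \<phi> - clifford (hol_part J w) \<phi>"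
      using number_clifford[OF dual_frames_gt_basis Suc.prems(1), of "hol_part J w"]
      by (simp add: Suc.prems clifford_linear clifford_linear_left idem QP)
    then show "NJ (clifford (hol_part J w) \<phi>) = of_nat m *\<^sub>f clifford (hol_part J w) \<phi>"
      by (simp add: cscale_form_simps)
  qed (use Suc.prems in auto)
  then have "NJ \<phi> \<in> cspan (words (Suc m))"
    unfolding number_op_def by (intro cspan_sum clifford_words idem)
  then have "(1 / of_nat (Suc m)) *\<^sub>f NJ \<phi> \<in> cspan (words (Suc m))" by (rule cspan_scale)
  moreover have "(1 / of_nat (Suc m)) *\<^sub>f NJ \<phi> = \<phi>"
    by (simp only: Suc.prems(2) cscale_form_simps(5)) (simp add: cscale_form_simps del: of_nat_Suc)
  ultimately show ?case by simp
qed

lemma words_eigen: "\<phi> \<in> cspan (words m) \<Longrightarrow> alt_form \<phi> \<and> NJ \<phi> = of_nat m *\<^sub>f \<phi>"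
proof (induction rule: cspan_induct)
  case zero then show ?case by (simp add: number_op_linear cscale_form_simps)
next
  case (add f a \<psi>)
  then have "alt_form f \<and> NJ f = of_nat m *\<^sub>f f"
    unfolding words_def cnj_i_eigenspace_UNIV spin_top_iff using word_eigen by blast
  then show ?case using add
    by (auto simp: number_op_linear cscale_form_simps mult.commute intro!: alt_form_linear)
qed

text \<open>Replaces the definition by words with an eigenvalue equation. For k > n the definition
  gives the zero space, which agrees because N has no negative eigenvalue.\<close>

theorem spin_grade_iff:
  "\<phi> \<in> spin_grade J k \<longleftrightarrow> alt_form \<phi> \<and> NJ \<phi> = of_int (int (CARD('n) div 2) - k) *\<^sub>f \<phi>"
proof (cases "k \<le> int (CARD('n) div 2)")
  case True
  then obtain m where m: "int (CARD('n) div 2) - k = int m" by (metis diff_ge_0_iff_ge nonneg_int_cases)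
  have sg: "spin_grade J k = cspan (words m)"
    unfolding spin_grade_def Let_def m words_def using True by simp
  show ?thesis unfolding sg m of_int_of_nat_eq using eigen_words words_eigen by blast
next
  case False
  have "\<phi> = 0" if "alt_form \<phi>" "NJ \<phi> = of_int (int (CARD('n) div 2) - k) *\<^sub>f \<phi>"
  proof (rule NJ_negative[OF that])
    fix j
    have "int (CARD('n) div 2) - k \<noteq> int j" using False by simp
    then show "of_int (int (CARD('n) div 2) - k) \<noteq> (of_nat j :: complex)"
      by (metis of_int_eq_iff of_int_of_nat_eq)
  qed
  moreover have "\<phi> \<in> spin_grade J k \<longleftrightarrow> \<phi> = 0"
    using False by (auto simp: spin_grade_def fun_eq_iff form_pt)
  ultimately show ?thesis by (auto simp: number_op_linear cscale_form_simps)
qed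

end

section \<open>The bigrading of a Hermitian fibre\<close>

lemma vector_space_form: "vector_space ((*\<^sub>f) :: complex \<Rightarrow> 'n mform \<Rightarrow> 'n mform)"
  by standard (simp_all add: cscale_form_simps)

lemma ctrace_add: "ctrace (\<lambda>z. S z + T z) = ctrace S + ctrace T"
  "ctrace (\<lambda>z. S z - T z) = ctrace S - ctrace T"
  "ctrace (\<lambda>z. cscale_gt a (S z)) = a * ctrace S"
  by (simp_all add: ctrace_def cpair_linear sum.distrib sum_subtractf sum_distrib_left)

lemma ctrace_id: "ctrace (\<lambda>z. z :: (complex, 'n::finite) gtan) = 2 * of_nat CARD('n)"
proof -
  have "cpair (gt_basis k) (gt_cobasis k) = (1::complex)" for k :: "bool \<times> 'n"
  proof (cases k)
    case (Pair b i)
    show ?thesis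
      unfolding Pair gt_cobasis_def fst_conv snd_conv
      by (cases b) (simp_all only: cpair_gt_basis simp_thms, simp_all add: gt_basis_def)
  qed
  then show ?thesis by (simp add: ctrace_def)
qed

lemma ctrace_skew:
  assumes "clin S" and "\<And>z w. cpair (S z) w = - cpair z (S w)"
  shows "ctrace S = 0"
proof -
  have "ctrace S = (\<Sum>k\<in>UNIV. - cpair (S (gt_cobasis k)) (gt_basis k))"
    unfolding ctrace_def by (intro sum.cong refl) (metis assms(2) cpair_commute)
  also have "\<dots> = - (\<Sum>k\<in>UNIV. cpair (S (gt_cobasis k)) (gt_basis k))" by (simp add: sum_negf)
  also have "(\<Sum>k\<in>UNIV. cpair (S (gt_cobasis k)) (gt_basis k)) = ctrace S"
    unfolding ctrace_def
    by (rule sum.reindex_bij_witness[where i = "\<lambda>k. (\<not> fst k, snd k)" and j = "\<lambda>k. (\<not> fst k, snd k)"])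
      (auto simp: gt_cobasis_def)
  finally show ?thesis by simp
qed

lemma ctrace_hol_part:
  fixes J :: "(real, 'n::finite) gtan \<Rightarrow> (real, 'n) gtan"
  assumes J: "orth_cs J"
  shows "ctrace (hol_part J) = of_nat CARD('n)"
proof -
  have "hol_part J = (\<lambda>z. cscale_gt (1/2) (z - cscale_gt \<i> (complexify J z)))"
    by (auto simp: fun_eq_iff hol_part_def)
  moreover have "ctrace (complexify J) = 0" by (rule ctrace_skew[OF clinJ[OF J] cpair_J[OF J]])
  ultimately show ?thesis by (simp add: ctrace_add ctrace_id)
qed

lemma (in adj_pair) eigen_nat:
  assumes "alt_form \<phi>" "number P Q \<phi> = c *\<^sub>f \<phi>" "\<phi> \<noteq> 0"
  shows "\<exists>j. c = of_nat j"
proof (rule ccontr)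
  assume no: "\<nexists>j. c = of_nat j"
  have "\<phi> = 0"
  proof (rule kill_eigen_0[where T = "number P Q" and sc = "(*\<^sub>f)"])
    show "kill (*\<^sub>f) (number P Q) (Suc (number_bound TYPE('n))) \<phi> = 0"
      by (rule kill_number[OF dual_frames_gt_basis assms(1)])
    show "c \<noteq> of_nat j" for j using no by blast
  qed (rule assms number_op_linear vector_space_form)+
  then show False using assms(3) by simp
qed

text \<open>The number operators of the pair and of the swapped pair have eigenvalues n - k and n +
  k, since they add up to the trace 2 n; both must be natural.\<close>

lemma spin_grade_bounds:
  fixes J :: "(real, 'n::finite) gtan \<Rightarrow> (real, 'n) gtan"
  assumes J: "orth_cs J" and phi: "\<phi> \<in> spin_grade J k" "\<phi> \<noteq> 0" and n: "CARD('n) = 2 * n"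
  shows "\<bar>k\<bar> \<le> int n"
proof -
  interpret adj_pair "hol_part J" "ahol_part J" by (rule adj_pair_hol[OF J])
  interpret sw: adj_pair "ahol_part J" "hol_part J" by (rule swap)
  have alt: "alt_form \<phi>" and e: "number (hol_part J) (ahol_part J) \<phi> = of_int (int n - k) *\<^sub>f \<phi>"
    using phi(1) n by (simp_all add: spin_grade_iff[OF J])
  obtain j where j: "of_int (int n - k) = (of_nat j :: complex)" using eigen_nat[OF alt e phi(2)] by blast
  then have 1: "int n - k = int j" by (metis of_int_eq_iff of_int_of_nat_eq)
  have "ctrace (hol_part J) = of_nat (2 * n)" using ctrace_hol_part[OF J] n by simp
  then have "number (ahol_part J) (hol_part J) \<phi> = of_nat (2 * n) *\<^sub>f \<phi> - of_int (int n - k) *\<^sub>f \<phi>"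
    using number_sum_swap[OF alt] e by (metis add_diff_cancel_left')
  also have "\<dots> = (of_nat (2 * n) - of_int (int n - k)) *\<^sub>f \<phi>" by (simp only: cscale_form_simps)
  also have "of_nat (2 * n) - of_int (int n - k) = (of_int (int n + k) :: complex)" by simp
  finally obtain j' where j': "of_int (int n + k) = (of_nat j' :: complex)" using sw.eigen_nat[OF alt _ phi(2)] by blast
  then have 2: "int n + k = int j'" by (metis of_int_eq_iff of_int_of_nat_eq)
  show ?thesis using 1 2 by linarith
qed

text \<open>Split by \<open>T\<close> first. Each eigenspace of \<open>T\<close> inside
  \<open>X\<close> is a subspace preserved by the commuting operator \<open>S\<close>, so the
  one-operator decomposition applies to it again.\<close>

lemma kill_decomp2:
  assumes vs: "vector_space sc" and X: "module.subspace sc X" and x: "x \<in> X"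
    and TX: "\<And>x. x \<in> X \<Longrightarrow> T x \<in> X" "\<And>x. x \<in> X \<Longrightarrow> S x \<in> X"
    and T: "\<And>a x. x \<in> X \<Longrightarrow> T (sc a x) = sc a (T x)" "\<And>x y. x \<in> X \<Longrightarrow> y \<in> X \<Longrightarrow> T (x - y) = T x - T y"
    and S: "\<And>a x. x \<in> X \<Longrightarrow> S (sc a x) = sc a (S x)" "\<And>x y. x \<in> X \<Longrightarrow> y \<in> X \<Longrightarrow> S (x - y) = S x - S y"
    and comm: "\<And>x. x \<in> X \<Longrightarrow> T (S x) = S (T x)"
    and k: "\<And>x. x \<in> X \<Longrightarrow> kill sc T m x = 0" "\<And>x. x \<in> X \<Longrightarrow> kill sc S m x = 0"
  shows "\<exists>f. (\<forall>i j. f i j \<in> X \<and> T (f i j) = sc (of_nat i) (f i j) \<and> S (f i j) = sc (of_nat j) (f i j)) \<and>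
    x = (\<Sum>i<m. \<Sum>j<m. f i j)"
proof -
  interpret vector_space sc by fact
  obtain g where g: "\<And>i. g i \<in> X" "\<And>i. T (g i) = sc (of_nat i) (g i)" and xg: "x = (\<Sum>i<m. g i)"
    using kill_decomp[OF vs X x TX(1) T k(1)[OF x]] by blast
  have "\<exists>h. (\<forall>j. h j \<in> {y \<in> X. T y = sc (of_nat i) y} \<and> S (h j) = sc (of_nat j) (h j)) \<and> g i = (\<Sum>j<m. h j)" for i
  proof (rule kill_decomp[OF vs])
    have T0: "T 0 = 0" using T(1)[OF subspace_0[OF X], of 0] by simp
    have Tadd: "T (y + z) = T y + T z" if "y \<in> X" "z \<in> X" for y z
    proof -
      have m: "0 - z \<in> X" using subspace_diff[OF X subspace_0[OF X] that(2)] .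
      have "T (y + z) = T (y - (0 - z))" by simp
      also have "\<dots> = T y - T (0 - z)" by (rule T(2)[OF that(1) m])
      also have "T (0 - z) = T 0 - T z" by (rule T(2)[OF subspace_0[OF X] that(2)])
      finally show ?thesis by (simp add: T0)
    qed
    show "subspace {y \<in> X. T y = sc (of_nat i) y}"
      unfolding subspace_def
      using subspace_0[OF X] subspace_add[OF X] subspace_scale[OF X] T0 Tadd T(1)
      by (auto simp: scale_right_distrib mult.commute)
  qed (use g k S TX comm in \<open>auto simp: \<close>)
  then obtain f where f: "\<And>i j. f i j \<in> {y \<in> X. T y = sc (of_nat i) y} \<and> S (f i j) = sc (of_nat j) (f i j)"
    "\<And>i. g i = (\<Sum>j<m. f i j)" by metis
  show ?thesis by (intro exI[of _ f]) (use f xg in auto)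
qed

text \<open>\<open>tr G = 0\<close> because the off-diagonal block \<open>C\<close> of \<open>G\<close> is positive definite and \<open>G\<^sup>2 = 1\<close>
  makes the diagonal blocks \<open>A\<close> and \<open>A\<^sup>T\<close> satisfy \<open>A C = - C A\<^sup>T\<close>.\<close>

lemma trace_conjugate_neg:
  fixes A C :: "real^'n::finite^'n"
  assumes inj: "\<And>x. C *v x = 0 \<Longrightarrow> x = 0" and AC: "A ** C + C ** transpose A = 0"
  shows "trace A = 0"
proof -
  have "inj ((*v) C)"
    using inj by (auto simp: inj_def) (metis eq_iff_diff_eq_0 matrix_vector_mult_diff_distrib)
  then have "invertible C" using invertible_left_inverse matrix_left_invertible_injective by blast
  then obtain C' where inv: "C ** C' = mat 1" "C' ** C = mat 1"
    unfolding invertible_def by blast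
  have "A ** C = - (C ** transpose A)" using AC by (simp add: eq_neg_iff_add_eq_0)
  have "C' ** (A ** C + C ** transpose A) = 0"
    unfolding AC by (simp add: matrix_matrix_mult_def vec_eq_iff)
  then have "C' ** (A ** C) + C' ** (C ** transpose A) = 0"
    by (simp add: matrix_add_ldistrib)
  then have "trace (C' ** (A ** C)) + trace (C' ** (C ** transpose A)) = 0"
    by (metis trace_add trace_0 mat_0)
  moreover have "trace (C' ** (A ** C)) = trace A"
    by (metis inv(1) matrix_mul_assoc matrix_mul_rid trace_mul_sym)
  moreover have "trace (C' ** (C ** transpose A)) = trace A"
    by (simp add: matrix_mul_assoc inv) (simp add: trace_def transpose_def)
  ultimately show ?thesis by simp
qed

locale herm_fibre =
  fixes G J :: "(real, 'n::finite) gtan \<Rightarrow> (real, 'n) gtan" and n :: nat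
  assumes J: "orth_cs J" and G_lin: "linear G" and GG: "G (G v) = v"
    and G_adj: "pairing (G v) w = pairing v (G w)" and G_pos: "v \<noteq> 0 \<Longrightarrow> pairing (G v) v > 0"
    and GJ: "G (J v) = J (G v)" and dim: "CARD('n) = 2 * n"
begin

lemma orth_cs_GJ: "orth_cs (G \<circ> J)"
  unfolding orth_cs_def
proof (intro conjI allI)
  show "linear (G \<circ> J)" by (rule linear_compose[OF linJ[OF J] G_lin])
  show "(G \<circ> J) ((G \<circ> J) v) = - v" for v
    by (simp add: GJ GG JJ[OF J] linear_neg[OF G_lin])
  show "pairing ((G \<circ> J) v) ((G \<circ> J) w) = pairing v w" for v w
    by (simp add: G_adj GG J_orth[OF J])
qed

abbreviation "Jc \<equiv> complexify J"
abbreviation "Gc \<equiv> complexify G"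

lemma clin_Gc: "clin Gc" by (rule clin_complexify[OF G_lin])

lemma GGc: "Gc (Gc z) = z" by (simp add: gt_eq_iff complexify_Re_Im GG)

lemma GJc: "Gc (Jc z) = Jc (Gc z)" by (simp add: gt_eq_iff complexify_Re_Im GJ)

lemma cpair_Gc: "cpair (Gc z) w = cpair z (Gc w)"
  using complexify_adjoint[of G 1 G] G_adj by simp

lemma ctrace_Gc: "ctrace Gc = 0"
proof -
  \<comment> \<open>The blocks of G: \<open>A\<close> maps vectors to vectors and \<open>C\<close>
    covectors to vectors. Self-adjointness makes the transpose of \<open>A\<close> the block from
    covectors to covectors.\<close>
  define A :: "real^'n^'n" where "A = (\<chi> j i. fst (G (axis i 1, 0)) $ j)"
  define C :: "real^'n^'n" where "C = (\<chi> j i. fst (G (0, axis i 1)) $ j)"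
  have sumax: "(\<Sum>i\<in>UNIV. x $ i *\<^sub>R axis i 1) = x" for x :: "real^'n"
    by (simp add: vec_eq_iff sum_axis)
  have A: "fst (G (x, 0)) = A *v x" and C: "fst (G (0, x)) = C *v x" for x
  proof -
    have "(x, 0) = (\<Sum>i\<in>UNIV. x $ i *\<^sub>R (axis i 1, 0 :: real^'n))" "(0, x) = (\<Sum>i\<in>UNIV. x $ i *\<^sub>R (0 :: real^'n, axis i 1))"
      by (simp_all add: prod_eq_iff sum_fst_snd sumax)
    then have "G (x, 0) = G (\<Sum>i\<in>UNIV. x $ i *\<^sub>R (axis i 1, 0 :: real^'n))" "G (0, x) = G (\<Sum>i\<in>UNIV. x $ i *\<^sub>R (0 :: real^'n, axis i 1))"
      by (simp_all only:)
    then have "G (x, 0) = (\<Sum>i\<in>UNIV. x $ i *\<^sub>R G (axis i 1, 0))" "G (0, x) = (\<Sum>i\<in>UNIV. x $ i *\<^sub>R G (0, axis i 1))"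
      by (simp_all only: linear_sum[OF G_lin] linear_scale[OF G_lin])
    then show "fst (G (x, 0)) = A *v x" "fst (G (0, x)) = C *v x"
      by (simp_all add: sum_fst_snd vec_eq_iff A_def C_def matrix_vector_mult_def mult.commute)
  qed
  have D: "snd (G (0, x)) = transpose A *v x" for x
  proof -
    have "snd (G (0, x)) \<bullet> y = (transpose A *v x) \<bullet> y" for y
    proof -
      have "snd (G (0, x)) \<bullet> y = 2 * pairing (G (0, x)) (y, 0)" by (simp add: pairing_def)
      also have "\<dots> = 2 * pairing (0, x) (G (y, 0))" by (simp add: G_adj)
      also have "\<dots> = x \<bullet> (A *v y)" by (simp add: pairing_def A)
      also have "\<dots> = (transpose A *v x) \<bullet> y" by (simp add: dot_lmul_matrix flip: dot_matrix_vector_mul)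
      finally show ?thesis .
    qed
    then show ?thesis by (metis vector_eq_rdot)
  qed
  have "trace A = 0"
  proof (rule trace_conjugate_neg)
    fix x assume Cx: "C *v x = 0"
    show "x = 0"
    proof (rule ccontr)
      assume "x \<noteq> 0"
      then have "pairing (G (0, x)) (0, x) > 0" by (intro G_pos) (simp add: prod_eq_iff)
      then show False using Cx by (simp add: pairing_def C)
    qed
  next
    have "(A ** C + C ** transpose A) *v x = 0" for x
    proof -
      \<comment> \<open>The vector component of G (G (0, x)) = (0, x) is the relation between
        \<open>A\<close> and \<open>C\<close>.\<close>
      have "G (0, x) = (C *v x, 0) + (0, transpose A *v x)"
        by (simp add: prod_eq_iff C D)
      then have "G (G (0, x)) = G (C *v x, 0) + G (0, transpose A *v x)"
        by (simp add: linear_add[OF G_lin] del: add_Pair)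
      then have "0 = fst (G (C *v x, 0)) + fst (G (0, transpose A *v x))"
        by (metis GG fst_add fst_conv)
      then show ?thesis by (simp add: A C matrix_vector_mul_assoc matrix_vector_mult_add_rdistrib del: transpose_matrix_vector)
    qed
    then show "A ** C + C ** transpose A = 0"
      by (metis matrix_eq matrix_vector_mult_0)
  qed
  moreover have "ctrace Gc = of_real (2 * trace A)"
  proof -
    have "cpair (Gc (gt_basis (True, i))) (gt_cobasis (True, i)) = of_real (A $ i $ i)"
      "cpair (Gc (gt_basis (False, i))) (gt_cobasis (False, i)) = of_real (A $ i $ i)" for i
    proof -
      have ax: "Re_vec (axis i 1) = axis i 1" "Im_vec (axis i 1) = 0" "Re_vec 0 = 0" "Im_vec 0 = 0"
        by (auto simp: Re_vec_def Im_vec_def axis_def vec_eq_iff)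
      have 1: "Gc (axis i 1, 0) = of_real_gt (G (axis i 1, 0))" "Gc (0, axis i 1) = of_real_gt (G (0, axis i 1))"
        by (simp_all add: gt_eq_iff complexify_Re_Im Re_gt_simps Im_gt_simps)
          (simp_all add: Re_gt_def Im_gt_def ax linear_0[OF G_lin] flip: zero_prod_def)
      have 2: "(transpose A *v axis i 1) $ i = A $ i $ i"
        by (simp add: matrix_vector_mult_basis column_def transpose_def)
      show "cpair (Gc (gt_basis (True, i))) (gt_cobasis (True, i)) = of_real (A $ i $ i)"
        "cpair (Gc (gt_basis (False, i))) (gt_cobasis (False, i)) = of_real (A $ i $ i)"
        unfolding gt_cobasis_def cpair_commute[of "Gc _"] fst_conv snd_conv simp_thms cpair_gt_basis
        by (simp_all add: gt_basis_def 1 of_real_gt_def A D 2 del: transpose_matrix_vector)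
          (simp add: matrix_vector_mult_basis column_def)
    qed
    then show ?thesis by (simp add: ctrace_def sum_bool_prod trace_def sum.distrib sum_distrib_left)
  qed
  ultimately show ?thesis by simp
qed

text \<open>The projection onto V_+^{1,0} for s = 1 and onto V_-^{1,0} for s = -1; \<open>QE\<close>
  is its conjugate. The sign is an integer because it serves both as the eigenvalue of G and as a
  shift of the second degree.\<close>

definition PE :: "int \<Rightarrow> (complex, 'n) gtan \<Rightarrow> (complex, 'n) gtan" where
  "PE s z = hol_part J (cscale_gt (1/2) (z + cscale_gt (of_int s) (Gc z)))"

definition QE :: "int \<Rightarrow> (complex, 'n) gtan \<Rightarrow> (complex, 'n) gtan" where
  "QE s z = ahol_part J (cscale_gt (1/2) (z + cscale_gt (of_int s) (Gc z)))"

definition U :: "int \<Rightarrow> int \<Rightarrow> 'n mform set" where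
  "U p q = spin_grade J p \<inter> spin_grade (G \<circ> J) q"

abbreviation "N1 \<equiv> number (hol_part J) (ahol_part J)"
abbreviation "N2 \<equiv> number (hol_part (G \<circ> J)) (ahol_part (G \<circ> J))"

lemma U_iff: "\<phi> \<in> U p q \<longleftrightarrow> alt_form \<phi> \<and> N1 \<phi> = of_int (int n - p) *\<^sub>f \<phi> \<and> N2 \<phi> = of_int (int n - q) *\<^sub>f \<phi>"
  using dim by (auto simp: U_def spin_grade_iff[OF J] spin_grade_iff[OF orth_cs_GJ])

lemma U_alt: "\<phi> \<in> U p q \<Longrightarrow> alt_form \<phi>" by (simp add: U_iff)

lemma U_bounds: "\<phi> \<in> U p q \<Longrightarrow> \<phi> \<noteq> 0 \<Longrightarrow> \<bar>p\<bar> \<le> int n \<and> \<bar>q\<bar> \<le> int n"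
  using spin_grade_bounds[OF J _ _ dim] spin_grade_bounds[OF orth_cs_GJ _ _ dim] by (auto simp: U_def)

lemma U_subspace: "0 \<in> U p q" "\<phi> \<in> U p q \<Longrightarrow> a *\<^sub>f \<phi> \<in> U p q"
  "\<phi> \<in> U p q \<Longrightarrow> \<psi> \<in> U p q \<Longrightarrow> \<phi> + \<psi> \<in> U p q" "\<phi> \<in> U p q \<Longrightarrow> \<psi> \<in> U p q \<Longrightarrow> \<phi> - \<psi> \<in> U p q"
  by (auto simp: U_iff number_op_linear cscale_form_simps(2,4,5,8) mult.commute intro!: alt_form_linear)

lemma hol_GJ: "hol_part (G \<circ> J) z = cscale_gt (1/2) (z - cscale_gt \<i> (Gc (Jc z)))"
  "ahol_part (G \<circ> J) z = cscale_gt (1/2) (z + cscale_gt \<i> (Gc (Jc z)))"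
  by (simp_all add: hol_part_def ahol_part_def complexify_o)

declare o_apply [simp del]

lemmas Jc_simps = clinD[OF clinJ[OF J]] complexify_JJ[OF J] clinD[OF clin_Gc] GGc GJc

lemma adj_pair_E:
  assumes s: "s = 1 \<or> s = -1"
  shows "adj_pair (PE s) (QE s)"
proof -
  interpret adj_pair "hol_part J" "ahol_part J" by (rule adj_pair_hol[OF J])
  define R where "R z = cscale_gt (1/2) (z + cscale_gt (of_int s) (Gc z))" for z
  have R_lin: "clin R" unfolding R_def by (intro clin_comps clin_Gc)
  have RR: "R (R z) = R z" for z
  proof -
    have "of_int s * of_int s = (1::complex)" using s by auto
    then show ?thesis
      by (auto simp: R_def Jc_simps cscale_gt_simps algebra_simps)
        (simp_all add: cscale_gt_def prod_eq_iff vec_eq_iff algebra_simps)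
  qed
  have comm: "hol_part J (R z) = R (hol_part J z)" "ahol_part J (R z) = R (ahol_part J z)" for z
    by (simp_all add: R_def hol_part_def ahol_part_def Jc_simps cscale_gt_simps algebra_simps)
  have Radj: "cpair (R z) w = cpair z (R w)" for z w
    by (simp add: R_def cpair_linear cpair_Gc)
  have PE: "PE s = (\<lambda>z. hol_part J (R z))" and QE: "QE s = (\<lambda>z. ahol_part J (R z))"
    by (auto simp: fun_eq_iff PE_def QE_def R_def)
  show ?thesis
  proof
    show "clin (PE s)" "clin (QE s)"
      unfolding PE QE clin_def by (simp_all add: clinD[OF R_lin] clinD[OF lin(1)] clinD[OF lin(2)])
    show "cpair (PE s z) w = cpair z (QE s w)" for z w
      by (simp add: PE QE adj Radj comm)
    show "PE s (PE s z) = PE s z" "QE s (QE s z) = QE s z" "PE s (QE s z) = 0" "QE s (PE s z) = 0" for z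
      by (simp_all add: PE QE comm RR idem PQ QP clinD[OF R_lin])
  qed
qed

lemma PE_iff:
  assumes s: "s = 1 \<or> s = -1"
  shows "PE s z = z \<longleftrightarrow> Jc z = cscale_gt \<i> z \<and> Gc z = cscale_gt (of_int s) z"
proof -
  interpret adj_pair "hol_part J" "ahol_part J" by (rule adj_pair_hol[OF J])
  have ss: "of_int s * of_int s = (1::complex)" using s by auto
  have half: "cscale_gt (1/2) (v + v) = v" for v :: "(complex, 'n) gtan"
    by (simp add: cscale_gt_def prod_eq_iff vec_eq_iff)
  show ?thesis
  proof
    assume z: "PE s z = z"
    then have 1: "hol_part J z = z" by (metis PE_def idem(1))
    have "Gc (PE s z) = cscale_gt (of_int s) (PE s z)"
      by (simp add: PE_def hol_part_def Jc_simps cscale_gt_simps ss algebra_simps)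
    then show "Jc z = cscale_gt \<i> z \<and> Gc z = cscale_gt (of_int s) z"
      using 1 z by (simp add: hol_part_iff[OF J])
  next
    assume z: "Jc z = cscale_gt \<i> z \<and> Gc z = cscale_gt (of_int s) z"
    then have "hol_part J z = z" by (simp add: hol_part_iff[OF J])
    then show "PE s z = z" using z by (simp add: PE_def cscale_gt_simps(5,6) ss half)
  qed
qed

lemma E_decomp: "z = PE 1 z + PE (-1) z + QE 1 z + QE (-1) z"
  by (simp add: PE_def QE_def hol_part_def ahol_part_def Jc_simps cscale_gt_simps algebra_simps)
    (simp add: cscale_gt_def prod_eq_iff vec_eq_iff algebra_simps)

text \<open>On \<open>E\<close> the structure J_2 = G J acts as s i, so \<open>z\<close> is an
  annihilator for J_1, and for J_2 an annihilator or a creator according to the sign of s. The two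
  number operators change by -1 and -s.\<close>

lemma clifford_E:
  assumes s: "s = 1 \<or> s = -1" and z: "PE s z = z" and phi: "\<phi> \<in> U p q"
  shows "clifford z \<phi> \<in> U (p + 1) (q + s)"
proof -
  interpret h1: adj_pair "hol_part J" "ahol_part J" by (rule adj_pair_hol[OF J])
  interpret h2: adj_pair "hol_part (G \<circ> J)" "ahol_part (G \<circ> J)" by (rule adj_pair_hol[OF orth_cs_GJ])
  note alt = U_alt[OF phi]
  have e: "Jc z = cscale_gt \<i> z" "Gc z = cscale_gt (of_int s) z" using z s by (simp_all add: PE_iff)
  have 1: "hol_part J z = z" using e by (simp add: hol_part_iff[OF J])
  then have 1: "hol_part J z = z" "ahol_part J z = 0" using h1.QP[of z] by simp_all
  have 2: "ahol_part (G \<circ> J) z - hol_part (G \<circ> J) z = - cscale_gt (of_int s) z"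
    using s by (auto simp: hol_GJ e Jc_simps cscale_gt_simps algebra_simps)
      (auto simp: cscale_gt_def prod_eq_iff vec_eq_iff algebra_simps)
  have "N1 (clifford z \<phi>) = of_int (int n - (p + 1)) *\<^sub>f clifford z \<phi>"
    using h1.number_clifford[OF dual_frames_gt_basis alt, of z] phi
    by (simp add: U_iff 1 clifford_linear clifford_linear_left cscale_form_simps)
  moreover have "N2 (clifford z \<phi>) = of_int (int n - (q + s)) *\<^sub>f clifford z \<phi>"
  proof -
    have e2: "N2 \<phi> = of_int (int n - q) *\<^sub>f \<phi>" using phi by (simp only: U_iff)
    have "N2 (clifford z \<phi>) = clifford z (N2 \<phi>) + clifford (ahol_part (G \<circ> J) z - hol_part (G \<circ> J) z) \<phi>"
      using h2.number_clifford[OF dual_frames_gt_basis alt, of z] by (simp add: clifford_linear_left[OF alt])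
    then show ?thesis
      unfolding 2 e2
      by (simp add: clifford_linear clifford_linear_left alt) (simp add: fun_eq_iff form_pt algebra_simps)
  qed
  ultimately show ?thesis using alt by (simp add: U_iff)
qed

lemma QE_cnj:
  shows "QE s z = cnj_gt (PE s (cnj_gt z))"
  by (simp add: PE_def QE_def hol_part_def ahol_part_def cnj_gt_simps complexify_cnj[OF G_lin] complexify_cnj[OF linJ[OF J]] Jc_simps cscale_gt_simps)

lemma clifford_E':
  assumes s: "s = 1 \<or> s = -1" and z: "QE s z = z" and phi: "\<phi> \<in> U p q"
  shows "clifford z \<phi> \<in> U (p - 1) (q - s)"
proof -
  interpret h1: adj_pair "hol_part J" "ahol_part J" by (rule adj_pair_hol[OF J])
  interpret h2: adj_pair "hol_part (G \<circ> J)" "ahol_part (G \<circ> J)" by (rule adj_pair_hol[OF orth_cs_GJ])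
  note alt = U_alt[OF phi]
  have "PE s (cnj_gt z) = cnj_gt z" using z by (metis QE_cnj cnj_gt_cnj_gt)
  then have "Jc (cnj_gt z) = cscale_gt \<i> (cnj_gt z)" "Gc (cnj_gt z) = cscale_gt (of_int s) (cnj_gt z)"
    using s by (simp_all add: PE_iff)
  then have "cnj_gt (Jc (cnj_gt z)) = cscale_gt (- \<i>) z" "cnj_gt (Gc (cnj_gt z)) = cscale_gt (of_int s) z"
    by (simp_all add: cnj_gt_simps)
  then have e: "Jc z = cscale_gt (- \<i>) z" "Gc z = cscale_gt (of_int s) z"
    by (simp_all add: complexify_cnj[OF G_lin] complexify_cnj[OF linJ[OF J]])
  have 1: "ahol_part J z = z" using e by (simp add: hol_part_iff[OF J])
  then have 1: "ahol_part J z = z" "hol_part J z = 0" using h1.PQ[of z] by simp_all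
  have 2: "ahol_part (G \<circ> J) z - hol_part (G \<circ> J) z = cscale_gt (of_int s) z"
    using s by (auto simp: hol_GJ e Jc_simps cscale_gt_simps algebra_simps)
      (auto simp: cscale_gt_def prod_eq_iff vec_eq_iff algebra_simps)
  have "N1 (clifford z \<phi>) = of_int (int n - (p - 1)) *\<^sub>f clifford z \<phi>"
    using h1.number_clifford[OF dual_frames_gt_basis alt, of z] phi[unfolded U_iff]
    by (simp add: 1 clifford_linear clifford_linear_left) (simp add: fun_eq_iff form_pt algebra_simps)
  moreover have "N2 (clifford z \<phi>) = of_int (int n - (q - s)) *\<^sub>f clifford z \<phi>"
  proof -
    have e2: "N2 \<phi> = of_int (int n - q) *\<^sub>f \<phi>" using phi by (simp only: U_iff)
    have "N2 (clifford z \<phi>) = clifford z (N2 \<phi>) + clifford (ahol_part (G \<circ> J) z - hol_part (G \<circ> J) z) \<phi>"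
      using h2.number_clifford[OF dual_frames_gt_basis alt, of z] by (simp add: clifford_linear_left[OF alt])
    then show ?thesis
      unfolding 2 e2
      by (simp add: clifford_linear clifford_linear_left alt) (simp add: fun_eq_iff form_pt algebra_simps)
  qed
  ultimately show ?thesis using alt by (simp add: U_iff)
qed

text \<open>\<open>QE s\<close> is half of Q_1 + s Q_2 + (s/2) G - (s/2) id, where Q_1 and Q_2 are
  the antiholomorphic projections of J and G J. Applying \<open>tau\<close>, the first two
  contribute n - p and s (n - q), G contributes half its trace, which is zero, and the identity
  contributes - s n.\<close>

lemma NE_U:
  assumes s: "s = 1 \<or> s = -1" and phi: "\<phi> \<in> U p q"
  shows "number (PE s) (QE s) \<phi> = (of_int (int n - p - s * q) / 2) *\<^sub>f \<phi>"
proof -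
  interpret h1: adj_pair "hol_part J" "ahol_part J" by (rule adj_pair_hol[OF J])
  interpret h2: adj_pair "hol_part (G \<circ> J)" "ahol_part (G \<circ> J)" by (rule adj_pair_hol[OF orth_cs_GJ])
  interpret e: adj_pair "PE s" "QE s" by (rule adj_pair_E[OF s])
  note alt = U_alt[OF phi]
  let ?s = "of_int s :: complex"
  have QE: "QE s = (\<lambda>z. cscale_gt (1/2) (((ahol_part J z + cscale_gt ?s (ahol_part (G \<circ> J) z)) +
      cscale_gt (?s / 2) (Gc z)) + cscale_gt (- ?s / 2) z))"
    using s by (auto simp: fun_eq_iff QE_def hol_GJ ahol_part_def complexify_o Jc_simps cscale_gt_simps algebra_simps)
  have "number (PE s) (QE s) \<phi> = tau (QE s) \<phi>" by (rule e.number_tau[OF alt])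
  also have "\<dots> = (1/2) *\<^sub>f (tau (ahol_part J) \<phi> + ?s *\<^sub>f tau (ahol_part (G \<circ> J)) \<phi> + (?s/2) *\<^sub>f tau Gc \<phi> +
      (- ?s/2) *\<^sub>f tau (\<lambda>z. z) \<phi>)"
    unfolding QE by (simp only: tau_add[OF alt] tau_scale[OF alt])
  also have "tau (ahol_part J) \<phi> = of_int (int n - p) *\<^sub>f \<phi>"
    using phi h1.number_tau[OF alt] by (simp add: U_iff)
  also have "tau (ahol_part (G \<circ> J)) \<phi> = of_int (int n - q) *\<^sub>f \<phi>"
    using phi h2.number_tau[OF alt] by (simp add: U_iff)
  also have "tau Gc \<phi> = 0"
    using tau_selfadjoint[OF clin_Gc cpair_Gc alt] by (simp add: ctrace_Gc cscale_form_simps)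
  also have "tau (\<lambda>z. z) \<phi> = of_nat (2 * n) *\<^sub>f \<phi>"
    using tau_selfadjoint[OF clin_comps(4) _ alt] by (simp add: ctrace_id dim)
  finally show ?thesis
    by (auto simp: fun_eq_iff form_pt algebra_simps)
qed

text \<open>The eigenvalue of the number operator of \<open>E\<close> is natural. This bounds p + s
  q from above by n and provides the start of the downward induction.\<close>

lemma U_nonneg:
  assumes s: "s = 1 \<or> s = -1" and phi: "\<phi> \<in> U p q" "\<phi> \<noteq> 0"
  shows "int n - p - s * q \<ge> 0"
proof -
  interpret e: adj_pair "PE s" "QE s" by (rule adj_pair_E[OF s])
  obtain j where "of_int (int n - p - s * q) / 2 = (of_nat j :: complex)"
    using e.eigen_nat[OF U_alt[OF phi(1)] NE_U[OF s phi(1)] phi(2)] by blast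
  then have "of_int (int n - p - s * q) = (of_int (2 * int j) :: complex)" by (simp add: field_simps)
  then have "int n - p - s * q = 2 * int j" by (simp only: of_int_eq_iff)
  then show ?thesis by simp
qed

text \<open>A form annihilated by all of \<open>E\<close> has \<open>E\<close>-number zero, so off
  the top weight it vanishes. Multiplying by \<open>w\<close> lowers n - p - s q by 2; starting from
  at least 3, it is still off the top, and the argument can be applied twice.\<close>

lemma E_injective:
  assumes s: "s = 1 \<or> s = -1" and phi: "\<phi> \<in> U p q" and nu: "int n - p - s * q \<ge> 3"
    and z: "\<And>z w. PE s z = z \<Longrightarrow> PE s w = w \<Longrightarrow> clifford z (clifford w \<phi>) = 0"
  shows "\<phi> = 0"
proof -
  interpret e: adj_pair "PE s" "QE s" by (rule adj_pair_E[OF s])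
  have inv: "\<psi> = 0" if psi: "\<psi> \<in> U p q" "int n - p - s * q \<noteq> 0" "\<And>z. clifford (PE s z) \<psi> = 0" for \<psi> p q
  proof -
    have "number (PE s) (QE s) \<psi> = 0" using psi(3) by (simp add: number_op_def clifford_linear)
    then have "(of_int (int n - p - s * q) / 2) *\<^sub>f \<psi> = 0" using NE_U[OF s psi(1)] by simp
    moreover have "of_int (int n - p - s * q) / 2 \<noteq> (0::complex)"
      using psi(2) by (metis divide_eq_0_iff of_int_eq_0_iff zero_neq_numeral)
    ultimately show ?thesis by (auto simp: fun_eq_iff form_pt)
  qed
  have "clifford (PE s w) \<phi> = 0" for w
  proof (rule inv[where p = "p + 1" and q = "q + s"])
    show "clifford (PE s w) \<phi> \<in> U (p + 1) (q + s)" by (rule clifford_E[OF s e.idem(1) phi])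
    have "s * s = 1" using s by auto
    then show "int n - (p + 1) - s * (q + s) \<noteq> 0" using nu by (simp add: algebra_simps)
  qed (intro z e.idem)
  then show ?thesis using nu by (intro inv[OF phi]) auto
qed

text \<open>Commuting N2 past multiplication by z inserts R z, where R = i G J is skew and commutes
  with \<open>ahol_part J\<close>. From the two factors of N1 this yields \<open>tau\<close> of R
  composed with \<open>ahol_part J\<close> and, after passing to adjoints, its negative.\<close>

lemma N1_N2_commute:
  assumes alt: "alt_form \<phi>"
  shows "N2 (N1 \<phi>) = N1 (N2 \<phi>)"
proof -
  interpret h1: adj_pair "hol_part J" "ahol_part J" by (rule adj_pair_hol[OF J])
  interpret h2: adj_pair "hol_part (G \<circ> J)" "ahol_part (G \<circ> J)" by (rule adj_pair_hol[OF orth_cs_GJ])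
  define R where "R z = ahol_part (G \<circ> J) z - hol_part (G \<circ> J) z" for z
  have R_lin: "clin R" unfolding R_def by (intro clin_comps h2.lin)
  have RGJ: "R z = cscale_gt \<i> (Gc (Jc z))" for z
    by (simp add: R_def hol_GJ) (simp add: cscale_gt_def prod_eq_iff vec_eq_iff algebra_simps)
  have comm: "R (ahol_part J z) = ahol_part J (R z)" for z
    by (simp add: RGJ ahol_part_def Jc_simps cscale_gt_simps)
  have Radj: "cpair (R z) w = - cpair z (R w)" for z w
    by (simp add: RGJ cpair_linear cpair_Gc cpair_J[OF J] GJc)
  have N2c: "N2 (clifford z \<psi>) = clifford z (N2 \<psi>) + clifford (R z) \<psi>" if "alt_form \<psi>" for z \<psi>
    using h2.number_clifford[OF dual_frames_gt_basis that, of z] by (simp add: R_def clifford_linear_left[OF that])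
  have N2sum: "N2 (\<Sum>i\<in>I. f i) = (\<Sum>i\<in>I. N2 (f i))" for f :: "bool \<times> 'n \<Rightarrow> 'n mform" and I
    by (induction I rule: infinite_finite_induct) (simp_all add: number_op_linear)
  have RQ: "clin (\<lambda>z. R (ahol_part J z))" "clin (\<lambda>z. R (hol_part J z))" "clin (\<lambda>z. - ahol_part J (R z))"
    unfolding clin_def by (simp_all add: clinD[OF R_lin] clinD[OF h1.lin(1)] clinD[OF h1.lin(2)] cscale_gt_simps)
  have "N2 (N1 \<phi>) = N1 (N2 \<phi>) + (number (hol_part J) (\<lambda>z. R (ahol_part J z)) \<phi> + number (\<lambda>z. R (hol_part J z)) (ahol_part J) \<phi>)"
  proof -
    have "N2 (N1 \<phi>) = (\<Sum>k\<in>UNIV. clifford (ahol_part J (gt_basis k)) (clifford (hol_part J (gt_cobasis k)) (N2 \<phi>))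
      + (clifford (R (ahol_part J (gt_basis k))) (clifford (hol_part J (gt_cobasis k)) \<phi>)
       + clifford (ahol_part J (gt_basis k)) (clifford (R (hol_part J (gt_cobasis k))) \<phi>)))"
      unfolding number_op_def[of _ _ "hol_part J" "ahol_part J"] N2sum
      by (intro sum.cong refl) (simp add: N2c alt clifford_linear)
    then show ?thesis by (simp only: sum.distrib number_op_def[of _ _ _ "ahol_part J"] number_op_def[of _ _ "hol_part J"])
  qed
  also have "number (hol_part J) (\<lambda>z. R (ahol_part J z)) \<phi> = tau (\<lambda>z. R (ahol_part J z)) \<phi>"
    using number_op_adjoint[OF dual_frames_gt_basis h1.lin h1.adj alt RQ(1)] by (simp add: tau_def h1.idem)
  also have "number (\<lambda>z. R (hol_part J z)) (ahol_part J) \<phi> = tau (\<lambda>z. ahol_part J (- ahol_part J (R z))) \<phi>"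
    unfolding tau_def
    by (rule number_op_adjoint[OF dual_frames_gt_basis RQ(2,3) _ alt h1.lin(2)]) (simp add: Radj h1.adj cpair_linear)
  also have "(\<lambda>z. ahol_part J (- ahol_part J (R z))) = (\<lambda>z. cscale_gt (-1) (R (ahol_part J z)))"
    by (simp add: fun_eq_iff clinD[OF h1.lin(2)] h1.idem comm cscale_gt_simps)
  finally show ?thesis by (simp add: tau_scale[OF alt] cscale_form_simps)
qed

end

section \<open>Decomposition into bidegrees and its projections\<close>

lemma sum_eigen_shift:
  fixes g :: "nat \<Rightarrow> 'v::comm_monoid_add"
  assumes "\<And>i. i > 2 * n \<Longrightarrow> g i = 0" "m > 2 * n"
  shows "(\<Sum>i<m. g i) = (\<Sum>a\<in>{- int n..int n}. g (nat (int n - a)))"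
proof -
  have "(\<Sum>i<m. g i) = (\<Sum>i\<in>{..2 * n}. g i)"
    by (rule sum.mono_neutral_right) (use assms in auto)
  also have "\<dots> = (\<Sum>a\<in>{- int n..int n}. g (nat (int n - a)))"
    by (rule sum.reindex_bij_witness[where i = "\<lambda>a. nat (int n - a)" and j = "\<lambda>i. int n - int i"]) auto
  finally show ?thesis .
qed

context herm_fibre
begin

abbreviation "wts \<equiv> {- int n..int n}"

lemma number_bound_eq: "number_bound TYPE('n) = 4 * n"
  using dim by simp

lemma U_decomp:
  assumes "alt_form \<psi>"
  shows "\<exists>f. (\<forall>a b. f a b \<in> U a b) \<and> \<psi> = (\<Sum>a\<in>wts. \<Sum>b\<in>wts. f a b)"
proof -
  interpret h1: adj_pair "hol_part J" "ahol_part J" by (rule adj_pair_hol[OF J])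
  interpret h2: adj_pair "hol_part (G \<circ> J)" "ahol_part (G \<circ> J)" by (rule adj_pair_hol[OF orth_cs_GJ])
  interpret fs: vector_space "(*\<^sub>f) :: complex \<Rightarrow> 'n mform \<Rightarrow> 'n mform" by (rule vector_space_form)
  let ?m = "Suc (number_bound TYPE('n))"
  have sub: "fs.subspace {\<phi> :: 'n mform. alt_form \<phi>}"
    unfolding fs.subspace_def by (auto intro: alt_form_linear)
  have "\<exists>f. (\<forall>i j. f i j \<in> {\<phi>. alt_form \<phi>} \<and> N1 (f i j) = of_nat i *\<^sub>f f i j \<and> N2 (f i j) = of_nat j *\<^sub>f f i j) \<and>
    \<psi> = (\<Sum>i<?m. \<Sum>j<?m. f i j)"
  proof (rule kill_decomp2[OF vector_space_form sub])
    show "kill (*\<^sub>f) N1 ?m x = 0" if "x \<in> {\<phi>. alt_form \<phi>}" for x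
      using h1.kill_number[OF dual_frames_gt_basis] that by blast
    show "kill (*\<^sub>f) N2 ?m x = 0" if "x \<in> {\<phi>. alt_form \<phi>}" for x
      using h2.kill_number[OF dual_frames_gt_basis] that by blast
  qed (use assms in \<open>auto simp: number_op_linear N1_N2_commute\<close>)
  then obtain f where f: "\<And>i j. alt_form (f i j)" "\<And>i j. N1 (f i j) = of_nat i *\<^sub>f f i j" "\<And>i j. N2 (f i j) = of_nat j *\<^sub>f f i j"
    and s: "\<psi> = (\<Sum>i<?m. \<Sum>j<?m. f i j)" by blast
  have fU: "f i j \<in> U (int n - int i) (int n - int j)" for i j
    using f by (simp add: U_iff)
  have z: "f i j = 0" if "i > 2 * n \<or> j > 2 * n" for i j
    using U_bounds[OF fU, of i j] that by linarith
  \<comment> \<open>The function \<open>nat\<close> sends every degree above n to eigenvalue 0, so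
    those degrees have to be set to zero by hand.\<close>
  define g where "g a b = (if a \<le> int n \<and> b \<le> int n then f (nat (int n - a)) (nat (int n - b)) else 0)" for a b
  have "g a b \<in> U a b" for a b
    using fU[of "nat (int n - a)" "nat (int n - b)"] U_subspace(1) by (auto simp: g_def)
  moreover have "\<psi> = (\<Sum>a\<in>wts. \<Sum>b\<in>wts. g a b)"
  proof -
    have m: "?m > 2 * n" by (simp add: number_bound_eq del: card_prod)
    have "(\<Sum>j<?m. f i j) = (\<Sum>b\<in>wts. f i (nat (int n - b)))" for i
      by (rule sum_eigen_shift[OF _ m]) (simp add: z)
    then have "\<psi> = (\<Sum>i<?m. \<Sum>b\<in>wts. f i (nat (int n - b)))" using s by simp
    also have "\<dots> = (\<Sum>a\<in>wts. \<Sum>b\<in>wts. f (nat (int n - a)) (nat (int n - b)))"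
      by (rule sum_eigen_shift[OF _ m]) (simp add: z)
    also have "\<dots> = (\<Sum>a\<in>wts. \<Sum>b\<in>wts. g a b)" by (intro sum.cong refl) (simp add: g_def)
    finally show ?thesis .
  qed
  ultimately show ?thesis by blast
qed

lemma U_unique:
  assumes f: "\<And>a b. f a b \<in> U a b" and g: "\<And>a b. g a b \<in> U a b"
    and e: "(\<Sum>a\<in>wts. \<Sum>b\<in>wts. f a b) = (\<Sum>a\<in>wts. \<Sum>b\<in>wts. g a b)"
  shows "f p q = g p q"
proof (cases "p \<in> wts \<and> q \<in> wts")
  case False
  then have "f p q = 0" "g p q = 0"
    using U_bounds[OF f, of p q] U_bounds[OF g, of p q] unfolding atLeastAtMost_iff abs_le_iff by linarith+
  then show ?thesis by simp
next
  case True
  \<comment> \<open>A single operator separates all pairs of degrees: its eigenvalues are read as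
    two-digit numbers in base 2 n + 1, each digit lying between 0 and 2 n.\<close>
  define T where "T \<phi> = N1 \<phi> + of_nat (2 * n + 1) *\<^sub>f N2 \<phi>" for \<phi>
  define h where "h k = f (fst k) (snd k) - g (fst k) (snd k)" for k
  define c :: "int \<times> int \<Rightarrow> complex" where "c k = of_int ((int n - fst k) + int (2 * n + 1) * (int n - snd k))" for k
  have "h (p, q) = 0"
  proof (rule eigen_unique[OF vector_space_form, of "wts \<times> wts" c T h])
    show "inj_on c (wts \<times> wts)"
    proof (rule inj_onI)
      fix k l assume k: "k \<in> wts \<times> wts" and l: "l \<in> wts \<times> wts" and "c k = c l"
      then have "(int n - fst k) + int (2 * n + 1) * (int n - snd k) = (int n - fst l) + int (2 * n + 1) * (int n - snd l)"
        unfolding c_def by (simp only: of_int_eq_iff)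
      then have e: "fst l - fst k = int (2 * n + 1) * (snd k - snd l)" by (simp add: algebra_simps)
      have b: "\<bar>fst l - fst k\<bar> < int (2 * n + 1)" using k l by (auto simp: mem_Times_iff)
      have "snd k = snd l"
      proof (rule ccontr)
        assume "snd k \<noteq> snd l"
        then have "\<bar>snd k - snd l\<bar> \<ge> 1" by linarith
        then have "int (2 * n + 1) * 1 \<le> int (2 * n + 1) * \<bar>snd k - snd l\<bar>" by (intro mult_left_mono) auto
        then show False using b e by (simp add: abs_mult)
      qed
      then show "k = l" using e by (simp add: prod_eq_iff)
    qed
    show "T (a *\<^sub>f x) = a *\<^sub>f T x" "T (x + y) = T x + T y" for a x y
      by (simp_all add: T_def number_op_linear cscale_form_simps mult.commute algebra_simps)
    fix k assume "k \<in> wts \<times> wts"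
    have "h k \<in> U (fst k) (snd k)" unfolding h_def by (intro U_subspace(4) f g)
    then have "N1 (h k) = of_int (int n - fst k) *\<^sub>f h k" "N2 (h k) = of_int (int n - snd k) *\<^sub>f h k"
      by (simp_all only: U_iff)
    then show "T (h k) = c k *\<^sub>f h k"
      unfolding T_def c_def by (simp only: of_int_add of_int_mult cscale_form_simps of_int_of_nat_eq)
  next
    have "(\<Sum>k\<in>wts \<times> wts. h k) = (\<Sum>a\<in>wts. \<Sum>b\<in>wts. f a b - g a b)"
      by (simp add: sum.cartesian_product h_def case_prod_beta)
    also have "\<dots> = 0" using e by (simp add: sum_subtractf)
    finally show "(\<Sum>k\<in>wts \<times> wts. h k) = 0" .
  qed (use True in auto)
  then show ?thesis by (simp add: h_def)
qed

text \<open>The projection of one fibre, obtained from \<open>spin_proj\<close> by regarding the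
  fibre as a family over a single point.\<close>

definition grade_proj :: "int \<Rightarrow> int \<Rightarrow> 'n mform \<Rightarrow> 'n mform" where
  "grade_proj p q \<psi> = spin_proj (\<lambda>_::unit. G) (\<lambda>_. J) () p q \<psi>"

lemma grade_proj_eq:
  assumes f: "\<And>a b. f a b \<in> U a b" and s: "\<psi> = (\<Sum>a\<in>wts. \<Sum>b\<in>wts. f a b)"
  shows "grade_proj p q \<psi> = f p q"
proof -
  have n2: "int (CARD('n) div 2) = int n" using dim by simp
  have pt: "(\<forall>vs. \<psi> vs = (\<Sum>a\<in>wts. \<Sum>b\<in>wts. g a b vs)) \<longleftrightarrow> \<psi> = (\<Sum>a\<in>wts. \<Sum>b\<in>wts. g a b)" for g
    by (simp add: fun_eq_iff sum_fun_apply)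
  show ?thesis
    unfolding grade_proj_def spin_proj_def Let_def n2 spin_bigrade_def U_def[symmetric] pt
  proof (rule the_equality)
    show "\<exists>f'. (\<forall>a b. f' a b \<in> U a b) \<and> \<psi> = (\<Sum>a\<in>wts. \<Sum>b\<in>wts. f' a b) \<and> f p q = f' p q"
      using f s by blast
    fix \<theta> assume "\<exists>f'. (\<forall>a b. f' a b \<in> U a b) \<and> \<psi> = (\<Sum>a\<in>wts. \<Sum>b\<in>wts. f' a b) \<and> \<theta> = f' p q"
    then obtain f' where "\<And>a b. f' a b \<in> U a b" "\<psi> = (\<Sum>a\<in>wts. \<Sum>b\<in>wts. f' a b)" "\<theta> = f' p q" by blast
    then show "\<theta> = f p q" using U_unique[of f' f] f s by metis
  qed
qed

lemma grade_proj_decomp: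
  assumes "alt_form \<psi>"
  shows "grade_proj p q \<psi> \<in> U p q" "(\<Sum>a\<in>wts. \<Sum>b\<in>wts. grade_proj a b \<psi>) = \<psi>"
proof -
  obtain f where f: "\<And>a b. f a b \<in> U a b" "\<psi> = (\<Sum>a\<in>wts. \<Sum>b\<in>wts. f a b)"
    using U_decomp[OF assms] by blast
  have c: "grade_proj a b \<psi> = f a b" for a b by (rule grade_proj_eq[OF f])
  show "grade_proj p q \<psi> \<in> U p q" "(\<Sum>a\<in>wts. \<Sum>b\<in>wts. grade_proj a b \<psi>) = \<psi>"
    unfolding c using f by simp_all
qed

lemma grade_proj_add:
  assumes "alt_form \<phi>" "alt_form \<psi>"
  shows "grade_proj p q (\<phi> + \<psi>) = grade_proj p q \<phi> + grade_proj p q \<psi>"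
  by (rule grade_proj_eq) (simp_all add: U_subspace(3) grade_proj_decomp assms sum.distrib)

lemma grade_proj_diff:
  assumes "alt_form \<phi>" "alt_form \<psi>"
  shows "grade_proj p q (\<phi> - \<psi>) = grade_proj p q \<phi> - grade_proj p q \<psi>"
  by (rule grade_proj_eq) (simp_all add: U_subspace(4) grade_proj_decomp assms sum_subtractf)

lemma grade_proj_U:
  assumes phi: "\<phi> \<in> U a b"
  shows "grade_proj p q \<phi> = (if p = a \<and> q = b then \<phi> else 0)"
proof (rule grade_proj_eq[where f = "\<lambda>p q. if p = a \<and> q = b then \<phi> else 0"])
  show "(if p = a \<and> q = b then \<phi> else 0) \<in> U p q" for p q
    using phi U_subspace(1) by auto
  have "(\<Sum>p\<in>wts. \<Sum>q\<in>wts. if p = a \<and> q = b then \<phi> else 0) = (\<Sum>p\<in>wts. if p = a then (\<Sum>q\<in>wts. if q = b then \<phi> else 0) else 0)"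
    by (intro sum.cong refl) auto
  also have "\<dots> = \<phi>" using U_bounds[OF phi] by (cases "\<phi> = 0") (auto simp: abs_le_iff)
  finally show "\<phi> = (\<Sum>p\<in>wts. \<Sum>q\<in>wts. if p = a \<and> q = b then \<phi> else 0)" by simp
qed

lemma grade_proj_zero [simp]: "grade_proj p q 0 = 0"
  using grade_proj_U[OF U_subspace(1)[of p q], of p q] by simp

lemma grade_proj_sum: "finite I \<Longrightarrow> (\<And>i. i \<in> I \<Longrightarrow> alt_form (f i)) \<Longrightarrow> grade_proj p q (\<Sum>i\<in>I. f i) = (\<Sum>i\<in>I. grade_proj p q (f i))"
  by (induction I rule: finite_induct) (simp_all add: grade_proj_add alt_form_sum)

text \<open>Every alternating form is a sum of bigraded ones. Additivity is asked for on alternating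
  forms only, since other functions on lists have no bidegree decomposition.\<close>

lemma grade_proj_ext:
  assumes psi: "alt_form \<psi>"
    and F: "\<And>\<phi> \<psi>. alt_form \<phi> \<Longrightarrow> alt_form \<psi> \<Longrightarrow> F (\<phi> + \<psi>) = F \<phi> + F \<psi>" "F 0 = (0 :: 'v::ab_group_add)"
    and F': "\<And>\<phi> \<psi>. alt_form \<phi> \<Longrightarrow> alt_form \<psi> \<Longrightarrow> F' (\<phi> + \<psi>) = F' \<phi> + F' \<psi>" "F' 0 = 0"
    and U: "\<And>a b \<phi>. \<phi> \<in> U a b \<Longrightarrow> F \<phi> = F' \<phi>"
  shows "F \<psi> = F' \<psi>"
proof -
  have s: "K (\<Sum>i\<in>I. f i) = (\<Sum>i\<in>I. K (f i))" if "finite I" "\<And>i. alt_form (f i)" "K 0 = 0"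
    "\<And>\<phi> \<psi>. alt_form \<phi> \<Longrightarrow> alt_form \<psi> \<Longrightarrow> K (\<phi> + \<psi>) = K \<phi> + K \<psi>"
    for K :: "'n mform \<Rightarrow> 'v" and I :: "int set" and f
    using that by (induction I rule: finite_induct) (simp_all add: alt_form_sum)
  have a: "alt_form (grade_proj a b \<psi>)" for a b using U_alt[OF grade_proj_decomp(1)[OF psi]] .
  have "K \<psi> = (\<Sum>a\<in>wts. \<Sum>b\<in>wts. K (grade_proj a b \<psi>))" if "K 0 = 0"
    "\<And>\<phi> \<psi>. alt_form \<phi> \<Longrightarrow> alt_form \<psi> \<Longrightarrow> K (\<phi> + \<psi>) = K \<phi> + K \<psi>"
    for K :: "'n mform \<Rightarrow> 'v"
  proof -
    have "K (\<Sum>a\<in>wts. \<Sum>b\<in>wts. grade_proj a b \<psi>) = (\<Sum>a\<in>wts. K (\<Sum>b\<in>wts. grade_proj a b \<psi>))"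
      by (rule s) (use that a in \<open>auto intro: alt_form_sum\<close>)
    also have "\<dots> = (\<Sum>a\<in>wts. \<Sum>b\<in>wts. K (grade_proj a b \<psi>))"
      by (intro sum.cong refl s) (use that a in auto)
    finally show ?thesis by (simp add: grade_proj_decomp(2)[OF psi])
  qed
  from this[of F] this[of F'] show ?thesis
    using F F' U[OF grade_proj_decomp(1)[OF psi]] by simp
qed

lemma grade_proj_clifford:
  assumes s: "s = 1 \<or> s = -1" and psi: "alt_form \<psi>"
  shows "PE s z = z \<Longrightarrow> grade_proj (p + 1) (q + s) (clifford z \<psi>) = clifford z (grade_proj p q \<psi>)"
    and "QE s z = z \<Longrightarrow> grade_proj (p - 1) (q - s) (clifford z \<psi>) = clifford z (grade_proj p q \<psi>)"
proof -
  show "grade_proj (p + 1) (q + s) (clifford z \<psi>) = clifford z (grade_proj p q \<psi>)" if z: "PE s z = z"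
  proof (rule grade_proj_ext[OF psi])
    fix a b \<phi> assume phi: "\<phi> \<in> U a b"
    show "grade_proj (p + 1) (q + s) (clifford z \<phi>) = clifford z (grade_proj p q \<phi>)"
      unfolding grade_proj_U[OF clifford_E[OF s z phi]] grade_proj_U[OF phi] by (simp add: clifford_linear)
  qed (simp_all add: clifford_linear grade_proj_add grade_proj_decomp)
  show "grade_proj (p - 1) (q - s) (clifford z \<psi>) = clifford z (grade_proj p q \<psi>)" if z: "QE s z = z"
  proof (rule grade_proj_ext[OF psi])
    fix a b \<phi> assume phi: "\<phi> \<in> U a b"
    show "grade_proj (p - 1) (q - s) (clifford z \<phi>) = clifford z (grade_proj p q \<phi>)"
      unfolding grade_proj_U[OF clifford_E'[OF s z phi]] grade_proj_U[OF phi] by (simp add: clifford_linear)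
  qed (simp_all add: clifford_linear grade_proj_add grade_proj_decomp)
qed

end

section \<open>Smooth functions\<close>

lemma differentiable_on_open_cong:
  assumes "open S" "x \<in> S" "\<And>y. y \<in> S \<Longrightarrow> f y = g y"
  shows "f differentiable at x \<longleftrightarrow> g differentiable at x"
    "frechet_derivative f (at x) = frechet_derivative g (at x)"
proof -
  have h: "(f has_derivative f') (at x) \<longleftrightarrow> (g has_derivative f') (at x)" for f'
    using has_derivative_transform_within_open[of f f' x UNIV S g]
      has_derivative_transform_within_open[of g f' x UNIV S f] assms by auto
  show "f differentiable at x \<longleftrightarrow> g differentiable at x"
    by (simp add: differentiable_def h)
  show "frechet_derivative f (at x) = frechet_derivative g (at x)"
    by (simp add: frechet_derivative_def h)
qed

lemma Ck_on_cong:
  assumes "open S" "\<And>x. x \<in> S \<Longrightarrow> f x = g x"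
  shows "Ck_on k S f \<longleftrightarrow> Ck_on k S g"
  using assms
proof (induction k arbitrary: f g)
  case 0
  then show ?case by (simp cong: continuous_on_cong)
next
  case (Suc k)
  have d: "frechet_derivative f (at x) = frechet_derivative g (at x)" "f differentiable at x \<longleftrightarrow> g differentiable at x"
    if "x \<in> S" for x
    using differentiable_on_open_cong[OF assms(1) that Suc.prems(2)] by auto
  have "Ck_on k S (\<lambda>x. frechet_derivative f (at x) v) \<longleftrightarrow> Ck_on k S (\<lambda>x. frechet_derivative g (at x) v)" for v
    by (rule Suc.IH[OF assms(1)]) (simp add: d)
  then show ?case using d by simp
qed

lemma Ck_on_SucI:
  assumes "open S" "\<And>x. x \<in> S \<Longrightarrow> (f has_derivative f' x) (at x)" "\<And>v. Ck_on k S (\<lambda>x. f' x v)"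
  shows "Ck_on (Suc k) S f"
proof -
  have "frechet_derivative f (at x) = f' x" if "x \<in> S" for x
    using frechet_derivative_at[OF assms(2)[OF that]] by simp
  then have "Ck_on k S (\<lambda>x. frechet_derivative f (at x) v)" for v
    using assms(3)[of v] Ck_on_cong[OF assms(1), of "\<lambda>x. frechet_derivative f (at x) v" "\<lambda>x. f' x v"] by simp
  then show ?thesis using assms(2) by (auto simp: differentiable_def)
qed

lemma Ck_on_SucD:
  assumes "Ck_on (Suc k) S f"
  shows "x \<in> S \<Longrightarrow> (f has_derivative frechet_derivative f (at x)) (at x)"
    "Ck_on k S (\<lambda>x. frechet_derivative f (at x) v)"
  using assms by (auto simp: frechet_derivative_works)

lemma Ck_on_Suc_imp: "Ck_on (Suc k) S f \<Longrightarrow> Ck_on k S f"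
proof (induction k arbitrary: f)
  case 0
  then have "f differentiable at x within S" if "x \<in> S" for x
    using that by (simp add: differentiable_at_withinI)
  then show ?case
    by (simp add: continuous_on_eq_continuous_within differentiable_imp_continuous_within)
next
  case (Suc k)
  then show ?case by simp
qed

lemma Ck_on_const: "open S \<Longrightarrow> Ck_on k S (\<lambda>x. c)"
  by (induction k arbitrary: c) (auto)

lemma Ck_on_subset: "Ck_on k S f \<Longrightarrow> T \<subseteq> S \<Longrightarrow> Ck_on k T f"
  by (induction k arbitrary: f) (auto intro: continuous_on_subset)

lemma Ck_on_bounded_linear:
  assumes L: "bounded_linear L" and "open S" "Ck_on k S f"
  shows "Ck_on k S (\<lambda>x. L (f x))"
  using assms(3)
proof (induction k arbitrary: f)
  case 0
  then show ?case by (simp add: bounded_linear.continuous_on[OF L])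
next
  case (Suc k)
  show ?case
    by (rule Ck_on_SucI[OF assms(2) bounded_linear.has_derivative[OF L Ck_on_SucD(1)[OF Suc.prems]]])
      (use Suc in auto)
qed

lemma Ck_on_add:
  assumes "open S" "Ck_on k S f" "Ck_on k S g"
  shows "Ck_on k S (\<lambda>x. f x + g x)"
  using assms(2,3)
proof (induction k arbitrary: f g)
  case 0
  then show ?case by (simp add: continuous_on_add)
next
  case (Suc k)
  show ?case
    by (rule Ck_on_SucI[OF assms(1) has_derivative_add[OF Ck_on_SucD(1)[OF Suc.prems(1)] Ck_on_SucD(1)[OF Suc.prems(2)]]])
      (use Suc in auto)
qed

lemma Ck_on_sum:
  assumes "open S" "\<And>i. i \<in> I \<Longrightarrow> Ck_on k S (f i)"
  shows "Ck_on k S (\<lambda>x. \<Sum>i\<in>I. f i x)"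
  using assms(2) by (induction I rule: infinite_finite_induct) (auto intro: Ck_on_const Ck_on_add assms(1))

lemma Ck_on_bilinear:
  assumes B: "bounded_bilinear B" and "open S" "Ck_on k S f" "Ck_on k S g"
  shows "Ck_on k S (\<lambda>x. B (f x) (g x))"
  using assms(3,4)
proof (induction k arbitrary: f g)
  case 0
  then show ?case by (simp add: bounded_bilinear.continuous_on[OF B])
next
  case (Suc k)
  show ?case
  proof (rule Ck_on_SucI[OF assms(2)])
    fix x assume x: "x \<in> S"
    show "((\<lambda>x. B (f x) (g x)) has_derivative
      (\<lambda>v. B (f x) (frechet_derivative g (at x) v) + B (frechet_derivative f (at x) v) (g x))) (at x)"
      by (rule bounded_bilinear.FDERIV[OF B Ck_on_SucD(1)[OF Suc.prems(1) x] Ck_on_SucD(1)[OF Suc.prems(2) x]])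
  next
    fix v
    show "Ck_on k S (\<lambda>x. B (f x) (frechet_derivative g (at x) v) + B (frechet_derivative f (at x) v) (g x))"
      by (intro Ck_on_add assms(2) Suc.IH Ck_on_Suc_imp[OF Suc.prems(1)] Ck_on_Suc_imp[OF Suc.prems(2)]
          Ck_on_SucD(2)[OF Suc.prems(1)] Ck_on_SucD(2)[OF Suc.prems(2)])
  qed
qed

lemma Ck_on_compose:
  fixes g :: "'u::euclidean_space \<Rightarrow> 'v::euclidean_space"
  assumes "open S" "open T" "g ` S \<subseteq> T" "Ck_on k T f" "Ck_on k S g"
  shows "Ck_on k S (\<lambda>x. f (g x))"
  using assms(4,5)
proof (induction k arbitrary: f)
  case 0
  then show ?case using assms(3) by (auto intro: continuous_on_compose2)
next
  case (Suc k)
  have lin: "linear (frechet_derivative f (at y))" if "y \<in> T" for y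
    using Ck_on_SucD(1)[OF Suc.prems(1) that] by (rule has_derivative_linear)
  show ?case
  proof (rule Ck_on_SucI[OF assms(1)])
    fix x assume x: "x \<in> S"
    have "((\<lambda>x. f (g x)) has_derivative (\<lambda>v. frechet_derivative f (at (g x)) (frechet_derivative g (at x) v))) (at x)"
      using diff_chain_at[OF Ck_on_SucD(1)[OF Suc.prems(2) x] Ck_on_SucD(1)[OF Suc.prems(1)]] x assms(3)
      by (auto simp: o_def)
    \<comment> \<open>The induction hypothesis concerns derivatives of \<open>f\<close> in fixed
      directions, so the moving direction is expanded in the standard basis and its coordinates
      become smooth coefficients.\<close>
    also have "(\<lambda>v. frechet_derivative f (at (g x)) (frechet_derivative g (at x) v)) =
      (\<lambda>v. \<Sum>b\<in>Basis. (frechet_derivative g (at x) v \<bullet> b) *\<^sub>R frechet_derivative f (at (g x)) b)"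
    proof
      fix v
      let ?w = "frechet_derivative g (at x) v"
      have l: "linear (frechet_derivative f (at (g x)))" using lin x assms(3) by auto
      have "frechet_derivative f (at (g x)) ?w = frechet_derivative f (at (g x)) (\<Sum>b\<in>Basis. (?w \<bullet> b) *\<^sub>R b)"
        by (simp add: euclidean_representation)
      also have "\<dots> = (\<Sum>b\<in>Basis. (?w \<bullet> b) *\<^sub>R frechet_derivative f (at (g x)) b)"
        by (simp only: linear_sum[OF l] linear_scale[OF l])
      finally show "frechet_derivative f (at (g x)) ?w = (\<Sum>b\<in>Basis. (?w \<bullet> b) *\<^sub>R frechet_derivative f (at (g x)) b)" .
    qed
    finally show "((\<lambda>x. f (g x)) has_derivative (\<lambda>v. \<Sum>b\<in>Basis. (frechet_derivative g (at x) v \<bullet> b) *\<^sub>R frechet_derivative f (at (g x)) b)) (at x)" .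
  next
    fix v
    show "Ck_on k S (\<lambda>x. \<Sum>b\<in>Basis. (frechet_derivative g (at x) v \<bullet> b) *\<^sub>R frechet_derivative f (at (g x)) b)"
      by (intro Ck_on_sum assms(1) Ck_on_bilinear[OF bounded_bilinear_scaleR] Suc.IH
          Ck_on_SucD(2)[OF Suc.prems(1)] Ck_on_Suc_imp[OF Suc.prems(2)]
          Ck_on_bounded_linear[OF bounded_linear_inner_left] Ck_on_SucD(2)[OF Suc.prems(2)])
  qed
qed

lemma smooth_on_cong: "open S \<Longrightarrow> (\<And>x. x \<in> S \<Longrightarrow> f x = g x) \<Longrightarrow> smooth_on S f \<longleftrightarrow> smooth_on S g"
  using Ck_on_cong[of S f g] by (simp add: smooth_on_def)

lemma smooth_on_const: "open S \<Longrightarrow> smooth_on S (\<lambda>x. c)"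
  by (simp add: smooth_on_def Ck_on_const)

lemma smooth_on_subset: "smooth_on S f \<Longrightarrow> T \<subseteq> S \<Longrightarrow> smooth_on T f"
  unfolding smooth_on_def using Ck_on_subset by blast

lemma smooth_on_bounded_linear: "bounded_linear L \<Longrightarrow> open S \<Longrightarrow> smooth_on S f \<Longrightarrow> smooth_on S (\<lambda>x. L (f x))"
  by (simp add: smooth_on_def Ck_on_bounded_linear)

lemma smooth_on_add: "open S \<Longrightarrow> smooth_on S f \<Longrightarrow> smooth_on S g \<Longrightarrow> smooth_on S (\<lambda>x. f x + g x)"
  by (simp add: smooth_on_def Ck_on_add)

lemma smooth_on_sum: "open S \<Longrightarrow> (\<And>i. i \<in> I \<Longrightarrow> smooth_on S (f i)) \<Longrightarrow> smooth_on S (\<lambda>x. \<Sum>i\<in>I. f i x)"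
  by (simp add: smooth_on_def Ck_on_sum)

lemma smooth_on_bilinear:
  "bounded_bilinear B \<Longrightarrow> open S \<Longrightarrow> smooth_on S f \<Longrightarrow> smooth_on S g \<Longrightarrow> smooth_on S (\<lambda>x. B (f x) (g x))"
  by (simp add: smooth_on_def Ck_on_bilinear)

lemmas smooth_on_mult = smooth_on_bilinear[OF bounded_bilinear_mult]

lemma smooth_on_compose:
  fixes g :: "'u::euclidean_space \<Rightarrow> 'v::euclidean_space"
  shows "open S \<Longrightarrow> open T \<Longrightarrow> g ` S \<subseteq> T \<Longrightarrow> smooth_on T f \<Longrightarrow> smooth_on S g \<Longrightarrow> smooth_on S (\<lambda>x. f (g x))"
  by (simp add: smooth_on_def Ck_on_compose)

lemma smooth_on_differentiable: "smooth_on S f \<Longrightarrow> x \<in> S \<Longrightarrow> f differentiable at x"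
  unfolding smooth_on_def using Ck_on.simps(2)[of 0 S f] by blast

lemma smooth_on_frechet: "smooth_on S f \<Longrightarrow> smooth_on S (\<lambda>x. frechet_derivative f (at x) v)"
  unfolding smooth_on_def using Ck_on_SucD(2) by blast

lemma bounded_linear_axis: "bounded_linear (axis i :: 'k::real_normed_vector \<Rightarrow> 'k^'m::finite)"
proof (rule bounded_linear_intro[where K = 1])
  fix x y :: 'k and r :: real
  show "axis i (x + y) = axis i x + axis i y" "axis i (r *\<^sub>R x) = r *\<^sub>R axis i x"
    by (auto simp: axis_def vec_eq_iff)
  have "norm (axis i x) \<le> (\<Sum>j\<in>UNIV. norm (axis i x $ j))" by (simp add: norm_vec_def L2_set_le_sum)
  also have "(\<Sum>j\<in>UNIV. norm (axis i x $ j)) = (\<Sum>j\<in>UNIV. if j = i then norm x else 0)"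
    by (intro sum.cong) (auto simp: axis_def)
  finally show "norm (axis i x) \<le> norm x * 1" by simp
qed

lemma smooth_on_vec:
  fixes f :: "'v::real_normed_vector \<Rightarrow> 'k::real_normed_vector^'m::finite"
  assumes "open S"
  shows "smooth_on S f \<longleftrightarrow> (\<forall>i. smooth_on S (\<lambda>x. f x $ i))"
proof
  assume "smooth_on S f"
  then show "\<forall>i. smooth_on S (\<lambda>x. f x $ i)"
    using smooth_on_bounded_linear[OF bounded_linear_vec_nth assms] by blast
next
  assume a: "\<forall>i. smooth_on S (\<lambda>x. f x $ i)"
  have "f = (\<lambda>x. \<Sum>i\<in>UNIV. axis i (f x $ i))"
  proof -
    have "(\<Sum>i\<in>UNIV. axis i (f x $ i) $ j) = (\<Sum>i\<in>UNIV. if i = j then f x $ j else 0)" for x j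
      by (intro sum.cong) (auto simp: axis_def)
    then show ?thesis by (simp add: fun_eq_iff vec_eq_iff)
  qed
  moreover have "smooth_on S (\<lambda>x. \<Sum>i\<in>UNIV. axis i (f x $ i))"
    by (intro smooth_on_sum assms smooth_on_bounded_linear[OF bounded_linear_axis]) (use a in auto)
  ultimately show "smooth_on S f" by simp
qed

lemma smooth_on_pair:
  assumes "open S"
  shows "smooth_on S f \<longleftrightarrow> smooth_on S (\<lambda>x. fst (f x)) \<and> smooth_on S (\<lambda>x. snd (f x))"
proof
  assume "smooth_on S f"
  then show "smooth_on S (\<lambda>x. fst (f x)) \<and> smooth_on S (\<lambda>x. snd (f x))"
    using smooth_on_bounded_linear[OF bounded_linear_fst assms] smooth_on_bounded_linear[OF bounded_linear_snd assms]
    by blast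
next
  assume "smooth_on S (\<lambda>x. fst (f x)) \<and> smooth_on S (\<lambda>x. snd (f x))"
  moreover have "bounded_linear (\<lambda>x. (x, 0 :: 'c))" "bounded_linear (\<lambda>y. (0 :: 'b, y))"
    by (intro bounded_linear_Pair bounded_linear_ident bounded_linear_zero)+
  ultimately have "smooth_on S (\<lambda>x. (fst (f x), 0) + (0, snd (f x)))"
    by (intro smooth_on_add assms) (auto intro: smooth_on_bounded_linear assms)
  then show "smooth_on S f" by simp
qed

section \<open>Coordinates\<close>

locale atlas =
  fixes A :: "('a::{t2_space,second_countable_topology}, 'n::finite) chart set"
  assumes A: "smooth_atlas A"
begin

lemma chartD:
  assumes "c \<in> A"
  shows "open (fst c)" "open (snd c ` fst c)" "homeomorphism (fst c) (snd c ` fst c) (snd c) (chart_inv c)"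
  using A assms unfolding smooth_atlas_def by blast+

lemma chart_inv [simp]: "c \<in> A \<Longrightarrow> p \<in> fst c \<Longrightarrow> chart_inv c (snd c p) = p"
  using homeomorphism_apply1[OF chartD(3)] by blast

lemma open_chart_image: "c \<in> A \<Longrightarrow> open W \<Longrightarrow> open (snd c ` (fst c \<inter> W))"
proof -
  assume c: "c \<in> A" and W: "open W"
  have "openin (top_of_set (snd c ` fst c)) (snd c ` (fst c \<inter> W))"
    by (rule homeomorphism_imp_open_map[OF chartD(3)[OF c]]) (use W in auto)
  then show ?thesis using chartD(2)[OF c] by (simp add: openin_open_eq)
qed

lemma chart_at: "chart_at A p \<in> A" "p \<in> fst (chart_at A p)"
proof -
  have "\<exists>c. c \<in> A \<and> p \<in> fst c" using A unfolding smooth_atlas_def by blast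
  then have "chart_at A p \<in> A \<and> p \<in> fst (chart_at A p)" unfolding chart_at_def by (rule someI_ex)
  then show "chart_at A p \<in> A" "p \<in> fst (chart_at A p)" by auto
qed

lemma transition_smooth: "c \<in> A \<Longrightarrow> c' \<in> A \<Longrightarrow> smooth_on (snd c ` (fst c \<inter> fst c')) (snd c' \<circ> chart_inv c)"
  using A unfolding smooth_atlas_def by blast

lemma transition_deriv:
  assumes "c \<in> A" "c' \<in> A" "p \<in> fst c" "p \<in> fst c'"
  shows "((snd c' \<circ> chart_inv c) has_derivative (*v) (jacobian c c' p)) (at (snd c p))"
proof -
  have "(snd c' \<circ> chart_inv c) differentiable at (snd c p)"
    by (rule smooth_on_differentiable[OF transition_smooth[OF assms(1,2)]]) (use assms in auto)
  then have d: "((snd c' \<circ> chart_inv c) has_derivative frechet_derivative (snd c' \<circ> chart_inv c) (at (snd c p))) (at (snd c p))"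
    by (simp add: frechet_derivative_works)
  have "(*v) (jacobian c c' p) = frechet_derivative (snd c' \<circ> chart_inv c) (at (snd c p))"
    unfolding jacobian_def by (rule matrix_vector_mul(2)[OF has_derivative_linear[OF d]])
  then show ?thesis using d by simp
qed

lemma jacobian_cocycle:
  assumes c: "c \<in> A" "c' \<in> A" "c'' \<in> A" and p: "p \<in> fst c" "p \<in> fst c'" "p \<in> fst c''"
  shows "jacobian c' c'' p ** jacobian c c' p = jacobian c c'' p"
proof -
  let ?S = "snd c ` (fst c \<inter> fst c')"
  have S: "open ?S" "snd c p \<in> ?S" using open_chart_image[OF c(1) chartD(1)[OF c(2)]] p by auto
  have y: "(snd c' \<circ> chart_inv c) (snd c p) = snd c' p" using c p by simp
  have "((snd c'' \<circ> chart_inv c') \<circ> (snd c' \<circ> chart_inv c) has_derivative (*v) (jacobian c' c'' p) \<circ> (*v) (jacobian c c' p)) (at (snd c p))"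
    by (rule diff_chain_at[OF transition_deriv[OF c(1,2) p(1,2)]])
      (use transition_deriv[OF c(2,3) p(2,3)] y in simp)
  then have "((snd c'' \<circ> chart_inv c) has_derivative (*v) (jacobian c' c'' p) \<circ> (*v) (jacobian c c' p)) (at (snd c p))"
    by (rule has_derivative_transform_within_open[OF _ S]) (use c in \<open>auto simp: o_def\<close>)
  from has_derivative_unique[OF this transition_deriv[OF c(1,3) p(1,3)]]
  have "jacobian c' c'' p *v (jacobian c c' p *v x) = jacobian c c'' p *v x" for x
    by (metis o_apply)
  then show ?thesis by (metis matrix_eq matrix_vector_mul_assoc)
qed

lemma jacobian_self:
  assumes c: "c \<in> A" and p: "p \<in> fst c"
  shows "jacobian c c p = mat 1"
proof -
  have S: "open (snd c ` fst c)" "snd c p \<in> snd c ` fst c" using chartD(2)[OF c] p by auto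
  have "((snd c \<circ> chart_inv c) has_derivative (\<lambda>x. x)) (at (snd c p))"
    by (rule has_derivative_transform_within_open[OF has_derivative_ident S]) (use c in auto)
  from has_derivative_unique[OF this transition_deriv[OF c c p p]]
  have "jacobian c c p *v x = mat 1 *v x" for x by (metis matrix_vector_mul_lid)
  then show ?thesis by (metis matrix_eq)
qed

lemma jacobian_inverse:
  assumes "c \<in> A" "c' \<in> A" "p \<in> fst c" "p \<in> fst c'"
  shows "jacobian c' c p ** jacobian c c' p = mat 1"
  using jacobian_cocycle[of c c' c p] jacobian_self assms by simp

lemma jacobian_smooth:
  assumes "c \<in> A" "c' \<in> A"
  shows "smooth_on (snd c ` (fst c \<inter> fst c')) (\<lambda>y. jacobian c c' (chart_inv c y) $ i $ j)"
proof -
  let ?S = "snd c ` (fst c \<inter> fst c')"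
  have S: "open ?S" using open_chart_image[OF assms(1) chartD(1)[OF assms(2)]] .
  have "smooth_on ?S (\<lambda>y. frechet_derivative (snd c' \<circ> chart_inv c) (at y) (axis j 1) $ i)"
    by (intro smooth_on_bounded_linear[OF bounded_linear_vec_nth S] smooth_on_frechet transition_smooth assms)
  moreover have "jacobian c c' (chart_inv c y) $ i $ j = frechet_derivative (snd c' \<circ> chart_inv c) (at y) (axis j 1) $ i"
    if "y \<in> ?S" for y
    using that assms by (auto simp: jacobian_def matrix_def)
  ultimately show ?thesis
    using smooth_on_cong[OF S, of "\<lambda>y. jacobian c c' (chart_inv c y) $ i $ j"
        "\<lambda>y. frechet_derivative (snd c' \<circ> chart_inv c) (at y) (axis j 1) $ i"] by blast
qed

end

section \<open>Change of coordinates\<close>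

abbreviation cmat :: "real^'n^'m \<Rightarrow> 'k::real_normed_field^'n^'m" where "cmat \<equiv> map_matrix of_real"

lemma cmat_mult: "cmat (M ** N) = (cmat M ** cmat N :: 'k::real_normed_field^'n::finite^'m::finite)"
  by (simp add: vec_eq_iff matrix_matrix_mult_def)

lemma map_matrix_id: "map_matrix id M = M"
  by (simp add: vec_eq_iff)

lemma cmat_1: "cmat (mat 1) = (mat 1 :: 'k::real_normed_field^'n::finite^'n)"
  by (simp add: vec_eq_iff mat_def)

text \<open>Coordinate change from \<open>c\<close> to \<open>c'\<close> on both summands; covectors
  use the transposed inverse Jacobian, which is the Jacobian of the opposite change.\<close>

definition gtrans :: "('a, 'n::finite) chart \<Rightarrow> ('a, 'n) chart \<Rightarrow> 'a \<Rightarrow> ('k::real_normed_field, 'n) gtan \<Rightarrow> ('k, 'n) gtan" where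
  "gtrans c c' p z = (cmat (jacobian c c' p) *v fst z, cmat (transpose (jacobian c' c p)) *v snd z)"

lemma sec_coord_eq: "sec_coord A c v y = gtrans (chart_at A (chart_inv c y)) c (chart_inv c y) (v (chart_inv c y))"
  by (simp add: sec_coord_def gtrans_def Let_def)

lemma matrix_vector_scale: "(M :: complex^'n^'m) *v (a *s x) = a *s (M *v x)"
  by (simp add: vec_eq_iff matrix_vector_mult_def sum_distrib_left mult.left_commute)

lemma gtrans_clin: "clin (gtrans c c' p)"
  by (simp add: clin_def gtrans_def cscale_gt_def prod_eq_iff matrix_vector_right_distrib matrix_vector_scale)

definition pullback :: "real^'n^'n \<Rightarrow> 'n::finite mform \<Rightarrow> 'n mform" where
  "pullback M \<phi> = (\<lambda>vs. \<phi> (map ((*v) M) vs))"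

lemma form_coord_eq:
  "form_coord A c \<phi> y = pullback (jacobian c (chart_at A (chart_inv c y)) (chart_inv c y)) (\<phi> (chart_inv c y))"
  by (simp add: form_coord_def pullback_def Let_def fun_eq_iff)

lemma pullback_pullback: "pullback M (pullback N \<phi>) = pullback (N ** M) \<phi>"
  by (simp add: pullback_def fun_eq_iff matrix_vector_mul_assoc o_def cong: map_cong)

lemma pullback_1: "pullback (mat 1) \<phi> = \<phi>"
proof
  fix vs
  have "map ((*v) (mat 1 :: real^'a^'a)) vs = vs" by (induction vs) auto
  then show "pullback (mat 1) \<phi> vs = \<phi> vs" by (simp only: pullback_def)
qed

lemma pullback_linear: "pullback M (\<phi> + \<psi>) = pullback M \<phi> + pullback M \<psi>" "pullback M (a *\<^sub>f \<phi>) = a *\<^sub>f pullback M \<phi>"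
  "pullback M 0 = 0"
  by (simp_all add: pullback_def fun_eq_iff form_pt)

lemma alt_form_pullback: "alt_form \<phi> \<Longrightarrow> alt_form (pullback M \<phi>)"
  unfolding alt_form_def pullback_def linear_iff
  by (simp add: matrix_vector_right_distrib scaleR_matrix_vector_assoc[symmetric] matrix_vector_mult_scaleR)

lemma wedge_pullback: "pullback M (wedge \<alpha> \<beta>) = wedge (pullback M \<alpha>) (pullback M \<beta>)"
  by (simp add: pullback_def wedge_def fun_eq_iff nths_map)

lemma Re_vec_cmat: "Re_vec (cmat M *v X) = M *v Re_vec X" "Im_vec (cmat M *v X) = M *v Im_vec X"
  by (simp_all add: Re_vec_def Im_vec_def vec_eq_iff matrix_vector_mult_def)

lemma pullback_covec_form: "pullback M (covec_form \<xi>) = covec_form (cmat (transpose M) *v \<xi>)"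
proof
  fix vs
  show "pullback M (covec_form \<xi>) vs = covec_form (cmat (transpose M) *v \<xi>) vs"
  proof (cases "\<exists>v. vs = [v]")
    case True
    then obtain v where v: "vs = [v]" by blast
    have "(\<Sum>i\<in>UNIV. \<xi> $ i * of_real (\<Sum>j\<in>UNIV. M $ i $ j * v $ j)) =
      (\<Sum>j\<in>UNIV. (\<Sum>i\<in>UNIV. of_real (M $ i $ j) * \<xi> $ i) * of_real (v $ j))"
      unfolding of_real_sum sum_distrib_left sum_distrib_right of_real_mult
      by (subst sum.swap) (simp add: mult_ac)
    then show ?thesis by (simp add: v pullback_def covec_form_def matrix_vector_mult_def transpose_def)
  next
    case False
    then show ?thesis by (auto simp: pullback_def covec_form_def split: list.splits)
  qed
qed

lemma pullback_contract:
  assumes "M ** M' = mat 1"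
  shows "pullback M (contract X \<phi>) = contract (cmat M' *v X) (pullback M \<phi>)"
proof -
  have "M *v (M' *v x) = x" for x by (simp add: matrix_vector_mul_assoc assms)
  then show ?thesis by (simp add: pullback_def contract_def fun_eq_iff Re_vec_cmat)
qed

lemma pullback_clifford:
  assumes "M ** M' = mat 1"
  shows "pullback M (clifford z \<phi>) = clifford (cmat M' *v fst z, cmat (transpose M) *v snd z) (pullback M \<phi>)"
  by (simp add: clifford_eq pullback_linear pullback_contract[OF assms] wedge_pullback pullback_covec_form)

lemma cmat_inner: "(\<Sum>i\<in>UNIV. (cmat (transpose M) *v \<xi>) $ i * (cmat N *v X) $ i) = (\<Sum>i\<in>UNIV. \<xi> $ i * X $ i)"
  if "M ** N = mat 1" for \<xi> X :: "complex^'n::finite"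
proof -
  have "(\<Sum>i\<in>UNIV. (cmat (transpose M) *v \<xi>) $ i * x $ i) = (\<Sum>i\<in>UNIV. \<xi> $ i * (cmat M *v x) $ i)" for x
  proof -
    have "(\<Sum>i\<in>UNIV. (\<Sum>j\<in>UNIV. of_real (M $ j $ i) * \<xi> $ j) * x $ i) =
      (\<Sum>j\<in>UNIV. \<xi> $ j * (\<Sum>i\<in>UNIV. of_real (M $ j $ i) * x $ i))"
      unfolding sum_distrib_left sum_distrib_right by (subst sum.swap) (simp add: mult_ac)
    then show ?thesis by (simp add: matrix_vector_mult_def transpose_def)
  qed
  moreover have "cmat M *v (cmat N *v X) = X"
    by (simp add: matrix_vector_mul_assoc that cmat_1 flip: cmat_mult)
  ultimately show ?thesis by simp
qed

section \<open>Smoothly varying alternating forms\<close>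

definition smooth_family :: "(real^'n) set \<Rightarrow> (real^'n \<Rightarrow> 'n::finite mform) \<Rightarrow> bool" where
  "smooth_family S F \<longleftrightarrow> (\<forall>y\<in>S. alt_form (F y)) \<and> (\<forall>vs. smooth_on S (\<lambda>y. F y vs))"

lemma alt_form_expand:
  assumes "alt_form \<phi>"
  shows "\<phi> (x # vs) = (\<Sum>i\<in>UNIV. of_real (x $ i) * \<phi> (axis i 1 # vs))"
proof -
  have "x = (\<Sum>i\<in>UNIV. x $ i *\<^sub>R axis i 1)"
    by (simp add: vec_eq_iff sum_axis)
  then have "\<phi> (x # vs) = (\<lambda>x. \<phi> (x # vs)) (\<Sum>i\<in>UNIV. x $ i *\<^sub>R axis i 1)" by simp
  also have "\<dots> = (\<Sum>i\<in>UNIV. x $ i *\<^sub>R \<phi> (axis i 1 # vs))"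
    by (simp only: linear_sum[OF alt_formD(1)[OF assms]] linear_scale[OF alt_formD(1)[OF assms]])
  finally show ?thesis by (simp add: scaleR_conv_of_real)
qed

text \<open>By multilinearity a moving argument may be expanded in the coordinate basis, which
  leaves smooth coefficients times a family with one argument fixed. This covers the Jacobians that
  appear inside the arguments when charts are changed.\<close>

lemma smooth_family_args:
  assumes S: "open S" and "smooth_family S F" "\<And>m. m \<in> set ms \<Longrightarrow> smooth_on S m"
  shows "smooth_on S (\<lambda>y. F y (map (\<lambda>m. m y) ms))"
  using assms(2,3)
proof (induction ms arbitrary: F)
  case Nil
  then show ?case by (simp add: smooth_family_def)
next
  case (Cons m ms)
  have F: "alt_form (F y)" if "y \<in> S" for y using Cons.prems(1) that by (simp add: smooth_family_def)
  have sl: "smooth_family S (\<lambda>y. slot v (F y))" for v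
    using Cons.prems(1) by (auto simp: smooth_family_def alt_formD(3) slot_apply)
  have "smooth_on S (\<lambda>y. \<Sum>i\<in>UNIV. of_real (m y $ i) * slot (axis i 1) (F y) (map (\<lambda>m. m y) ms))"
    by (intro smooth_on_sum S smooth_on_mult Cons.IH sl smooth_on_bounded_linear[OF bounded_linear_of_real]
      smooth_on_bounded_linear[OF bounded_linear_vec_nth]) (use Cons.prems in auto)
  then show ?case
    using smooth_on_cong[OF S, of "\<lambda>y. F y (map (\<lambda>m. m y) (m # ms))"
       "\<lambda>y. \<Sum>i\<in>UNIV. of_real (m y $ i) * slot (axis i 1) (F y) (map (\<lambda>m. m y) ms)"]
    by (simp add: slot_apply alt_form_expand[OF F, of _ "m _"])
qed

lemma bounded_linear_covec_form: "bounded_linear (\<lambda>z :: (complex, 'n::finite) gtan. covec_form (snd z) vs)"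
proof (cases "\<exists>v. vs = [v]")
  case True
  then obtain v where v: "vs = [v]" by blast
  have "bounded_linear (\<lambda>z :: (complex, 'n) gtan. \<Sum>i\<in>UNIV. snd z $ i * of_real (v $ i))"
    by (intro bounded_linear_sum bounded_linear_compose[OF bounded_linear_mult_left]
      bounded_linear_compose[OF bounded_linear_vec_nth] bounded_linear_snd)
  then show ?thesis by (simp add: v covec_form_def)
next
  case False
  then have "(\<lambda>z :: (complex, 'n) gtan. covec_form (snd z) vs) = (\<lambda>z. 0)"
    by (auto simp: covec_form_def fun_eq_iff split: list.splits)
  then show ?thesis by simp
qed

text \<open>Both the Leibniz rule and the smoothness of Clifford products are read off from this expansion.\<close>

lemma clifford_expand:
  fixes vs :: "(real^'n::finite) list"
  shows "\<exists>(K :: ('n + nat set) set) L w. finite K \<and> (\<forall>k\<in>K. bounded_linear (L k)) \<and>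
    (\<forall>z \<phi>. alt_form \<phi> \<longrightarrow> clifford z \<phi> vs = (\<Sum>k\<in>K. L k z * \<phi> (w k)))"
proof -
  define sg where "sg I = (-1::complex) ^ card {(i, j). i \<in> I \<and> j \<in> {..<length vs} - I \<and> j < i}" for I
  define K :: "('n + nat set) set" where "K = UNIV <+> Pow {..<length vs}"
  define L where "L k z = (case k of Inl i \<Rightarrow> fst z $ i | Inr I \<Rightarrow> sg I * covec_form (snd z) (nths vs I))"
    for k :: "'n + nat set" and z :: "(complex, 'n) gtan"
  define w where "w k = (case k of Inl i \<Rightarrow> axis i 1 # vs | Inr I \<Rightarrow> nths vs (- I))" for k
  have "clifford z \<phi> vs = (\<Sum>k\<in>K. L k z * \<phi> (w k))" if "alt_form \<phi>" for z \<phi>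
  proof -
    have "contract (fst z) \<phi> vs = (\<Sum>i\<in>UNIV. fst z $ i * \<phi> (axis i 1 # vs))"
    proof -
      have ri: "of_real (Re_vec (fst z) $ i) + \<i> * of_real (Im_vec (fst z) $ i) = fst z $ i" for i
        by (simp add: Re_vec_def Im_vec_def complex_eq_iff)
      have "contract (fst z) \<phi> vs = (\<Sum>i\<in>UNIV. of_real (Re_vec (fst z) $ i) * \<phi> (axis i 1 # vs)) +
        \<i> * (\<Sum>i\<in>UNIV. of_real (Im_vec (fst z) $ i) * \<phi> (axis i 1 # vs))"
        unfolding contract_def
        by (simp only: alt_form_expand[OF that, of "Re_vec (fst z)"] alt_form_expand[OF that, of "Im_vec (fst z)"])
      also have "\<dots> = (\<Sum>i\<in>UNIV. (of_real (Re_vec (fst z) $ i) + \<i> * of_real (Im_vec (fst z) $ i)) * \<phi> (axis i 1 # vs))"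
        by (simp add: sum_distrib_left sum.distrib algebra_simps)
      finally show ?thesis by (simp only: ri)
    qed
    moreover have "wed (snd z) \<phi> vs = (\<Sum>I\<in>Pow {..<length vs}. sg I * covec_form (snd z) (nths vs I) * \<phi> (nths vs (- I)))"
      by (simp add: wedge_def sg_def)
    moreover have "(\<Sum>k\<in>K. L k z * \<phi> (w k)) = (\<Sum>i\<in>UNIV. L (Inl i) z * \<phi> (w (Inl i))) + (\<Sum>I\<in>Pow {..<length vs}. L (Inr I) z * \<phi> (w (Inr I)))"
      unfolding K_def by (simp add: sum.Plus o_def)
    ultimately show ?thesis by (simp add: clifford_def L_def w_def)
  qed
  moreover have "bounded_linear (L k)" for k
  proof (cases k)
    case (Inl i)
    have "bounded_linear (\<lambda>z :: (complex, 'n) gtan. fst z $ i)"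
      by (intro bounded_linear_compose[OF bounded_linear_vec_nth] bounded_linear_fst)
    moreover have "L (Inl i) = (\<lambda>z. fst z $ i)" by (simp add: L_def fun_eq_iff)
    ultimately show ?thesis by (simp add: Inl)
  next
    case (Inr I)
    have "bounded_linear (\<lambda>z :: (complex, 'n) gtan. sg I * covec_form (snd z) (nths vs I))"
      by (intro bounded_linear_compose[OF bounded_linear_mult_right] bounded_linear_covec_form)
    moreover have "L (Inr I) = (\<lambda>z. sg I * covec_form (snd z) (nths vs I))" by (simp add: L_def fun_eq_iff)
    ultimately show ?thesis by (simp add: Inr)
  qed
  moreover have "finite K" by (simp add: K_def)
  ultimately show ?thesis by blast
qed

lemma smooth_family_clifford:
  assumes S: "open S" and F: "smooth_family S F" and v: "smooth_on S v"
  shows "smooth_family S (\<lambda>y. clifford (v y) (F y))"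
  unfolding smooth_family_def
proof (intro conjI allI ballI)
  have alt: "alt_form (F y)" if "y \<in> S" for y using F that by (simp add: smooth_family_def)
  then show "alt_form (clifford (v y) (F y))" if "y \<in> S" for y using that by simp
  fix vs :: "(real^'a) list"
  obtain K :: "('a + nat set) set" and L w where K: "finite K" "\<And>k. k \<in> K \<Longrightarrow> bounded_linear (L k)"
    "\<And>z \<phi>. alt_form \<phi> \<Longrightarrow> clifford z \<phi> vs = (\<Sum>k\<in>K. L k z * \<phi> (w k))"
    using clifford_expand[of vs] by blast
  have "smooth_on S (\<lambda>y. \<Sum>k\<in>K. L k (v y) * F y (w k))"
    by (intro smooth_on_sum S smooth_on_mult smooth_on_bounded_linear[OF K(2)] v)
      (use F in \<open>auto simp: smooth_family_def\<close>)
  then show "smooth_on S (\<lambda>y. clifford (v y) (F y) vs)"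
    using smooth_on_cong[OF S, of "\<lambda>y. clifford (v y) (F y) vs" "\<lambda>y. \<Sum>k\<in>K. L k (v y) * F y (w k)"]
    by (simp add: K(3) alt)
qed

section \<open>Smooth sections and forms in changing charts\<close>

context atlas
begin

lemma gtrans_cocycle:
  assumes "c \<in> A" "c' \<in> A" "c'' \<in> A" "p \<in> fst c" "p \<in> fst c'" "p \<in> fst c''"
  shows "gtrans c' c'' p (gtrans c c' p z) = gtrans c c'' p z"
  using jacobian_cocycle[of c c' c'' p] jacobian_cocycle[of c'' c' c p] assms
  by (simp add: gtrans_def matrix_vector_mul_assoc flip: cmat_mult matrix_transpose_mul)

lemma gtrans_self: "c \<in> A \<Longrightarrow> p \<in> fst c \<Longrightarrow> gtrans c c p z = z"
  by (simp add: gtrans_def jacobian_self cmat_1 transpose_mat)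

lemma sec_coord_at: "c \<in> A \<Longrightarrow> p \<in> fst c \<Longrightarrow> sec_coord A c v (snd c p) = gtrans (chart_at A p) c p (v p)"
  by (simp add: sec_coord_eq)

lemma sec_coord_chart_at: "sec_coord A (chart_at A p) v (snd (chart_at A p) p) = v p"
  by (simp add: sec_coord_at chart_at gtrans_self)

lemma sec_coord_trans:
  assumes "c \<in> A" "c' \<in> A" "p \<in> fst c" "p \<in> fst c'"
  shows "sec_coord A c' v (snd c' p) = gtrans c c' p (sec_coord A c v (snd c p))"
  using assms by (simp add: sec_coord_at gtrans_cocycle chart_at)

lemma form_coord_at: "c \<in> A \<Longrightarrow> p \<in> fst c \<Longrightarrow> form_coord A c \<phi> (snd c p) = pullback (jacobian c (chart_at A p) p) (\<phi> p)"
  by (simp add: form_coord_eq)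

lemma form_coord_chart_at: "form_coord A (chart_at A p) \<phi> (snd (chart_at A p) p) = \<phi> p"
  by (simp add: form_coord_at chart_at jacobian_self pullback_1)

lemma form_coord_trans:
  assumes "c \<in> A" "c' \<in> A" "p \<in> fst c" "p \<in> fst c'"
  shows "form_coord A c' \<phi> (snd c' p) = pullback (jacobian c' c p) (form_coord A c \<phi> (snd c p))"
  using assms by (simp add: form_coord_at pullback_pullback jacobian_cocycle chart_at)

lemma form_coord_clifford:
  assumes "c \<in> A" "p \<in> fst c"
  shows "form_coord A c (\<lambda>q. clifford (v q) (\<phi> q)) (snd c p) = clifford (sec_coord A c v (snd c p)) (form_coord A c \<phi> (snd c p))"
  using assms pullback_clifford[OF jacobian_inverse[of "chart_at A p" c p]]
  by (simp add: form_coord_at sec_coord_at gtrans_def chart_at)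

lemma cpair_gtrans:
  assumes "c \<in> A" "c' \<in> A" "p \<in> fst c" "p \<in> fst c'"
  shows "cpair (gtrans c c' p z) (gtrans c c' p w) = cpair z w"
proof -
  have "jacobian c' c p ** jacobian c c' p = mat 1" using jacobian_inverse assms by simp
  from cmat_inner[OF this] show ?thesis by (simp add: cpair_def gtrans_def sum.distrib)
qed

lemma smooth_transfer:
  assumes c: "c \<in> A" "c' \<in> A" and W: "open W" "W \<subseteq> fst c" and f: "smooth_on (snd c ` W) f"
    and e: "\<And>p. p \<in> W \<Longrightarrow> p \<in> fst c' \<Longrightarrow> g (snd c' p) = f (snd c p)"
  shows "smooth_on (snd c' ` (fst c' \<inter> W)) g"
proof -
  let ?S = "snd c' ` (fst c' \<inter> W)"
  have S: "open ?S" by (rule open_chart_image[OF c(2) W(1)])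
  have T: "open (snd c ` W)" using open_chart_image[OF c(1) W(1)] W(2) by (simp add: inf.absorb2)
  have "smooth_on ?S (\<lambda>y. f ((snd c \<circ> chart_inv c') y))"
  proof (rule smooth_on_compose[OF S T _ f])
    show "(snd c \<circ> chart_inv c') ` ?S \<subseteq> snd c ` W" using c by (auto simp: o_def)
    show "smooth_on ?S (snd c \<circ> chart_inv c')"
      by (rule smooth_on_subset[OF transition_smooth[OF c(2,1)]]) (use W in auto)
  qed
  moreover have "g y = f ((snd c \<circ> chart_inv c') y)" if "y \<in> ?S" for y
    using that e c by (auto simp: o_apply)
  ultimately show ?thesis
    using smooth_on_cong[OF S, of g "\<lambda>y. f ((snd c \<circ> chart_inv c') y)"] by blast
qed

lemma jacobian_smooth':
  assumes "c \<in> A" "c' \<in> A" "open W" "W \<subseteq> fst c"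
  shows "smooth_on (snd c' ` (fst c' \<inter> W)) (\<lambda>y. jacobian c c' (chart_inv c' y) $ i $ j)"
proof -
  have "smooth_on (snd c' ` (fst c' \<inter> (fst c' \<inter> W))) (\<lambda>y. jacobian c c' (chart_inv c' y) $ i $ j)"
  proof (rule smooth_transfer[OF assms(1,2)])
    show "open (fst c' \<inter> W)" using assms chartD(1) by blast
    show "smooth_on (snd c ` (fst c' \<inter> W)) (\<lambda>y. jacobian c c' (chart_inv c y) $ i $ j)"
      by (rule smooth_on_subset[OF jacobian_smooth[OF assms(1,2)]]) (use assms in auto)
  qed (use assms in auto)
  then show ?thesis by (simp add: Int_assoc[symmetric])
qed

text \<open>One chart covering \<open>W\<close> suffices: the components in any other chart arise by
  a transition map and Jacobian entries, all of which are smooth.\<close>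

lemma smooth_sectionI:
  fixes v :: "'a \<Rightarrow> ('k::real_normed_field, 'n) gtan"
  assumes c: "c \<in> A" and W: "open W" "W \<subseteq> fst c" and v: "smooth_on (snd c ` W) (sec_coord A c v)"
  shows "smooth_section A W v"
  unfolding smooth_section_def
proof
  fix c' assume c': "c' \<in> A"
  let ?S = "snd c' ` (fst c' \<inter> W)"
  have S: "open ?S" by (rule open_chart_image[OF c' W(1)])
  define u where "u y = sec_coord A c v (snd c (chart_inv c' y))" for y
  have "smooth_on ?S u"
    by (rule smooth_transfer[OF c c' W v]) (use c' in \<open>auto simp: u_def\<close>)
  then have u: "smooth_on ?S (\<lambda>y. fst (u y))" "smooth_on ?S (\<lambda>y. snd (u y))"
    using smooth_on_pair[OF S] by auto
  have j1: "smooth_on ?S (\<lambda>y. jacobian c c' (chart_inv c' y) $ i $ j)" for i j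
    by (rule jacobian_smooth'[OF c c' W])
  have j2: "smooth_on ?S (\<lambda>y. jacobian c' c (chart_inv c' y) $ i $ j)" for i j
    by (rule smooth_on_subset[OF jacobian_smooth[OF c' c]]) (use W in auto)
  have "smooth_on ?S (\<lambda>y. gtrans c c' (chart_inv c' y) (u y))"
    unfolding smooth_on_pair[OF S] smooth_on_vec[OF S] gtrans_def fst_conv snd_conv matrix_vector_mult_def
      vec_lambda_beta nth_map_matrix transpose_def
    by (intro conjI allI smooth_on_sum S smooth_on_mult smooth_on_bounded_linear[OF bounded_linear_of_real] j1 j2
      smooth_on_bounded_linear[OF bounded_linear_vec_nth] u)
  moreover have "gtrans c c' (chart_inv c' y) (u y) = sec_coord A c' v y" if y: "y \<in> ?S" for y
  proof -
    obtain p where p: "p \<in> W" "p \<in> fst c'" "y = snd c' p" using y by blast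
    then have "p \<in> fst c" using W(2) by blast
    then show ?thesis using p c c' by (simp add: u_def sec_coord_trans[OF c c'])
  qed
  ultimately show "smooth_on ?S (sec_coord A c' v)"
    using smooth_on_cong[OF S, of "\<lambda>y. gtrans c c' (chart_inv c' y) (u y)" "sec_coord A c' v"] by blast
qed

lemma alt_form_form_coord: "alt_form (\<phi> (chart_inv c y)) \<Longrightarrow> alt_form (form_coord A c \<phi> y)"
  by (simp add: form_coord_eq alt_form_pullback)

lemma smooth_formI:
  assumes c: "c \<in> A" and W: "open W" "W \<subseteq> fst c" and alt: "\<And>p. p \<in> W \<Longrightarrow> alt_form (\<phi> p)"
    and v: "\<And>vs. smooth_on (snd c ` W) (\<lambda>y. form_coord A c \<phi> y vs)"
  shows "smooth_form A W \<phi>"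
  unfolding smooth_form_def
proof (intro conjI ballI allI alt)
  fix c' vs assume c': "c' \<in> A"
  let ?S = "snd c' ` (fst c' \<inter> W)"
  have S: "open ?S" by (rule open_chart_image[OF c' W(1)])
  define F where "F y = form_coord A c \<phi> (snd c (chart_inv c' y))" for y
  have F: "smooth_family ?S F"
    unfolding smooth_family_def
  proof (intro conjI ballI allI)
    show "alt_form (F y)" if "y \<in> ?S" for y
      unfolding F_def by (rule alt_form_form_coord) (use that alt W c c' in auto)
    show "smooth_on ?S (\<lambda>y. F y vs)" for vs
      by (rule smooth_transfer[OF c c' W v]) (use c' in \<open>auto simp: F_def\<close>)
  qed
  have j2: "smooth_on ?S (\<lambda>y. jacobian c' c (chart_inv c' y) $ i $ j)" for i j
    by (rule smooth_on_subset[OF jacobian_smooth[OF c' c]]) (use W in auto)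
  have "smooth_on ?S (\<lambda>y. F y (map (\<lambda>m. m y) (map (\<lambda>x y. jacobian c' c (chart_inv c' y) *v x) vs)))"
  proof (rule smooth_family_args[OF S F])
    fix m assume "m \<in> set (map (\<lambda>x y. jacobian c' c (chart_inv c' y) *v x) vs)"
    then obtain x where m: "m = (\<lambda>y. jacobian c' c (chart_inv c' y) *v x)" by auto
    show "smooth_on ?S m"
      unfolding m smooth_on_vec[OF S] matrix_vector_mult_def vec_lambda_beta
      by (intro allI smooth_on_sum S smooth_on_mult j2 smooth_on_const)
  qed
  moreover have "F y (map (\<lambda>m. m y) (map (\<lambda>x y. jacobian c' c (chart_inv c' y) *v x) vs)) = form_coord A c' \<phi> y vs"
    if y: "y \<in> ?S" for y
  proof -
    obtain p where p: "p \<in> W" "p \<in> fst c'" "y = snd c' p" using y by blast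
    then have "p \<in> fst c" using W(2) by blast
    then show ?thesis using p form_coord_trans[OF c c'] c c' by (simp add: F_def pullback_def o_def)
  qed
  ultimately show "smooth_on ?S (\<lambda>y. form_coord A c' \<phi> y vs)"
    using smooth_on_cong[OF S, of "\<lambda>y. F y (map (\<lambda>m. m y) (map (\<lambda>x y. jacobian c' c (chart_inv c' y) *v x) vs))"
      "\<lambda>y. form_coord A c' \<phi> y vs"] by blast
qed

lemma smooth_section_restrict: "smooth_section A W v \<Longrightarrow> W' \<subseteq> W \<Longrightarrow> smooth_section A W' v"
  unfolding smooth_section_def by (meson image_mono Int_mono order_refl smooth_on_subset)

lemma smooth_form_restrict: "smooth_form A W \<phi> \<Longrightarrow> W' \<subseteq> W \<Longrightarrow> smooth_form A W' \<phi>"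
  unfolding smooth_form_def by (meson image_mono Int_mono order_refl smooth_on_subset subsetD)

lemma smooth_form_clifford:
  assumes W: "open W" and v: "smooth_section A W v" and phi: "smooth_form A W \<phi>"
  shows "smooth_form A W (\<lambda>q. clifford (v q) (\<phi> q))"
proof -
  have "smooth_on (snd c ` (fst c \<inter> W)) (\<lambda>y. form_coord A c (\<lambda>q. clifford (v q) (\<phi> q)) y vs)" if c: "c \<in> A" for c vs
  proof -
    let ?S = "snd c ` (fst c \<inter> W)"
    have S: "open ?S" by (rule open_chart_image[OF c W])
    have F: "smooth_family ?S (form_coord A c \<phi>)"
      unfolding smooth_family_def
      using phi c by (auto simp: smooth_form_def intro!: alt_form_form_coord)
    have "smooth_family ?S (\<lambda>y. clifford (sec_coord A c v y) (form_coord A c \<phi> y))"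
      by (rule smooth_family_clifford[OF S F]) (use v c in \<open>simp add: smooth_section_def\<close>)
    then have "smooth_on ?S (\<lambda>y. clifford (sec_coord A c v y) (form_coord A c \<phi> y) vs)"
      by (simp add: smooth_family_def)
    moreover have "clifford (sec_coord A c v y) (form_coord A c \<phi> y) vs = form_coord A c (\<lambda>q. clifford (v q) (\<phi> q)) y vs"
      if "y \<in> ?S" for y
      using that form_coord_clifford[OF c] by auto
    ultimately show ?thesis
      using smooth_on_cong[OF S, of "\<lambda>y. clifford (sec_coord A c v y) (form_coord A c \<phi> y) vs"
        "\<lambda>y. form_coord A c (\<lambda>q. clifford (v q) (\<phi> q)) y vs"] by blast
  qed
  then show ?thesis using phi by (auto simp: smooth_form_def)
qed

lemma smooth_form_add:
  assumes W: "open W" and "smooth_form A W \<phi>" "smooth_form A W \<psi>"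
  shows "smooth_form A W (\<lambda>q. \<phi> q + \<psi> q)"
proof -
  have "form_coord A c (\<lambda>q. \<phi> q + \<psi> q) y vs = form_coord A c \<phi> y vs + form_coord A c \<psi> y vs" for c y vs
    by (simp add: form_coord_eq pullback_linear form_pt)
  then show ?thesis
    using assms by (simp add: smooth_form_def alt_form_linear smooth_on_add open_chart_image)
qed

lemma smooth_form_scale:
  assumes W: "open W" and "smooth_form A W \<phi>"
  shows "smooth_form A W (\<lambda>q. a *\<^sub>f \<phi> q)"
proof -
  have "form_coord A c (\<lambda>q. a *\<^sub>f \<phi> q) y vs = a * form_coord A c \<phi> y vs" for c y vs
    by (simp add: form_coord_eq pullback_linear form_pt)
  then show ?thesis
    using assms by (simp add: smooth_form_def alt_form_linear(3)[OF _ alt_form_0] smooth_on_mult smooth_on_const open_chart_image)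
qed

lemma smooth_form_zero: "open W \<Longrightarrow> smooth_form A W (\<lambda>q. 0)"
proof -
  assume "open W"
  moreover have "form_coord A c (\<lambda>q. 0) y vs = 0" for c y vs
    by (simp add: form_coord_eq pullback_linear form_pt)
  ultimately show ?thesis
    by (simp add: smooth_form_def smooth_on_const open_chart_image)
qed

lemma smooth_form_sum:
  "open W \<Longrightarrow> (\<And>i. i \<in> I \<Longrightarrow> smooth_form A W (f i)) \<Longrightarrow> smooth_form A W (\<lambda>q. \<Sum>i\<in>I. f i q)"
  by (induction I rule: infinite_finite_induct) (auto intro: smooth_form_zero smooth_form_add)

lemma smooth_form_cong:
  assumes "open W" "\<And>q. q \<in> W \<Longrightarrow> \<phi> q = \<psi> q" "smooth_form A W \<phi>"
  shows "smooth_form A W \<psi>"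
  unfolding smooth_form_def
proof (intro conjI ballI allI)
  show "alt_form (\<psi> p)" if "p \<in> W" for p using assms that by (metis smooth_form_def)
  fix c vs assume c: "c \<in> A"
  have "form_coord A c \<phi> y vs = form_coord A c \<psi> y vs" if "y \<in> snd c ` (fst c \<inter> W)" for y
    using that c assms(2) by (auto simp: form_coord_eq)
  then show "smooth_on (snd c ` (fst c \<inter> W)) (\<lambda>y. form_coord A c \<psi> y vs)"
    using smooth_on_cong[OF open_chart_image[OF c assms(1)], of "\<lambda>y. form_coord A c \<phi> y vs" "\<lambda>y. form_coord A c \<psi> y vs"]
      assms(3) c by (auto simp: smooth_form_def)
qed

lemma gtrans_add: "gtrans c c' p (z + w) = gtrans c c' p z + gtrans c c' p w"
  by (simp add: gtrans_def matrix_vector_right_distrib)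

lemma sec_coord_add: "sec_coord A c (\<lambda>q. v q + w q) y = sec_coord A c v y + sec_coord A c w y"
  by (simp add: sec_coord_eq gtrans_add)

lemma smooth_section_add:
  assumes "open W" "smooth_section A W v" "smooth_section A W w"
  shows "smooth_section A W (\<lambda>q. v q + w q)"
proof -
  have "sec_coord A c (\<lambda>q. v q + w q) = (\<lambda>y. sec_coord A c v y + sec_coord A c w y)" for c
    by (rule ext) (rule sec_coord_add)
  then show ?thesis using assms by (simp add: smooth_section_def smooth_on_add open_chart_image)
qed

lemma bounded_linear_cscale: "bounded_linear (cscale_gt a :: (complex, 'm::finite) gtan \<Rightarrow> _)"
proof (rule linear_conv_bounded_linear[THEN iffD1], rule linearI)
  show "cscale_gt a (r *\<^sub>R z) = r *\<^sub>R cscale_gt a z" for r and z :: "(complex, 'm) gtan"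
    by (simp add: cscale_gt_def prod_eq_iff vec_eq_iff)
qed (simp add: cscale_gt_simps)

lemma smooth_section_cscale:
  assumes "open W" "smooth_section A W v"
  shows "smooth_section A W (\<lambda>q. cscale_gt a (v q))"
proof -
  have "sec_coord A c (\<lambda>q. cscale_gt a (v q)) = (\<lambda>y. cscale_gt a (sec_coord A c v y))" for c
    by (simp add: sec_coord_eq clinD[OF gtrans_clin] fun_eq_iff)
  then show ?thesis using assms
    by (auto simp: smooth_section_def intro!: smooth_on_bounded_linear[OF bounded_linear_cscale] open_chart_image)
qed

lemma gtrans_Re_Im:
  "Re_gt (gtrans c c' p z) = gtrans c c' p (Re_gt z)" "Im_gt (gtrans c c' p z) = gtrans c c' p (Im_gt z)"
  "gtrans c c' p (of_real_gt u) = of_real_gt (gtrans c c' p u)"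
proof -
  show 1: "Re_gt (gtrans c c' p z) = gtrans c c' p (Re_gt z)" "Im_gt (gtrans c c' p z) = gtrans c c' p (Im_gt z)" for z
    by (simp_all add: Re_gt_def Im_gt_def gtrans_def Re_vec_cmat map_matrix_id del: transpose_matrix_vector)
  show "gtrans c c' p (of_real_gt u) = of_real_gt (gtrans c c' p u)"
    by (simp add: gt_eq_iff 1 Re_gt_simps Im_gt_simps) (simp add: gtrans_def zero_prod_def)
qed

lemma bounded_linear_Re_gt:
  "bounded_linear (Re_gt :: (complex, 'm::finite) gtan \<Rightarrow> _)" "bounded_linear (Im_gt :: (complex, 'm::finite) gtan \<Rightarrow> _)"
  "bounded_linear (of_real_gt :: (real, 'm::finite) gtan \<Rightarrow> _)"
  by (intro linear_conv_bounded_linear[THEN iffD1] linearI;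
    simp add: Re_gt_def Im_gt_def of_real_gt_def Re_vec_def Im_vec_def prod_eq_iff vec_eq_iff scaleR_conv_of_real[where 'a = complex])+

lemma smooth_section_complexify:
  assumes W: "open W" and v: "smooth_section A W v" and T: "smooth_endo_on A (\<lambda>_. UNIV) T"
  shows "smooth_section A W (\<lambda>q. complexify (T q) (v q))"
proof -
  have TD: "smooth_section A W (\<lambda>q. T q (u q))" if "smooth_section A W u" for u
    using T W that unfolding smooth_endo_on_def by blast
  have re: "smooth_section A W (\<lambda>q. Re_gt (v q))" "smooth_section A W (\<lambda>q. Im_gt (v q))"
  proof -
    have "sec_coord A c (\<lambda>q. Re_gt (v q)) = (\<lambda>y. Re_gt (sec_coord A c v y))"
      "sec_coord A c (\<lambda>q. Im_gt (v q)) = (\<lambda>y. Im_gt (sec_coord A c v y))" for c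
      by (simp_all add: sec_coord_eq gtrans_Re_Im fun_eq_iff)
    then show "smooth_section A W (\<lambda>q. Re_gt (v q))" "smooth_section A W (\<lambda>q. Im_gt (v q))"
      using v W by (auto simp: smooth_section_def intro!: smooth_on_bounded_linear[OF bounded_linear_Re_gt(1)]
        smooth_on_bounded_linear[OF bounded_linear_Re_gt(2)] open_chart_image)
  qed
  have or: "smooth_section A W (\<lambda>q. of_real_gt (u q))" if "smooth_section A W u" for u
  proof -
    have "sec_coord A c (\<lambda>q. of_real_gt (u q)) = (\<lambda>y. of_real_gt (sec_coord A c u y))" for c
      by (simp_all add: sec_coord_eq gtrans_Re_Im fun_eq_iff)
    then show ?thesis
      using that W by (auto simp: smooth_section_def intro!: smooth_on_bounded_linear[OF bounded_linear_Re_gt(3)] open_chart_image)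
  qed
  show ?thesis
    unfolding complexify_def
    by (intro smooth_section_add smooth_section_cscale or TD re W)
qed

text \<open>The section with constant components \<open>z\<close> in the fixed chart
  \<open>c\<close>, rewritten at each point in the chart chosen there. Such sections are the raw
  material for all local extensions.\<close>

definition const_section :: "('a, 'n) chart \<Rightarrow> (complex, 'n) gtan \<Rightarrow> 'a \<Rightarrow> (complex, 'n) gtan" where
  "const_section c z q = gtrans c (chart_at A q) q z"

lemma smooth_const_section:
  assumes c: "c \<in> A" and W: "open W" "W \<subseteq> fst c"
  shows "smooth_section A W (const_section c z)"
proof (rule smooth_sectionI[OF c W])
  have S: "open (snd c ` W)" using open_chart_image[OF c W(1)] W(2) by (simp add: inf.absorb2)
  have "sec_coord A c (const_section c z) y = z" if "y \<in> snd c ` W" for y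
    using that c W by (auto simp: sec_coord_at const_section_def gtrans_cocycle chart_at gtrans_self subset_iff)
  then show "smooth_on (snd c ` W) (sec_coord A c (const_section c z))"
    using smooth_on_cong[OF S, of "sec_coord A c (const_section c z)" "\<lambda>_. z"] smooth_on_const[OF S] by blast
qed

text \<open>Coordinate changes preserve \<open>cpair\<close>, so the coordinate frame of a fixed
  chart and its coframe remain dual when expressed in the charts chosen pointwise.\<close>

lemma const_section_frames:
  assumes "c \<in> A" "p \<in> fst c"
  shows "dual_frames (\<lambda>k. const_section c (gt_basis k) p) (\<lambda>k. const_section c (gt_cobasis k) p)"
proof -
  let ?g = "gtrans c (chart_at A p) p :: (complex, 'n) gtan \<Rightarrow> _" and ?h = "gtrans (chart_at A p) c p :: (complex, 'n) gtan \<Rightarrow> _"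
  have gh: "?g (?h z) = z" "?h (?g z) = z" for z
    using assms by (simp_all add: gtrans_cocycle chart_at gtrans_self)
  have cp: "cpair (?g x) z = cpair x (?h z)" for x z
    using cpair_gtrans[of c "chart_at A p" p x "?h z"] assms gh by (simp add: chart_at)
  have "(\<Sum>k\<in>UNIV. cscale_gt (cpair (?g (gt_cobasis k)) z) (?g (gt_basis k))) = ?g (\<Sum>k\<in>UNIV. cscale_gt (cpair (gt_cobasis k) (?h z)) (gt_basis k))"
    "(\<Sum>k\<in>UNIV. cscale_gt (cpair (?g (gt_basis k)) z) (?g (gt_cobasis k))) = ?g (\<Sum>k\<in>UNIV. cscale_gt (cpair (gt_basis k) (?h z)) (gt_cobasis k))" for z
    by (simp_all add: clinD[OF gtrans_clin] cp)
  then show ?thesis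
    unfolding dual_frames_def const_section_def
    by (simp only: dual_framesD[OF dual_frames_gt_basis] gh) simp
qed

definition const_form :: "('a, 'n) chart \<Rightarrow> 'n mform \<Rightarrow> 'a \<Rightarrow> 'n mform" where
  "const_form c \<phi> q = pullback (jacobian (chart_at A q) c q) \<phi>"

lemma smooth_const_form:
  assumes c: "c \<in> A" and W: "open W" "W \<subseteq> fst c" and alt: "alt_form \<phi>"
  shows "smooth_form A W (const_form c \<phi>)"
proof (rule smooth_formI[OF c W])
  show "alt_form (const_form c \<phi> p)" for p by (simp add: const_form_def alt_form_pullback alt)
  have S: "open (snd c ` W)" using open_chart_image[OF c W(1)] W(2) by (simp add: inf.absorb2)
  fix vs
  have "form_coord A c (const_form c \<phi>) y vs = \<phi> vs" if "y \<in> snd c ` W" for y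
    using that c W by (auto simp: form_coord_at const_form_def pullback_pullback jacobian_inverse chart_at pullback_1 subset_iff)
  then show "smooth_on (snd c ` W) (\<lambda>y. form_coord A c (const_form c \<phi>) y vs)"
    using smooth_on_cong[OF S, of "\<lambda>y. form_coord A c (const_form c \<phi>) y vs" "\<lambda>_. \<phi> vs"] smooth_on_const[OF S] by blast
qed

end

section \<open>The derived bracket\<close>

definition flat_d :: "(real^'n \<Rightarrow> 'n::finite mform) \<Rightarrow> real^'n \<Rightarrow> 'n mform" where
  "flat_d F y vs = (\<Sum>i<length vs. (-1) ^ i *
     frechet_derivative (\<lambda>y. F y (take i vs @ drop (Suc i) vs)) (at y) (vs ! i))"

lemma ext_d_flat: "ext_d A \<phi> p = flat_d (form_coord A (chart_at A p) \<phi>) (snd (chart_at A p) p)"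
  by (simp add: fun_eq_iff ext_d_def flat_d_def Let_def)

definition form_deriv :: "(real^'n \<Rightarrow> 'n::finite mform) \<Rightarrow> real^'n \<Rightarrow> real^'n \<Rightarrow> 'n mform" where
  "form_deriv F y u vs = frechet_derivative (\<lambda>y. F y vs) (at y) u"

text \<open>The coordinate differential dx^i as an element of the fibre.\<close>

definition coframe :: "'n \<Rightarrow> (complex, 'n::finite) gtan" where
  "coframe i = (0, axis i 1)"

lemma cpair_coframe: "cpair (coframe i) z = fst z $ i"
  using cpair_gt_basis(2)[of i z] by (simp add: coframe_def gt_basis_def)

lemma wed_explicit:
  "wed \<xi> \<phi> vs = (\<Sum>j<length vs. (-1) ^ j * covec_app \<xi> (vs ! j) * \<phi> (take j vs @ drop (Suc j) vs))"
proof (induction vs arbitrary: \<phi>)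
  case Nil
  show ?case by simp
next
  case (Cons v vs)
  have "wed \<xi> \<phi> (v # vs) = covec_app \<xi> v * \<phi> vs - wed \<xi> (slot v \<phi>) vs"
    using fun_cong[OF slot_wed[of v \<xi> \<phi>], of vs] by (simp add: slot_apply form_pt)
  also have "\<dots> = covec_app \<xi> v * \<phi> vs + (\<Sum>j<length vs. (-1) ^ Suc j * covec_app \<xi> (vs ! j) * \<phi> (v # take j vs @ drop (Suc j) vs))"
    by (simp add: Cons slot_apply sum_negf)
  finally show ?case by (simp add: sum.lessThan_Suc_shift del: sum.lessThan_Suc)
qed


lemma contract_0: "alt_form \<phi> \<Longrightarrow> contract 0 \<phi> = 0"
  using contract_linear_left(2)[of \<phi> 0 0] by (simp add: cscale_form_simps)

lemma clifford_coframe: "alt_form \<phi> \<Longrightarrow> clifford (coframe i) \<phi> = wed (axis i 1) \<phi>"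
  by (simp add: clifford_eq coframe_def contract_0)

lemma covec_app_axis: "covec_app (axis i 1) x = of_real (x $ i)"
proof -
  have "axis i 1 $ j * of_real (x $ j) = (if j = i then of_real (x $ i) else (0::complex))" for j
    by (auto simp: axis_def)
  then show ?thesis by (simp add: covec_app_def)
qed

text \<open>Differentiability is required at the single point where d is evaluated, but alternation
  on a whole neighbourhood, so that it passes to the derivative.\<close>

locale diff_family =
  fixes S :: "(real^'n::finite) set" and y :: "real^'n" and F :: "real^'n \<Rightarrow> 'n mform"
  assumes S: "open S" "y \<in> S" and alt: "\<And>x. x \<in> S \<Longrightarrow> alt_form (F x)"
    and diff: "\<And>vs. (\<lambda>x. F x vs) differentiable at y"
begin

lemma F_deriv: "((\<lambda>x. F x vs) has_derivative (\<lambda>u. form_deriv F y u vs)) (at y)"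
  using diff[of vs] by (simp add: frechet_derivative_works form_deriv_def[abs_def])

lemma form_deriv_linear: "linear (\<lambda>u. form_deriv F y u vs)"
  using F_deriv by (rule has_derivative_linear)

text \<open>Each identity expressing multilinearity or alternation holds near \<open>y\<close>;
  uniqueness of derivatives carries it over to the derivative.\<close>

lemma alt_form_deriv: "alt_form (form_deriv F y u)"
  unfolding alt_form_def
proof (intro conjI allI)
  have altF: "linear (\<lambda>v. F x (us @ v # vs))" "F x (us @ v # vs @ v # ws) = 0" if "x \<in> S" for x us vs ws v
    using alt[OF that] unfolding alt_form_def by blast+
  fix us vs
  show "linear (\<lambda>v. form_deriv F y u (us @ v # vs))"
  proof (rule linearI)
    fix a b :: "real^'n" and r :: real
    have "((\<lambda>x. F x (us @ (a + b) # vs)) has_derivative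
       (\<lambda>u. form_deriv F y u (us @ a # vs) + form_deriv F y u (us @ b # vs))) (at y)"
      by (rule has_derivative_transform_within_open[OF has_derivative_add[OF F_deriv[of "us @ a # vs"] F_deriv[of "us @ b # vs"]] S])
        (simp add: linear_add[OF altF(1)])
    from has_derivative_unique[OF this F_deriv]
    show "form_deriv F y u (us @ (a + b) # vs) = form_deriv F y u (us @ a # vs) + form_deriv F y u (us @ b # vs)"
      by metis
    have "((\<lambda>x. F x (us @ (r *\<^sub>R a) # vs)) has_derivative (\<lambda>u. r *\<^sub>R form_deriv F y u (us @ a # vs))) (at y)"
      by (rule has_derivative_transform_within_open[OF has_derivative_scaleR_right[OF F_deriv[of "us @ a # vs"]] S])
        (simp add: linear_scale[OF altF(1)])
    from has_derivative_unique[OF this F_deriv]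
    show "form_deriv F y u (us @ (r *\<^sub>R a) # vs) = r *\<^sub>R form_deriv F y u (us @ a # vs)"
      by metis
  qed
  fix ws v
  have "((\<lambda>x. F x (us @ v # vs @ v # ws)) has_derivative (\<lambda>u. 0)) (at y)"
    by (rule has_derivative_transform_within_open[OF has_derivative_const S]) (simp add: altF(2))
  from has_derivative_unique[OF this F_deriv]
  show "form_deriv F y u (us @ v # vs @ v # ws) = 0" by metis
qed

lemma clifford_deriv:
  assumes v: "v differentiable at y"
  shows "((\<lambda>x. clifford (v x) (F x) vs) has_derivative
    (\<lambda>u. (clifford (frechet_derivative v (at y) u) (F y) + clifford (v y) (form_deriv F y u)) vs)) (at y)"
proof -
  obtain K :: "('n + nat set) set" and L w where K: "finite K" "\<And>k. k \<in> K \<Longrightarrow> bounded_linear (L k)"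
    "\<And>z \<phi>. alt_form \<phi> \<Longrightarrow> clifford z \<phi> vs = (\<Sum>k\<in>K. L k z * \<phi> (w k))"
    using clifford_expand[of vs] by blast
  have dv: "(v has_derivative frechet_derivative v (at y)) (at y)" using v by (simp add: frechet_derivative_works)
  have "((\<lambda>x. \<Sum>k\<in>K. L k (v x) * F x (w k)) has_derivative
    (\<lambda>u. \<Sum>k\<in>K. L k (v y) * form_deriv F y u (w k) + L k (frechet_derivative v (at y) u) * F y (w k))) (at y)"
    by (intro has_derivative_sum has_derivative_mult F_deriv bounded_linear.has_derivative[OF K(2) dv])
  then have "((\<lambda>x. clifford (v x) (F x) vs) has_derivative
    (\<lambda>u. \<Sum>k\<in>K. L k (v y) * form_deriv F y u (w k) + L k (frechet_derivative v (at y) u) * F y (w k))) (at y)"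
    by (rule has_derivative_transform_within_open[OF _ S]) (simp add: K(3) alt)
  moreover have "(\<lambda>u. \<Sum>k\<in>K. L k (v y) * form_deriv F y u (w k) + L k (frechet_derivative v (at y) u) * F y (w k)) =
    (\<lambda>u. (clifford (frechet_derivative v (at y) u) (F y) + clifford (v y) (form_deriv F y u)) vs)"
    by (simp add: fun_eq_iff K(3) alt S alt_form_deriv form_pt sum.distrib add.commute)
  ultimately show ?thesis by simp
qed

lemma diff_family_clifford:
  assumes "v differentiable at y"
  shows "diff_family S y (\<lambda>x. clifford (v x) (F x))"
proof (rule diff_family.intro)
  show "open S" by (rule S(1))
  show "y \<in> S" by (rule S(2))
  show "alt_form (clifford (v x) (F x))" if "x \<in> S" for x
    using alt[OF that] by (rule alt_form_clifford)
  show "(\<lambda>x. clifford (v x) (F x) vs) differentiable at y" for vs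
    unfolding differentiable_def by (rule exI, rule clifford_deriv[OF assms])
qed

lemma form_deriv_clifford:
  assumes "v differentiable at y"
  shows "form_deriv (\<lambda>x. clifford (v x) (F x)) y u = clifford (frechet_derivative v (at y) u) (F y) + clifford (v y) (form_deriv F y u)"
proof
  fix vs
  show "form_deriv (\<lambda>x. clifford (v x) (F x)) y u vs = (clifford (frechet_derivative v (at y) u) (F y) + clifford (v y) (form_deriv F y u)) vs"
    unfolding form_deriv_def[of "\<lambda>x. clifford (v x) (F x)"]
    by (rule fun_cong[OF frechet_derivative_at[OF clifford_deriv[OF assms]], symmetric])
qed

text \<open>d is the sum of dx^i \<wedge> \<partial>_i. In this form its commutators with Clifford
  multiplications reduce to the Clifford relation and the Leibniz rule.\<close>

lemma flat_d_clifford: "flat_d F y = (\<Sum>i\<in>UNIV. clifford (coframe i) (form_deriv F y (axis i 1)))"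
proof
  fix vs
  have "(\<Sum>i\<in>UNIV. clifford (coframe i) (form_deriv F y (axis i 1))) vs =
    (\<Sum>i\<in>UNIV. \<Sum>j<length vs. (-1) ^ j * (of_real (vs ! j $ i) * form_deriv F y (axis i 1) (take j vs @ drop (Suc j) vs)))"
    by (simp add: sum_fun_apply clifford_coframe alt_form_deriv wed_explicit covec_app_axis mult.assoc)
  also have "\<dots> = (\<Sum>j<length vs. (-1) ^ j * (\<Sum>i\<in>UNIV. of_real (vs ! j $ i) * form_deriv F y (axis i 1) (take j vs @ drop (Suc j) vs)))"
    by (subst sum.swap) (simp add: sum_distrib_left)
  also have "\<dots> = flat_d F y vs"
  proof -
    have "(\<Sum>i\<in>UNIV. of_real (x $ i) * form_deriv F y (axis i 1) ws) = form_deriv F y x ws" for x ws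
    proof -
      have "form_deriv F y (\<Sum>i\<in>UNIV. x $ i *\<^sub>R axis i 1) ws = (\<Sum>i\<in>UNIV. x $ i *\<^sub>R form_deriv F y (axis i 1) ws)"
        by (simp only: linear_sum[OF form_deriv_linear] linear_scale[OF form_deriv_linear])
      moreover have "(\<Sum>i\<in>UNIV. x $ i *\<^sub>R axis i 1) = x" by (simp add: vec_eq_iff sum_axis)
      ultimately show ?thesis by (simp add: scaleR_conv_of_real)
    qed
    then show ?thesis by (simp add: flat_d_def form_deriv_def)
  qed
  finally show "flat_d F y vs = (\<Sum>i\<in>UNIV. clifford (coframe i) (form_deriv F y (axis i 1))) vs" by simp
qed

theorem flat_derived_bracket:
  assumes v: "v differentiable at y" and w: "w differentiable at y"
  shows "flat_d (\<lambda>x. clifford (v x) (clifford (w x) (F x))) y + clifford (v y) (flat_d (\<lambda>x. clifford (w x) (F x)) y)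
    - clifford (w y) (flat_d (\<lambda>x. clifford (v x) (F x)) y) - clifford (w y) (clifford (v y) (flat_d F y)) =
    clifford (\<Sum>i\<in>UNIV. cscale_gt (fst (v y) $ i) (frechet_derivative w (at y) (axis i 1))
       - cscale_gt (fst (w y) $ i) (frechet_derivative v (at y) (axis i 1))
       + cscale_gt (cpair (frechet_derivative v (at y) (axis i 1)) (w y)) (coframe i)) (F y)"
proof -
  interpret w: diff_family S y "\<lambda>x. clifford (w x) (F x)" by (rule diff_family_clifford[OF w])
  interpret v: diff_family S y "\<lambda>x. clifford (v x) (F x)" by (rule diff_family_clifford[OF v])
  interpret vw: diff_family S y "\<lambda>x. clifford (v x) (clifford (w x) (F x))" by (rule w.diff_family_clifford[OF v])
  have aF: "alt_form (F y)" using alt S by blast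
  \<comment> \<open>One coordinate direction, with \<open>e\<close> the differential dx^i and primes
    for \<partial>_i. The terms containing \<Phi>' cancel because the anticommutator of
    \<open>e\<close> and \<open>V\<close> is a scalar; the derivatives of \<open>V\<close> and
    \<open>W\<close> leave a single Clifford multiplication.\<close>
  have per: "clifford e (clifford V' (clifford W \<Phi>) + clifford V (clifford W' \<Phi> + clifford W \<Phi>'))
      + clifford V (clifford e (clifford W' \<Phi> + clifford W \<Phi>'))
      - clifford W (clifford e (clifford V' \<Phi> + clifford V \<Phi>')) - clifford W (clifford V (clifford e \<Phi>'))
      = clifford (cscale_gt (cpair e V) W' - cscale_gt (cpair e W) V' + cscale_gt (cpair V' W) e) \<Phi>"
    if a: "alt_form \<Phi>" "alt_form \<Phi>'" for e V V' W W' and \<Phi> \<Phi>' :: "'n mform"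
  proof -
    have 1: "clifford e (clifford V (clifford W' \<Phi>)) = cpair e V *\<^sub>f clifford W' \<Phi> - clifford V (clifford e (clifford W' \<Phi>))"
      "clifford e (clifford V (clifford W \<Phi>')) = cpair e V *\<^sub>f clifford W \<Phi>' - clifford V (clifford e (clifford W \<Phi>'))"
      by (rule clifford_swap, intro alt_form_clifford a)+
    have 2: "clifford e (clifford V \<Phi>') = cpair e V *\<^sub>f \<Phi>' - clifford V (clifford e \<Phi>')"
      by (rule clifford_swap[OF a(2)])
    have 3: "clifford V' (clifford W \<Phi>) = cpair V' W *\<^sub>f \<Phi> - clifford W (clifford V' \<Phi>)"
      by (rule clifford_swap[OF a(1)])
    have 4: "clifford e (clifford W (clifford V' \<Phi>)) = cpair e W *\<^sub>f clifford V' \<Phi> - clifford W (clifford e (clifford V' \<Phi>))"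
      by (rule clifford_swap) (intro alt_form_clifford a)
    show ?thesis
      by (simp add: clifford_linear 1 2 3 4 clifford_linear_left[OF a(1)] cscale_form_simps algebra_simps)
  qed
  show ?thesis
    unfolding flat_d_clifford vw.flat_d_clifford v.flat_d_clifford w.flat_d_clifford
      w.form_deriv_clifford[OF v] form_deriv_clifford[OF v] form_deriv_clifford[OF w]
      clifford_sum sum.distrib[symmetric] sum_subtractf[symmetric]
    by (simp only: per[OF aF alt_form_deriv] cpair_coframe clifford_sum_left[OF aF])
qed

end

lemma covec_form_minus: "covec_form (- \<xi>) = - covec_form \<xi>" "covec_form (\<xi> - \<eta>) = covec_form \<xi> - covec_form \<eta>"
  by (auto simp: covec_form_def fun_eq_iff form_pt algebra_simps sum_subtractf sum_negf split: list.splits)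

text \<open>The same double commutator with H \<wedge> in place of d. As H is odd, its
  anticommutator with \<open>v\<close> is multiplication by i_X H; this two-form is even, and its
  commutator with \<open>w\<close> is multiplication by - i_Y i_X H.\<close>

lemma flat_derived_bracket_H:
  assumes H: "homogeneous 3 H" "alt_form H" and phi: "alt_form \<Phi>"
  shows "wedge H (clifford v (clifford w \<Phi>)) + clifford v (wedge H (clifford w \<Phi>))
    - clifford w (wedge H (clifford v \<Phi>)) - clifford w (clifford v (wedge H \<Phi>)) =
    clifford (0, - form_covec (contract (fst w) (contract (fst v) H))) \<Phi>"
proof -
  have gH: "grade_inv H = - H"
  proof
    fix vs show "grade_inv H vs = (- H) vs"
      using H(1) by (cases "length vs = 3") (simp_all add: grade_inv_def homogeneous_def form_pt)
  qed
  have conB: "contract X (wedge B \<phi>) = wedge (contract X B) \<phi> + wedge (grade_inv B) (contract X \<phi>)" for X B and \<phi> :: "'a mform"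
    by (simp add: contract_eq slot_wedge wedge_linear cscale_form_simps algebra_simps)
  define B where "B = contract (fst v) H"
  have gB: "grade_inv B = B"
  proof
    fix vs show "grade_inv B vs = B vs"
      using H(1) by (cases "length vs = 2") (simp_all add: B_def contract_def grade_inv_def homogeneous_def)
  qed
  have 1: "wedge H (clifford v \<phi>) + clifford v (wedge H \<phi>) = wedge B \<phi>" for \<phi>
    by (simp add: clifford_eq conB gH wedge_linear wedge_wed[of H] B_def algebra_simps)
  have 2: "wedge B (clifford w \<phi>) - clifford w (wedge B \<phi>) = - wedge (contract (fst w) B) \<phi>" for \<phi>
    by (simp add: clifford_eq conB gB wedge_linear wedge_wed[of B] algebra_simps)
  have 3: "contract (fst w) B = covec_form (form_covec (contract (fst w) B))"
  proof
    fix vs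
    let ?\<beta> = "contract (fst w) B"
    have b: "alt_form ?\<beta>"
      unfolding B_def contract_eq by (intro alt_form_linear(1,3) alt_formD(3) H(2)) (auto intro: alt_formD(3) H(2) alt_form_linear)
    show "?\<beta> vs = covec_form (form_covec ?\<beta>) vs"
    proof (cases "\<exists>v. vs = [v]")
      case True
      then obtain x where v: "vs = [x]" by blast
      have "?\<beta> vs = (\<Sum>i\<in>UNIV. of_real (x $ i) * ?\<beta> [axis i 1])"
        unfolding v by (rule alt_form_expand[OF b])
      then show ?thesis by (simp add: v covec_form_def form_covec_def mult.commute)
    next
      case False
      then have "length vs \<noteq> 1" by (cases vs) (auto simp: length_Suc_conv)
      then have "?\<beta> vs = 0" using H(1) by (simp add: B_def contract_def homogeneous_def)
      then show ?thesis using False by (auto simp: covec_form_def split: list.splits)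
    qed
  qed
  have "wedge H (clifford v (clifford w \<Phi>)) + clifford v (wedge H (clifford w \<Phi>))
    - clifford w (wedge H (clifford v \<Phi>)) - clifford w (clifford v (wedge H \<Phi>)) =
    wedge B (clifford w \<Phi>) - clifford w (wedge H (clifford v \<Phi>) + clifford v (wedge H \<Phi>))"
    by (simp add: clifford_linear flip: 1)
  also have "\<dots> = - wed (form_covec (contract (fst w) B)) \<Phi>"
    unfolding 1 2 using 3 by simp
  also have "\<dots> = clifford (0, - form_covec (contract (fst w) B)) \<Phi>"
    by (simp add: clifford_eq contract_0[OF phi] covec_form_minus wedge_linear)
  finally show ?thesis by (simp add: B_def)
qed

section \<open>Coordinate expression of the Courant bracket\<close>

lemma cderiv_sum:
  fixes f :: "real^'n::finite \<Rightarrow> complex^'n"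
  assumes "f differentiable at y"
  shows "cderiv f y Z = (\<Sum>i\<in>UNIV. Z $ i *s frechet_derivative f (at y) (axis i 1))"
proof -
  let ?D = "frechet_derivative f (at y)"
  have l: "linear ?D" using assms by (rule linear_frechet_derivative)
  have e: "?D x = (\<Sum>i\<in>UNIV. of_real (x $ i) *s ?D (axis i 1))" for x
  proof -
    have "?D (\<Sum>i\<in>UNIV. x $ i *\<^sub>R axis i 1) = (\<Sum>i\<in>UNIV. x $ i *\<^sub>R ?D (axis i 1))"
      by (simp only: linear_sum[OF l] linear_scale[OF l])
    moreover have "(\<Sum>i\<in>UNIV. x $ i *\<^sub>R axis i 1) = x" by (simp add: vec_eq_iff sum_axis)
    moreover have "r *\<^sub>R z = of_real r *s z" for r and z :: "complex^'n"
      by (simp add: vec_eq_iff scaleR_conv_of_real[where 'a = complex])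
    ultimately show ?thesis by simp
  qed
  have ri: "of_real (Re_vec Z $ i) + \<i> * of_real (Im_vec Z $ i) = Z $ i" for i
    by (simp add: Re_vec_def Im_vec_def complex_eq_iff)
  have "cderiv f y Z = (\<Sum>i\<in>UNIV. (of_real (Re_vec Z $ i) + \<i> * of_real (Im_vec Z $ i)) *s ?D (axis i 1))"
    unfolding cderiv_def e[of "Re_vec Z"] e[of "Im_vec Z"]
    by (simp add: vec_eq_iff sum_distrib_left sum.distrib algebra_simps)
  then show ?thesis by (simp only: ri)
qed

lemma flat_d_cong:
  assumes "open S" "y \<in> S" "\<And>x. x \<in> S \<Longrightarrow> F x = F' x"
  shows "flat_d F y = flat_d F' y"
proof
  fix vs
  have "frechet_derivative (\<lambda>x. F x ws) (at y) = frechet_derivative (\<lambda>x. F' x ws) (at y)" for ws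
    by (rule differentiable_on_open_cong(2)[OF assms(1,2)]) (simp add: assms(3))
  then show "flat_d F y vs = flat_d F' y vs" by (simp add: flat_d_def)
qed

definition cdot :: "complex^'n \<Rightarrow> complex^'n::finite \<Rightarrow> complex" where
  "cdot \<xi> X = (\<Sum>i\<in>UNIV. \<xi> $ i * X $ i)"

lemma wed_one_form0: "wed \<xi> one_form0 = covec_form \<xi>"
  by (rule form_eqI) (auto simp: slot_wed slot_covec_form wedge_linear)

lemma contract_covec_form: "contract X (covec_form \<xi>) = cdot \<xi> X *\<^sub>f one_form0"
  using contract_wed[of X \<xi> one_form0]
  by (simp add: wed_one_form0 cdot_def contract_eq wedge_linear cscale_form_simps)

lemma form_covec_covec_form: "form_covec (covec_form \<xi>) = \<xi>"
proof -
  have "\<xi> $ j * of_real (axis i 1 $ j) = (if j = i then \<xi> $ i else 0)" for i j by (auto simp: axis_def)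
  then show ?thesis by (simp add: form_covec_def covec_form_def vec_eq_iff)
qed

lemma form_covec_diff: "form_covec (\<alpha> - \<beta>) = form_covec \<alpha> - form_covec \<beta>"
  by (simp add: form_covec_def vec_eq_iff form_pt)

lemma covec_form_sum: "covec_form (\<Sum>i\<in>I. f i) = (\<Sum>i\<in>I. covec_form (f i))"
proof (induction I rule: infinite_finite_induct)
  case (insert x F)
  then show ?case by (simp add: covec_form_linear)
qed (simp_all add: covec_form_linear(2)[of 0 0, simplified cscale_form_simps, simplified])

context
  fixes S :: "(real^'n::finite) set" and y :: "real^'n" and w :: "real^'n \<Rightarrow> (complex, 'n) gtan"
  assumes S: "open S" "y \<in> S" and w: "w differentiable at y"
begin

lemma w_deriv: "(w has_derivative frechet_derivative w (at y)) (at y)"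
  using w by (simp add: frechet_derivative_works)

lemma covec_form_deriv:
  "((\<lambda>x. covec_form (snd (w x)) vs) has_derivative (\<lambda>u. covec_form (snd (frechet_derivative w (at y) u)) vs)) (at y)"
  by (rule bounded_linear.has_derivative[OF bounded_linear_covec_form w_deriv])

lemma covec_diff_family: "diff_family S y (\<lambda>x. covec_form (snd (w x)))"
proof (rule diff_family.intro)
  show "(\<lambda>x. covec_form (snd (w x)) vs) differentiable at y" for vs
    unfolding differentiable_def by (rule exI, rule covec_form_deriv)
qed (rule S alt_form_covec_form)+

text \<open>Together with \<open>flat_d_contract\<close> this gives the two terms i_X d\<eta> and d
  i_X \<eta> of Cartan's formula in coordinates. The latter is evaluated on coordinate vectors,
  which are the values that \<open>form_covec\<close> reads.\<close>

lemma contract_flat_d_covec: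
  "contract X (flat_d (\<lambda>x. covec_form (snd (w x))) y) = covec_form (\<Sum>i\<in>UNIV.
     X $ i *s snd (frechet_derivative w (at y) (axis i 1)) - cdot (snd (frechet_derivative w (at y) (axis i 1))) X *s axis i 1)"
proof -
  interpret diff_family S y "\<lambda>x. covec_form (snd (w x))" by (rule covec_diff_family)
  have fd: "form_deriv (\<lambda>x. covec_form (snd (w x))) y u = covec_form (snd (frechet_derivative w (at y) u))" for u
  proof
    fix vs
    show "form_deriv (\<lambda>x. covec_form (snd (w x))) y u vs = covec_form (snd (frechet_derivative w (at y) u)) vs"
      unfolding form_deriv_def by (rule fun_cong[OF frechet_derivative_at[OF covec_form_deriv], symmetric])
  qed
  have ax: "(\<Sum>j\<in>UNIV. axis i 1 $ j * X $ j) = X $ i" for i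
  proof -
    have "axis i 1 $ j * X $ j = (if j = i then X $ i else 0)" for j by (auto simp: axis_def)
    then show ?thesis by simp
  qed
  have cs: "contract X (\<Sum>i\<in>I. f i) = (\<Sum>i\<in>I. contract X (f i))" for I :: "'n set" and f
    by (induction I rule: infinite_finite_induct)
      (simp_all add: contract_linear, simp_all add: contract_eq cscale_form_simps)
  have "contract X (flat_d (\<lambda>x. covec_form (snd (w x))) y) =
    (\<Sum>i\<in>UNIV. contract X (wed (axis i 1) (covec_form (snd (frechet_derivative w (at y) (axis i 1))))))"
    unfolding flat_d_clifford fd cs by (simp add: clifford_coframe)
  also have "\<dots> = (\<Sum>i\<in>UNIV. covec_form (X $ i *s snd (frechet_derivative w (at y) (axis i 1)) - cdot (snd (frechet_derivative w (at y) (axis i 1))) X *s axis i 1))"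
    by (simp add: contract_wed ax contract_covec_form wedge_linear wed_one_form0 covec_form_linear covec_form_minus)
  finally show ?thesis by (simp add: covec_form_sum)
qed

lemma flat_d_contract:
  assumes v: "v differentiable at y"
  shows "flat_d (\<lambda>x. contract (fst (v x)) (covec_form (snd (w x)))) y [axis j 1] =
    covec_form (\<Sum>i\<in>UNIV. (cdot (snd (frechet_derivative w (at y) (axis i 1))) (fst (v y)) +
      cdot (snd (w y)) (fst (frechet_derivative v (at y) (axis i 1)))) *s axis i 1) [axis j 1]"
proof -
  have dv: "(v has_derivative frechet_derivative v (at y)) (at y)" using v by (simp add: frechet_derivative_works)
  let ?g = "\<lambda>u. cdot (snd (frechet_derivative w (at y) u)) (fst (v y)) + cdot (snd (w y)) (fst (frechet_derivative v (at y) u))"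
  have "((\<lambda>x. cdot (snd (w x)) (fst (v x))) has_derivative
     (\<lambda>u. \<Sum>i\<in>UNIV. snd (w y) $ i * fst (frechet_derivative v (at y) u) $ i + snd (frechet_derivative w (at y) u) $ i * fst (v y) $ i)) (at y)"
    unfolding cdot_def
    by (intro has_derivative_sum has_derivative_mult bounded_linear.has_derivative[OF bounded_linear_vec_nth]
      has_derivative_fst has_derivative_snd dv w_deriv)
  also have "(\<lambda>u. \<Sum>i\<in>UNIV. snd (w y) $ i * fst (frechet_derivative v (at y) u) $ i + snd (frechet_derivative w (at y) u) $ i * fst (v y) $ i) = ?g"
    by (simp add: fun_eq_iff cdot_def sum.distrib add.commute)
  finally have g: "((\<lambda>x. cdot (snd (w x)) (fst (v x))) has_derivative ?g) (at y)" .
  have "flat_d (\<lambda>x. contract (fst (v x)) (covec_form (snd (w x)))) y [axis j 1] =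
    frechet_derivative (\<lambda>x. cdot (snd (w x)) (fst (v x))) (at y) (axis j 1)"
    by (simp add: flat_d_def contract_covec_form form_pt one_form0_def)
  also have "\<dots> = ?g (axis j 1)"
    by (rule fun_cong[OF frechet_derivative_at[OF g], symmetric])
  also have "\<dots> = covec_form (\<Sum>i\<in>UNIV. ?g (axis i 1) *s axis i 1) [axis j 1]"
  proof -
    have "(\<Sum>i\<in>UNIV. ?g (axis i 1) *s axis i 1) $ k = ?g (axis k 1)" for k
      by (simp only: sum_component vector_smult_component sum_axis)
    then show ?thesis
      using covec_app_axis form_covec_covec_form[of "\<Sum>i\<in>UNIV. ?g (axis i 1) *s axis i 1"]
      by (simp add: form_covec_def vec_eq_iff)
  qed
  finally show ?thesis .
qed

end

context atlas
begin

text \<open>In the chart chosen at \<open>p\<close> components at \<open>p\<close> coincide with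
  values, so the left side is the flat double commutator plus the contribution of \<open>H\<close>.
  It remains to recognise the resulting coordinate expression as the Courant bracket.\<close>

theorem courant_derived_bracket:
  assumes W: "open W" "p \<in> W" and v: "smooth_section A W v" and w: "smooth_section A W w"
    and phi: "smooth_form A W \<phi>" and H: "smooth_form A UNIV H" "\<And>p. homogeneous 3 (H p)"
  shows "twisted_d A H (\<lambda>q. clifford (v q) (clifford (w q) (\<phi> q))) p + clifford (v p) (twisted_d A H (\<lambda>q. clifford (w q) (\<phi> q)) p)
    - clifford (w p) (twisted_d A H (\<lambda>q. clifford (v q) (\<phi> q)) p) - clifford (w p) (clifford (v p) (twisted_d A H \<phi> p))
    = clifford (courant A H v w p) (\<phi> p)"
proof -
  define c where "c = chart_at A p"
  define y where "y = snd c p"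
  define S where "S = snd c ` (fst c \<inter> W)"
  have c: "c \<in> A" "p \<in> fst c" by (simp_all add: c_def chart_at)
  have S: "open S" "y \<in> S" using open_chart_image[OF c(1) W(1)] c W by (auto simp: S_def y_def)
  define V where "V = sec_coord A c v"
  define X where "X = sec_coord A c w"
  define F where "F = form_coord A c \<phi>"
  have Vd: "V differentiable at y" and Xd: "X differentiable at y"
    using smooth_on_differentiable[OF _ S(2)] v w c by (auto simp: smooth_section_def S_def V_def X_def)
  have at_p: "V y = v p" "X y = w p" "F y = \<phi> p"
    by (simp_all add: V_def X_def F_def y_def c_def sec_coord_chart_at form_coord_chart_at)
  have Falt: "alt_form (F x)" if "x \<in> S" for x
    unfolding F_def by (rule alt_form_form_coord) (use that phi c in \<open>auto simp: S_def smooth_form_def\<close>)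
  interpret diff_family S y F
  proof (rule diff_family.intro)
    show "(\<lambda>x. F x vs) differentiable at y" for vs
      by (rule smooth_on_differentiable[OF _ S(2)]) (use phi c in \<open>auto simp: smooth_form_def S_def F_def\<close>)
  qed (rule S Falt | assumption)+
  have cl: "form_coord A c (\<lambda>q. clifford (u q) (\<psi> q)) x = clifford (sec_coord A c u x) (form_coord A c \<psi> x)"
    if "x \<in> S" for u \<psi> x
    using that form_coord_clifford[OF c(1)] by (auto simp: S_def)
  have d: "ext_d A \<psi> p = flat_d F' y" if "\<And>x. x \<in> S \<Longrightarrow> form_coord A c \<psi> x = F' x" for \<psi> F'
    unfolding ext_d_flat c_def[symmetric] y_def[symmetric] by (rule flat_d_cong[OF S that])
  have tw: "twisted_d A H \<psi> p = ext_d A \<psi> p + wedge (H p) (\<psi> p)" for \<psi>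
    by (simp add: fun_eq_iff twisted_d_def form_pt)
  have ph: "alt_form (\<phi> p)" and aH: "alt_form (H p)" using phi H W by (auto simp: smooth_form_def)
  define cc where "cc = (\<Sum>i\<in>UNIV. cscale_gt (fst (V y) $ i) (frechet_derivative X (at y) (axis i 1))
       - cscale_gt (fst (X y) $ i) (frechet_derivative V (at y) (axis i 1))
       + cscale_gt (cpair (frechet_derivative V (at y) (axis i 1)) (X y)) (coframe i))"
  define h where "h = form_covec (contract (fst (w p)) (contract (fst (v p)) (H p)))"
  have 1: "ext_d A (\<lambda>q. clifford (v q) (clifford (w q) (\<phi> q))) p = flat_d (\<lambda>x. clifford (V x) (clifford (X x) (F x))) y"
    by (rule d) (simp add: cl V_def X_def F_def)
  have 2: "ext_d A (\<lambda>q. clifford (w q) (\<phi> q)) p = flat_d (\<lambda>x. clifford (X x) (F x)) y"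
    "ext_d A (\<lambda>q. clifford (v q) (\<phi> q)) p = flat_d (\<lambda>x. clifford (V x) (F x)) y"
    "ext_d A \<phi> p = flat_d F y"
    by (rule d, simp add: cl V_def X_def F_def)+
  have "twisted_d A H (\<lambda>q. clifford (v q) (clifford (w q) (\<phi> q))) p + clifford (v p) (twisted_d A H (\<lambda>q. clifford (w q) (\<phi> q)) p)
    - clifford (w p) (twisted_d A H (\<lambda>q. clifford (v q) (\<phi> q)) p) - clifford (w p) (clifford (v p) (twisted_d A H \<phi> p))
    = (flat_d (\<lambda>x. clifford (V x) (clifford (X x) (F x))) y + clifford (V y) (flat_d (\<lambda>x. clifford (X x) (F x)) y)
      - clifford (X y) (flat_d (\<lambda>x. clifford (V x) (F x)) y) - clifford (X y) (clifford (V y) (flat_d F y))) +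
      (wedge (H p) (clifford (v p) (clifford (w p) (\<phi> p))) + clifford (v p) (wedge (H p) (clifford (w p) (\<phi> p)))
       - clifford (w p) (wedge (H p) (clifford (v p) (\<phi> p))) - clifford (w p) (clifford (v p) (wedge (H p) (\<phi> p))))"
    unfolding tw 1 2 at_p by (simp add: clifford_linear algebra_simps)
  also have "\<dots> = clifford (cc + (0, - h)) (\<phi> p)"
    unfolding flat_derived_bracket[OF Vd Xd] flat_derived_bracket_H[OF H(2) aH ph] cc_def[symmetric] h_def[symmetric] at_p(3)
    by (simp only: clifford_linear_left(1)[OF ph])
  also have "cc + (0, - h) = courant A H v w p"
  proof -
    have D: "frechet_derivative (\<lambda>x. fst (u x)) (at y) i = fst (frechet_derivative u (at y) i)" "(\<lambda>x. fst (u x)) differentiable at y"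
      if "u differentiable at y" for u :: "real^'n \<Rightarrow> (complex, 'n) gtan" and i
    proof -
      have "((\<lambda>x. fst (u x)) has_derivative (\<lambda>i. fst (frechet_derivative u (at y) i))) (at y)"
        by (intro has_derivative_fst) (use that in \<open>simp add: frechet_derivative_works\<close>)
      then show "frechet_derivative (\<lambda>x. fst (u x)) (at y) i = fst (frechet_derivative u (at y) i)" "(\<lambda>x. fst (u x)) differentiable at y"
        using frechet_derivative_at by (metis, auto simp: differentiable_def)
    qed
    have lie: "lie_bracket A v w p = fst cc"
      unfolding lie_bracket_def Let_def c_def[symmetric] y_def[symmetric] V_def[symmetric] X_def[symmetric]
        cderiv_sum[OF D(2)[OF Xd]] cderiv_sum[OF D(2)[OF Vd]] D(1)[OF Xd] D(1)[OF Vd] at_p[symmetric]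
      by (simp add: cc_def sum_fst_snd cscale_gt_def coframe_def sum_subtractf)
    have cov: "form_coord A c (\<lambda>q. covec_form (snd (u q))) x = covec_form (snd (sec_coord A c u x))" if "x \<in> S" for u x
      using that c by (auto simp: S_def form_coord_at pullback_covec_form sec_coord_at gtrans_def)
    have con: "form_coord A c (\<lambda>q. contract (fst (v q)) (covec_form (snd (w q)))) x = contract (fst (V x)) (covec_form (snd (X x)))"
      if x: "x \<in> S" for x
    proof -
      obtain q where q: "q \<in> fst c" "x = snd c q" using x by (auto simp: S_def)
      show ?thesis
        using q c pullback_contract[OF jacobian_inverse[of "chart_at A q" c q]] chart_at[of q]
        by (simp add: V_def X_def form_coord_at sec_coord_at gtrans_def pullback_covec_form)
    qed
    let ?R = "\<lambda>vs. lie_deriv A (\<lambda>q. fst (v q)) (\<lambda>q. covec_form (snd (w q))) p vs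
         - contract (fst (w p)) (ext_d A (\<lambda>q. covec_form (snd (v q))) p) vs
         - contract (fst (w p)) (contract (fst (v p)) (H p)) vs"
    have "?R [axis j 1] = (covec_form (snd cc) - contract (fst (w p)) (contract (fst (v p)) (H p))) [axis j 1]" for j
    proof -
      have a: "ext_d A (\<lambda>q. covec_form (snd (w q))) p = flat_d (\<lambda>x. covec_form (snd (X x))) y"
        "ext_d A (\<lambda>q. covec_form (snd (v q))) p = flat_d (\<lambda>x. covec_form (snd (V x))) y"
        "ext_d A (\<lambda>q. contract (fst (v q)) (covec_form (snd (w q)))) p = flat_d (\<lambda>x. contract (fst (V x)) (covec_form (snd (X x)))) y"
        by (rule d, simp add: cov con V_def X_def)+
      let ?dX = "\<lambda>i. frechet_derivative X (at y) (axis i 1)" and ?dV = "\<lambda>i. frechet_derivative V (at y) (axis i 1)"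
      \<comment> \<open>The three sums are i_X d\<eta>, d i_X \<eta> and i_Y d\<xi>. The derivatives
        of \<eta> evaluated on X occur in the first two with opposite signs and cancel.\<close>
      have "snd cc = (\<Sum>i\<in>UNIV. fst (V y) $ i *s snd (?dX i) - cdot (snd (?dX i)) (fst (V y)) *s axis i 1)
         + (\<Sum>i\<in>UNIV. (cdot (snd (?dX i)) (fst (V y)) + cdot (snd (X y)) (fst (?dV i))) *s axis i 1)
         - (\<Sum>i\<in>UNIV. fst (X y) $ i *s snd (?dV i) - cdot (snd (?dV i)) (fst (X y)) *s axis i 1)"
        unfolding cc_def sum_fst_snd sum.distrib[symmetric] sum_subtractf[symmetric]
        by (intro sum.cong refl)
          (simp add: cscale_gt_def coframe_def cpair_def cdot_def sum.distrib vec_eq_iff algebra_simps)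
      then show ?thesis
        unfolding lie_deriv_def a at_p[symmetric] contract_flat_d_covec[OF S Xd] contract_flat_d_covec[OF S Vd]
          flat_d_contract[OF S Xd Vd]
        by (simp add: covec_form_linear covec_form_minus form_pt)
    qed
    then have "form_covec ?R = form_covec (covec_form (snd cc) - contract (fst (w p)) (contract (fst (v p)) (H p)))"
      by (simp add: form_covec_def vec_eq_iff)
    then have "form_covec ?R = snd cc - h"
      by (simp only: form_covec_diff form_covec_covec_form h_def)
    then show ?thesis
      by (simp add: courant_def Let_def lie prod_eq_iff)
  qed
  finally show ?thesis .
qed

end

section \<open>Complex conjugation\<close>

definition cnj_form :: "'n mform \<Rightarrow> 'n mform" where
  "cnj_form \<phi> vs = cnj (\<phi> vs)"

lemma cnj_form_simps:
  "cnj_form (\<phi> + \<psi>) = cnj_form \<phi> + cnj_form \<psi>" "cnj_form (\<phi> - \<psi>) = cnj_form \<phi> - cnj_form \<psi>"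
  "cnj_form (a *\<^sub>f \<phi>) = cnj a *\<^sub>f cnj_form \<phi>" "cnj_form 0 = 0" "cnj_form (- \<phi>) = - cnj_form \<phi>"
  "cnj_form (cnj_form \<phi>) = \<phi>"
  by (simp_all add: cnj_form_def fun_eq_iff form_pt)

lemma cnj_form_sum: "cnj_form (\<Sum>i\<in>I. f i) = (\<Sum>i\<in>I. cnj_form (f i))"
  by (simp add: cnj_form_def fun_eq_iff sum_fun_apply)

lemma alt_form_cnj: "alt_form \<phi> \<Longrightarrow> alt_form (cnj_form \<phi>)"
  unfolding alt_form_def cnj_form_def linear_iff by simp

lemma cnj_form_wedge: "cnj_form (wedge \<alpha> \<beta>) = wedge (cnj_form \<alpha>) (cnj_form \<beta>)"
  by (simp add: cnj_form_def wedge_def fun_eq_iff)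

lemma cnj_form_covec_form: "cnj_form (covec_form \<xi>) = covec_form (\<chi> i. cnj (\<xi> $ i))"
  by (auto simp: cnj_form_def covec_form_def fun_eq_iff split: list.splits)

lemma cnj_form_clifford:
  assumes "alt_form \<phi>"
  shows "cnj_form (clifford z \<phi>) = clifford (cnj_gt z) (cnj_form \<phi>)"
proof -
  have v: "Re_vec (fst (cnj_gt z)) = Re_vec (fst z)" "Im_vec (fst (cnj_gt z)) = (-1) *\<^sub>R Im_vec (fst z)"
    by (simp_all add: Re_vec_def Im_vec_def cnj_gt_def vec_eq_iff)
  have s: "cnj_form (slot x \<phi>) = slot x (cnj_form \<phi>)" for x
    by (simp add: cnj_form_def slot_def fun_eq_iff)
  show ?thesis
    unfolding clifford_eq contract_eq v slot_scale[OF alt_form_cnj[OF assms]] cnj_form_simps cnj_form_wedge cnj_form_covec_form s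
    by (simp add: cnj_gt_def cscale_form_simps)
qed

lemma cnj_gt_basis: "cnj_gt (gt_basis k) = gt_basis k" "cnj_gt (gt_cobasis k) = gt_cobasis k"
  by (auto simp: cnj_gt_def gt_basis_def gt_cobasis_def axis_def vec_eq_iff)

lemma cnj_hol_part:
  assumes "orth_cs J"
  shows "cnj_gt (hol_part J z) = ahol_part J (cnj_gt z)" "cnj_gt (ahol_part J z) = hol_part J (cnj_gt z)"
  by (simp_all add: hol_part_def ahol_part_def cnj_gt_simps complexify_cnj[OF linJ[OF assms]] cscale_gt_simps)

text \<open>Conjugation exchanges holomorphic and antiholomorphic projections, so it turns N into
  the swapped number operator; as the two add up to 2 n, the eigenvalue n - k becomes n + k.\<close>

lemma spin_grade_cnj:
  fixes J :: "(real, 'n::finite) gtan \<Rightarrow> (real, 'n) gtan"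
  assumes J: "orth_cs J" and n: "CARD('n) = 2 * n" and phi: "\<phi> \<in> spin_grade J k"
  shows "cnj_form \<phi> \<in> spin_grade J (- k)"
proof -
  interpret adj_pair "hol_part J" "ahol_part J" by (rule adj_pair_hol[OF J])
  have alt: "alt_form \<phi>" and e: "number (hol_part J) (ahol_part J) \<phi> = of_int (int n - k) *\<^sub>f \<phi>"
    using phi n by (simp_all add: spin_grade_iff[OF J])
  have "cnj_form (number (hol_part J) (ahol_part J) \<phi>) = number (ahol_part J) (hol_part J) (cnj_form \<phi>)"
    by (simp add: number_op_def cnj_form_sum cnj_form_clifford alt cnj_hol_part[OF J] cnj_gt_basis)
  then have s: "number (ahol_part J) (hol_part J) (cnj_form \<phi>) = of_int (int n - k) *\<^sub>f cnj_form \<phi>"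
    by (simp add: e cnj_form_simps)
  have "number (hol_part J) (ahol_part J) (cnj_form \<phi>) = of_nat (2 * n) *\<^sub>f cnj_form \<phi> - of_int (int n - k) *\<^sub>f cnj_form \<phi>"
    using number_sum_swap[OF alt_form_cnj[OF alt]] unfolding s ctrace_hol_part[OF J] n
    by (metis add_diff_cancel_right')
  also have "\<dots> = of_int (int n - (- k)) *\<^sub>f cnj_form \<phi>"
    by (simp add: fun_eq_iff form_pt algebra_simps)
  finally show ?thesis
    using alt_form_cnj[OF alt] n by (simp add: spin_grade_iff[OF J])
qed

context herm_fibre
begin

lemma U_cnj: "\<phi> \<in> U p q \<Longrightarrow> cnj_form \<phi> \<in> U (- p) (- q)"
  using spin_grade_cnj[OF J dim] spin_grade_cnj[OF orth_cs_GJ dim] by (simp add: U_def)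

lemma grade_proj_cnj:
  assumes "alt_form \<psi>"
  shows "grade_proj (- p) (- q) (cnj_form \<psi>) = cnj_form (grade_proj p q \<psi>)"
proof (rule grade_proj_ext[OF assms])
  fix a b \<phi> assume phi: "\<phi> \<in> U a b"
  show "grade_proj (- p) (- q) (cnj_form \<phi>) = cnj_form (grade_proj p q \<phi>)"
    unfolding grade_proj_U[OF phi] grade_proj_U[OF U_cnj[OF phi]] by (simp add: cnj_form_simps)
qed (simp_all add: cnj_form_simps grade_proj_add alt_form_cnj)

text \<open>Each of the four summands of the complexified fibre shifts the bidegree by exactly one
  of the four pairs of signs.\<close>

lemma clifford_grades:
  assumes phi: "\<phi> \<in> U a b" and ne: "(i, j) \<notin> {(a + 1, b + 1), (a + 1, b - 1), (a - 1, b - 1), (a - 1, b + 1)}"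
  shows "grade_proj i j (clifford z \<phi>) = 0"
proof -
  interpret e1: adj_pair "PE 1" "QE 1" by (rule adj_pair_E) simp
  interpret e2: adj_pair "PE (-1)" "QE (-1)" by (rule adj_pair_E) simp
  note alt = U_alt[OF phi]
  have m: "clifford (PE 1 z) \<phi> \<in> U (a + 1) (b + 1)" "clifford (PE (-1) z) \<phi> \<in> U (a + 1) (b + - 1)"
    "clifford (QE 1 z) \<phi> \<in> U (a - 1) (b - 1)" "clifford (QE (-1) z) \<phi> \<in> U (a - 1) (b - - 1)"
    by (intro clifford_E clifford_E' phi e1.idem e2.idem; simp)+
  have "clifford z \<phi> = clifford (PE 1 z) \<phi> + clifford (PE (-1) z) \<phi> + clifford (QE 1 z) \<phi> + clifford (QE (-1) z) \<phi>"
    by (subst E_decomp[of z]) (simp only: clifford_linear_left[OF alt])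
  then show ?thesis
    using ne by (auto simp: grade_proj_add alt alt_form_linear grade_proj_U[OF m(1)] grade_proj_U[OF m(2)]
        grade_proj_U[OF m(3)] grade_proj_U[OF m(4)])
qed

text \<open>The four parts of \<open>z\<close> shift the bidegree by four different amounts, and all
  except the part in \<open>E\<close> fail to raise p + s q. The hypothesis therefore makes the
  other three act by zero on every U^{a,b}; being zero as operators, their sum is zero by
  faithfulness.\<close>

lemma PE_of_grades:
  assumes s: "s = 1 \<or> s = -1"
    and z: "\<And>a b i j \<phi>. \<phi> \<in> U a b \<Longrightarrow> (i - a) + s * (j - b) \<le> 0 \<Longrightarrow> grade_proj i j (clifford z \<phi>) = 0"
  shows "PE s z = z"
proof -
  have s': "- s = 1 \<or> - s = -1" using s by auto
  have ss: "s * s = 1" using s by auto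
  interpret e1: adj_pair "PE s" "QE s" by (rule adj_pair_E[OF s])
  interpret e2: adj_pair "PE (- s)" "QE (- s)" by (rule adj_pair_E[OF s'])
  have dec: "z = PE s z + (PE (- s) z + QE s z + QE (- s) z)"
    using s E_decomp[of z] by (auto simp: algebra_simps)
  have U0: "clifford (PE (- s) z + QE s z + QE (- s) z) \<phi> = 0" if phi: "\<phi> \<in> U a b" for a b \<phi>
  proof -
    note alt = U_alt[OF phi]
    have m: "clifford (PE s z) \<phi> \<in> U (a + 1) (b + s)" "clifford (PE (- s) z) \<phi> \<in> U (a + 1) (b + - s)"
      "clifford (QE s z) \<phi> \<in> U (a - 1) (b - s)" "clifford (QE (- s) z) \<phi> \<in> U (a - 1) (b - - s)"
      by (intro clifford_E clifford_E' phi e1.idem e2.idem s s')+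
    have c: "clifford z \<phi> = clifford (PE s z) \<phi> + (clifford (PE (- s) z) \<phi> + clifford (QE s z) \<phi> + clifford (QE (- s) z) \<phi>)"
      by (subst dec) (simp only: clifford_linear_left[OF alt])
    have gp: "grade_proj i j (clifford z \<phi>) = grade_proj i j (clifford (PE s z) \<phi>) + (grade_proj i j (clifford (PE (- s) z) \<phi>)
       + grade_proj i j (clifford (QE s z) \<phi>) + grade_proj i j (clifford (QE (- s) z) \<phi>))" for i j
      unfolding c by (simp add: grade_proj_add alt alt_form_linear)
    note gU = grade_proj_U[OF m(1)] grade_proj_U[OF m(2)] grade_proj_U[OF m(3)] grade_proj_U[OF m(4)]
    have "grade_proj (a + 1) (b - s) (clifford z \<phi>) = 0" "grade_proj (a - 1) (b - s) (clifford z \<phi>) = 0"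
      "grade_proj (a - 1) (b + s) (clifford z \<phi>) = 0"
      by (rule z[OF phi], simp add: ss)+
    then have "clifford (PE (- s) z) \<phi> = 0" "clifford (QE s z) \<phi> = 0" "clifford (QE (- s) z) \<phi> = 0"
      unfolding gp gU using s by auto
    then show ?thesis by (simp add: clifford_linear_left[OF alt])
  qed
  have "PE (- s) z + QE s z + QE (- s) z = 0"
  proof (rule clifford_faithful)
    fix \<phi> :: "'n mform" assume alt: "alt_form \<phi>"
    show "clifford (PE (- s) z + QE s z + QE (- s) z) \<phi> = 0"
    proof (rule grade_proj_ext[OF alt, of "clifford (PE (- s) z + QE s z + QE (- s) z)" "\<lambda>_. 0"])
      show "clifford (PE (- s) z + QE s z + QE (- s) z) \<psi> = 0" if "\<psi> \<in> U a b" for a b \<psi>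
        by (rule U0[OF that])
    qed (simp_all add: clifford_linear)
  qed
  then show ?thesis using dec by simp
qed

end

section \<open>Hermitian structures on the manifold\<close>

locale skt_data = atlas A
  for A :: "('a::{t2_space,second_countable_topology}, 'n::finite) chart set" +
  fixes n :: nat and H :: "'a \<Rightarrow> 'n mform"
    and G I_plus I_minus :: "'a \<Rightarrow> (real, 'n) gtan \<Rightarrow> (real, 'n) gtan"
  assumes dim: "CARD('n) = 2 * n" and H: "real_closed_3form A H" and G: "generalized_metric A G"
    and Ip: "positive_almost_hermitian A G I_plus" and Im: "negative_almost_hermitian A G I_minus"
begin

abbreviation "J \<equiv> sum_structure G I_plus I_minus"

lemma metric: "smooth_endo_on A (\<lambda>_. UNIV) G" "pairing (G p v) (G p w) = pairing v w" "pairing (G p v) w = pairing v (G p w)"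
  "v \<noteq> 0 \<Longrightarrow> pairing (G p v) v > 0"
  using G unfolding generalized_metric_def by blast+

lemma smooth_endo_onD:
  assumes "smooth_endo_on A V T"
  shows "v \<in> V p \<Longrightarrow> T p v \<in> V p" "v \<in> V p \<Longrightarrow> w \<in> V p \<Longrightarrow> T p (v + w) = T p v + T p w"
    "v \<in> V p \<Longrightarrow> T p (a *\<^sub>R v) = a *\<^sub>R T p v"
    "open W \<Longrightarrow> smooth_section A W u \<Longrightarrow> (\<And>p. p \<in> W \<Longrightarrow> u p \<in> V p) \<Longrightarrow> smooth_section A W (\<lambda>p. T p (u p))"
proof -
  have 1: "\<forall>p. \<forall>v\<in>V p. T p v \<in> V p"
    using assms unfolding smooth_endo_on_def by (elim conjE)
  have 2: "\<forall>p. \<forall>v\<in>V p. \<forall>w\<in>V p. T p (v + w) = T p v + T p w"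
    using assms unfolding smooth_endo_on_def by (elim conjE)
  have 3: "\<forall>p. \<forall>v\<in>V p. \<forall>a. T p (a *\<^sub>R v) = a *\<^sub>R T p v"
    using assms unfolding smooth_endo_on_def by (elim conjE)
  have 4: "\<forall>W v. open W \<longrightarrow> smooth_section A W v \<longrightarrow> (\<forall>p\<in>W. v p \<in> V p) \<longrightarrow> smooth_section A W (\<lambda>p. T p (v p))"
    using assms unfolding smooth_endo_on_def by (elim conjE)
  show "v \<in> V p \<Longrightarrow> T p v \<in> V p" using 1 by blast
  show "v \<in> V p \<Longrightarrow> w \<in> V p \<Longrightarrow> T p (v + w) = T p v + T p w" using 2 by blast
  show "v \<in> V p \<Longrightarrow> T p (a *\<^sub>R v) = a *\<^sub>R T p v" using 3 by blast
  assume W: "open W" "smooth_section A W u" "\<And>p. p \<in> W \<Longrightarrow> u p \<in> V p"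
  then have "\<forall>p\<in>W. u p \<in> V p" by blast
  with 4[rule_format, OF W(1,2)] show "smooth_section A W (\<lambda>p. T p (u p))" by blast
qed

lemma linear_G: "linear (G p)"
  using smooth_endo_onD(2,3)[OF metric(1)] by (intro linearI) auto

lemma GG: "G p (G p v) = v"
  by (rule pairing_nondegenerate) (metis metric(2,3))

lemma plus_structure: "smooth_endo_on A (V_plus G) I_plus" "v \<in> V_plus G p \<Longrightarrow> I_plus p (I_plus p v) = - v"
  "v \<in> V_plus G p \<Longrightarrow> w \<in> V_plus G p \<Longrightarrow> pairing (I_plus p v) (I_plus p w) = pairing v w"
  using Ip unfolding positive_almost_hermitian_def orthogonal_complex_structure_on_def by blast+

lemma minus_structure: "smooth_endo_on A (V_minus G) I_minus" "v \<in> V_minus G p \<Longrightarrow> I_minus p (I_minus p v) = - v"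
  "v \<in> V_minus G p \<Longrightarrow> w \<in> V_minus G p \<Longrightarrow> pairing (I_minus p v) (I_minus p w) = pairing v w"
  using Im unfolding negative_almost_hermitian_def orthogonal_complex_structure_on_def by blast+

definition plus_part :: "'a \<Rightarrow> (real, 'n) gtan \<Rightarrow> (real, 'n) gtan" where "plus_part p v = (1/2) *\<^sub>R (v + G p v)"
definition minus_part :: "'a \<Rightarrow> (real, 'n) gtan \<Rightarrow> (real, 'n) gtan" where "minus_part p v = (1/2) *\<^sub>R (v - G p v)"

lemma J_eq: "J p v = I_plus p (plus_part p v) + I_minus p (minus_part p v)"
  by (simp add: sum_structure_def plus_part_def minus_part_def)

lemmas G_linear = linear_add[OF linear_G] linear_diff[OF linear_G] linear_scale[OF linear_G] linear_neg[OF linear_G]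

lemma part_in: "plus_part p v \<in> V_plus G p" "minus_part p v \<in> V_minus G p"
  by (simp_all add: plus_part_def minus_part_def V_plus_def V_minus_def G_linear GG add.commute flip: scaleR_minus_right)

lemma parts_sum: "plus_part p v + minus_part p v = v"
  by (simp add: plus_part_def minus_part_def flip: scaleR_add_right scaleR_2)

lemma part_linear: "plus_part p (v + w) = plus_part p v + plus_part p w" "plus_part p (a *\<^sub>R v) = a *\<^sub>R plus_part p v"
  "minus_part p (v + w) = minus_part p v + minus_part p w" "minus_part p (a *\<^sub>R v) = a *\<^sub>R minus_part p v"
  by (simp_all add: plus_part_def minus_part_def G_linear algebra_simps)

lemma part_of_V: "v \<in> V_plus G p \<Longrightarrow> plus_part p v = v" "v \<in> V_plus G p \<Longrightarrow> minus_part p v = 0"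
  "v \<in> V_minus G p \<Longrightarrow> plus_part p v = 0" "v \<in> V_minus G p \<Longrightarrow> minus_part p v = v"
  by (simp_all add: plus_part_def minus_part_def V_plus_def V_minus_def flip: scaleR_2)

lemma I_zero: "I_plus p 0 = 0" "I_minus p 0 = 0"
  using smooth_endo_onD(3)[OF plus_structure(1), of 0 p 0] smooth_endo_onD(3)[OF minus_structure(1), of 0 p 0]
  by (simp_all add: V_plus_def V_minus_def linear_0[OF linear_G])

lemma J_linear: "linear (J p)"
proof (rule linearI)
  show "J p (v + w) = J p v + J p w" for v w
    by (simp add: J_eq part_linear smooth_endo_onD(2)[OF plus_structure(1) part_in(1) part_in(1)]
        smooth_endo_onD(2)[OF minus_structure(1) part_in(2) part_in(2)])
  show "J p (a *\<^sub>R v) = a *\<^sub>R J p v" for a v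
    by (simp add: J_eq part_linear smooth_endo_onD(3)[OF plus_structure(1) part_in(1)]
        smooth_endo_onD(3)[OF minus_structure(1) part_in(2)] scaleR_add_right)
qed

lemma I_in: "I_plus p (plus_part p v) \<in> V_plus G p" "I_minus p (minus_part p v) \<in> V_minus G p"
  by (rule smooth_endo_onD(1)[OF plus_structure(1) part_in(1)], rule smooth_endo_onD(1)[OF minus_structure(1) part_in(2)])

lemma J_plus: "v \<in> V_plus G p \<Longrightarrow> J p v = I_plus p v" "v \<in> V_minus G p \<Longrightarrow> J p v = I_minus p v"
  by (simp_all add: J_eq part_of_V I_zero)

lemma JJ: "J p (J p v) = - v"
proof -
  have "J p (J p v) = J p (I_plus p (plus_part p v)) + J p (I_minus p (minus_part p v))"
    unfolding J_eq[of p v] by (rule linear_add[OF J_linear])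
  also have "\<dots> = - plus_part p v + - minus_part p v"
    by (simp add: J_plus I_in plus_structure(2)[OF part_in(1)] minus_structure(2)[OF part_in(2)])
  finally show ?thesis using parts_sum[of p v] by (metis minus_add_distrib add.commute)
qed

lemma V_orth: "v \<in> V_plus G p \<Longrightarrow> w \<in> V_minus G p \<Longrightarrow> pairing v w = 0"
  using metric(3)[of p v w] by (simp add: V_plus_def V_minus_def pairing_linear)

lemma J_orth: "pairing (J p v) (J p w) = pairing v w"
proof -
  have "pairing (J p v) (J p w) = pairing (I_plus p (plus_part p v)) (I_plus p (plus_part p w)) + pairing (I_minus p (minus_part p v)) (I_minus p (minus_part p w))"
    by (simp add: J_eq pairing_linear V_orth[OF I_in] pairing_commute[of "I_minus p _" "I_plus p _"])
  also have "\<dots> = pairing (plus_part p v) (plus_part p w) + pairing (minus_part p v) (minus_part p w)"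
    by (simp add: plus_structure(3) minus_structure(3) part_in)
  also have "\<dots> = pairing (plus_part p v + minus_part p v) (plus_part p w + minus_part p w)"
    by (simp add: pairing_linear V_orth[OF part_in] pairing_commute[of "minus_part p _" "plus_part p _"])
  finally show ?thesis by (simp add: parts_sum)
qed

lemma GJ: "G p (J p v) = J p (G p v)"
proof -
  have "G p (J p v) = I_plus p (plus_part p v) - I_minus p (minus_part p v)"
    using I_in[of p v] by (simp add: J_eq G_linear V_plus_def V_minus_def)
  moreover have "G p v = plus_part p v - minus_part p v"
    by (simp add: plus_part_def minus_part_def flip: scaleR_diff_right scaleR_2)
  ultimately show ?thesis
    by (simp add: linear_diff[OF J_linear] J_plus part_in)
qed

sublocale fib: herm_fibre "G p" "J p" n for p
proof (rule herm_fibre.intro)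
  show "orth_cs (J p)" unfolding orth_cs_def using J_linear JJ J_orth by blast
qed (rule linear_G GG metric(3,4) GJ dim | assumption)+

lemma smooth_J: "smooth_endo_on A (\<lambda>_. UNIV) J"
  unfolding smooth_endo_on_def
proof (intro conjI allI ballI impI)
  show "J p (v + w) = J p v + J p w" "J p (a *\<^sub>R v) = a *\<^sub>R J p v" for p v w a
    using linear_add[OF J_linear] linear_scale[OF J_linear] by blast+
  fix W :: "'a set" and v :: "'a \<Rightarrow> (real, 'n) gtan"
  assume W: "open W" and v: "smooth_section A W v"
  have Gv: "smooth_section A W (\<lambda>p. G p (v p))" by (rule smooth_endo_onD(4)[OF metric(1) W v]) simp
  have sc: "smooth_section A W (\<lambda>p. r *\<^sub>R u p)" if u: "smooth_section A W u" for r and u :: "'a \<Rightarrow> (real, 'n) gtan"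
  proof -
    have "sec_coord A c (\<lambda>q. r *\<^sub>R u q) = (\<lambda>y. r *\<^sub>R sec_coord A c u y)" for c
      by (simp add: sec_coord_eq fun_eq_iff gtrans_def prod_eq_iff matrix_vector_mult_scaleR del: transpose_matrix_vector)
    then show ?thesis using u W
      by (auto simp: smooth_section_def intro!: smooth_on_bounded_linear[OF bounded_linear_scaleR_right] open_chart_image)
  qed
  have 1: "smooth_section A W (\<lambda>p. plus_part p (v p))"
    unfolding plus_part_def by (intro sc smooth_section_add W v Gv)
  have 2: "smooth_section A W (\<lambda>p. minus_part p (v p))"
  proof -
    have "(\<lambda>p. minus_part p (v p)) = (\<lambda>p. (1/2) *\<^sub>R (v p + (-1) *\<^sub>R G p (v p)))" by (simp add: minus_part_def)
    then show ?thesis by (simp only:) (intro sc smooth_section_add W v Gv)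
  qed
  have "smooth_section A W (\<lambda>p. I_plus p (plus_part p (v p)) + I_minus p (minus_part p (v p)))"
    by (intro smooth_section_add W smooth_endo_onD(4)[OF plus_structure(1) W 1] smooth_endo_onD(4)[OF minus_structure(1) W 2] part_in)
  then show "smooth_section A W (\<lambda>p. J p (v p))" by (simp add: J_eq)
qed simp

section \<open>The eigenbundles V_+^{1,0} and V_-^{1,0}\<close>

definition E :: "int \<Rightarrow> 'a \<Rightarrow> (complex, 'n) gtan set" where "E s p = {z. fib.PE p s z = z}"

lemma E_plus: "i_eigenspace (V_plus G p) (I_plus p) = E 1 p"
proof -
  have "z \<in> i_eigenspace (V_plus G p) (I_plus p) \<longleftrightarrow> fib.PE p 1 z = z" for z
  proof -
    have "fib.PE p 1 z = z \<longleftrightarrow> complexify (J p) z = cscale_gt \<i> z \<and> complexify (G p) z = z"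
      using fib.PE_iff[of 1 p z] by (simp add: cscale_gt_simps)
    also have "complexify (G p) z = z \<longleftrightarrow> Re_gt z \<in> V_plus G p \<and> Im_gt z \<in> V_plus G p"
      by (simp add: gt_eq_iff complexify_Re_Im V_plus_def)
    also have "complexify (J p) z = cscale_gt \<i> z \<and> Re_gt z \<in> V_plus G p \<and> Im_gt z \<in> V_plus G p \<longleftrightarrow>
      Re_gt z \<in> V_plus G p \<and> Im_gt z \<in> V_plus G p \<and> complexify (I_plus p) z = cscale_gt \<i> z"
      by (auto simp: complexify_def J_plus)
    finally show ?thesis by (simp add: i_eigenspace_def)
  qed
  then show ?thesis by (auto simp: E_def)
qed

lemma E_minus: "i_eigenspace (V_minus G p) (I_minus p) = E (-1) p"
proof -
  have "z \<in> i_eigenspace (V_minus G p) (I_minus p) \<longleftrightarrow> fib.PE p (-1) z = z" for z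
  proof -
    have "fib.PE p (-1) z = z \<longleftrightarrow> complexify (J p) z = cscale_gt \<i> z \<and> complexify (G p) z = - z"
      using fib.PE_iff[of "-1" p z] by (simp add: cscale_gt_simps)
    also have "complexify (G p) z = - z \<longleftrightarrow> Re_gt z \<in> V_minus G p \<and> Im_gt z \<in> V_minus G p"
      by (simp add: gt_eq_iff complexify_Re_Im V_minus_def Re_gt_simps Im_gt_simps)
    also have "complexify (J p) z = cscale_gt \<i> z \<and> Re_gt z \<in> V_minus G p \<and> Im_gt z \<in> V_minus G p \<longleftrightarrow>
      Re_gt z \<in> V_minus G p \<and> Im_gt z \<in> V_minus G p \<and> complexify (I_minus p) z = cscale_gt \<i> z"
      by (auto simp: complexify_def J_plus)
    finally show ?thesis by (simp add: i_eigenspace_def)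
  qed
  then show ?thesis by (auto simp: E_def)
qed

lemma smooth_hol_part:
  assumes W: "open W" and v: "smooth_section A W v"
  shows "smooth_section A W (\<lambda>p. hol_part (J p) (v p))" "smooth_section A W (\<lambda>p. ahol_part (J p) (v p))"
    "smooth_section A W (\<lambda>p. hol_part (G p \<circ> J p) (v p))" "smooth_section A W (\<lambda>p. ahol_part (G p \<circ> J p) (v p))"
proof -
  have a: "z - cscale_gt \<i> w = z + cscale_gt (- \<i>) w" for z w :: "(complex, 'n) gtan"
    by (simp add: cscale_gt_simps)
  note c = smooth_section_complexify[OF W _ smooth_J] smooth_section_complexify[OF W _ metric(1)]
  show "smooth_section A W (\<lambda>p. hol_part (J p) (v p))" "smooth_section A W (\<lambda>p. ahol_part (J p) (v p))"
    "smooth_section A W (\<lambda>p. hol_part (G p \<circ> J p) (v p))" "smooth_section A W (\<lambda>p. ahol_part (G p \<circ> J p) (v p))"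
    unfolding hol_part_def ahol_part_def complexify_o a
    by (intro smooth_section_cscale smooth_section_add W v c)+
qed

lemma smooth_PE:
  assumes W: "open W" and v: "smooth_section A W v"
  shows "smooth_section A W (\<lambda>p. fib.PE p s (v p))"
  unfolding fib.PE_def
  by (intro smooth_hol_part(1) smooth_section_cscale smooth_section_add W v smooth_section_complexify[OF W _ metric(1)])

lemma spin_bigrade_U: "spin_bigrade G J x p q = fib.U x p q"
  by (simp add: spin_bigrade_def fib.U_def)

lemma spin_proj_fib: "spin_proj G J x p q \<psi> = fib.grade_proj x p q \<psi>"
  by (simp add: fib.grade_proj_def spin_proj_def spin_bigrade_def)

lemma H_props: "smooth_form A UNIV H" "homogeneous 3 (H p)" "cnj_form (H p) = H p" "alt_form (H p)"
proof -
  show 1: "smooth_form A UNIV H" "homogeneous 3 (H p)" using H by (auto simp: real_closed_3form_def)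
  show "cnj_form (H p) = H p"
    using H by (auto simp: real_closed_3form_def cnj_form_def fun_eq_iff Reals_cnj_iff)
  show "alt_form (H p)" using 1 by (simp add: smooth_form_def)
qed

section \<open>The twisted differential and its components\<close>

abbreviation "dH \<equiv> twisted_d A H"

lemma dH_eq: "dH \<phi> x = ext_d A \<phi> x + wedge (H x) (\<phi> x)"
  by (simp add: fun_eq_iff twisted_d_def form_pt)

lemma form_diff_family:
  assumes "open W" "x \<in> W" "smooth_form A W \<phi>" "c = chart_at A x"
  shows "diff_family (snd c ` (fst c \<inter> W)) (snd c x) (form_coord A c \<phi>)"
proof (rule diff_family.intro)
  have c: "c \<in> A" "x \<in> fst c" by (simp_all add: assms(4) chart_at)
  show "open (snd c ` (fst c \<inter> W))" by (rule open_chart_image[OF c(1) assms(1)])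
  show x: "snd c x \<in> snd c ` (fst c \<inter> W)" using c assms by auto
  show "alt_form (form_coord A c \<phi> y)" if "y \<in> snd c ` (fst c \<inter> W)" for y
    by (rule alt_form_form_coord) (use that assms c in \<open>auto simp: smooth_form_def\<close>)
  show "(\<lambda>y. form_coord A c \<phi> y vs) differentiable at (snd c x)" for vs
    by (rule smooth_on_differentiable[OF _ x]) (use assms c in \<open>auto simp: smooth_form_def\<close>)
qed

lemma alt_form_dH:
  assumes "open W" "x \<in> W" "smooth_form A W \<phi>"
  shows "alt_form (dH \<phi> x)"
proof -
  interpret diff_family "snd (chart_at A x) ` (fst (chart_at A x) \<inter> W)" "snd (chart_at A x) x" "form_coord A (chart_at A x) \<phi>"
    by (rule form_diff_family[OF assms refl])
  have "alt_form (ext_d A \<phi> x)"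
    unfolding ext_d_flat flat_d_clifford by (intro alt_form_sum alt_form_clifford alt_form_deriv)
  moreover have "alt_form (wedge (H x) (\<phi> x))"
    using assms H_props(4) by (intro alt_form_wedge) (auto simp: smooth_form_def)
  ultimately show ?thesis unfolding dH_eq by (intro alt_form_linear)
qed

lemma dH_zero:
  assumes W: "open W" "x \<in> W" and z: "\<And>q. q \<in> W \<Longrightarrow> \<phi> q = 0"
  shows "dH \<phi> x = 0"
proof -
  define c where "c = chart_at A x"
  have c: "c \<in> A" "x \<in> fst c" by (simp_all add: c_def chart_at)
  have "flat_d (form_coord A c \<phi>) (snd c x) = flat_d (\<lambda>_. 0) (snd c x)"
    by (rule flat_d_cong[OF open_chart_image[OF c(1) W(1)]])
      (use c W z in \<open>auto simp: form_coord_at pullback_linear\<close>)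
  also have "\<dots> = 0" by (simp add: flat_d_def fun_eq_iff form_pt)
  finally show ?thesis using z[OF W(2)] by (simp add: dH_eq ext_d_flat c_def wedge_linear)
qed

text \<open>Vanishing of the component of d^H with shift (r, r'), for arbitrary integers. Shifts
  that are absent from d^H and those of the torsion are then treated by one induction.\<close>

definition no_shift :: "int \<Rightarrow> int \<Rightarrow> bool" where
  "no_shift r r' \<longleftrightarrow> (\<forall>p q W \<phi> x. open W \<longrightarrow> smooth_form A W \<phi> \<longrightarrow> (\<forall>x\<in>W. \<phi> x \<in> fib.U x p q) \<longrightarrow> x \<in> W \<longrightarrow>
     fib.grade_proj x (p + r) (q + r') (dH \<phi> x) = 0)"

lemma no_shiftD:
  assumes "no_shift r r'" "open W" "smooth_form A W \<phi>" "\<And>x. x \<in> W \<Longrightarrow> \<phi> x \<in> fib.U x p q" "x \<in> W"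
    "i = p + r" "j = q + r'"
  shows "fib.grade_proj x i j (dH \<phi> x) = 0"
  using assms unfolding no_shift_def by blast

lemma torsion_vanishes_iff: "torsion_vanishes (dH_component r r') A H G J \<longleftrightarrow> no_shift r r'"
proof -
  have z: "(\<forall>vs. \<phi> vs = 0) \<longleftrightarrow> \<phi> = 0" for \<phi> :: "'n mform" by (simp add: fun_eq_iff form_pt)
  show ?thesis
    unfolding torsion_vanishes_def no_shift_def bigrade_sections_def dH_component_def spin_bigrade_U spin_proj_fib z
    by blast
qed

text \<open>d^H is real because H is, and conjugation maps U^{p,q} to U^{-p,-q}. The induction
  reaches only components that lower the weight, so raising ones are handled through their
  conjugates.\<close>

lemma no_shift_cnj:
  assumes "no_shift r r'"
  shows "no_shift (- r) (- r')"
  unfolding no_shift_def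
proof (intro allI impI)
  fix p q W \<phi> x
  assume W: "open W" and phi: "smooth_form A W \<phi>" and U: "\<forall>x\<in>W. \<phi> x \<in> fib.U x p q" and x: "x \<in> W"
  define \<psi> where "\<psi> = (\<lambda>q. cnj_form (\<phi> q))"
  have fc: "form_coord A c \<psi> y vs = cnj (form_coord A c \<phi> y vs)" for c y vs
    by (simp add: form_coord_eq \<psi>_def pullback_def cnj_form_def)
  have psi: "smooth_form A W \<psi>"
    using phi W unfolding smooth_form_def fc
    by (auto simp: \<psi>_def alt_form_cnj intro!: smooth_on_bounded_linear[OF bounded_linear_cnj] open_chart_image)
  have psiU: "\<psi> y \<in> fib.U y (- p) (- q)" if "y \<in> W" for y
    using fib.U_cnj U that by (simp add: \<psi>_def)
  have d: "dH \<psi> x = cnj_form (dH \<phi> x)"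
  proof -
    define c where "c = chart_at A x"
    interpret diff_family "snd c ` (fst c \<inter> W)" "snd c x" "form_coord A c \<phi>"
      by (rule form_diff_family[OF W x phi c_def])
    have "frechet_derivative (\<lambda>y. cnj (form_coord A c \<phi> y vs)) (at (snd c x)) u
      = cnj (frechet_derivative (\<lambda>y. form_coord A c \<phi> y vs) (at (snd c x)) u)" for vs u
      using fun_cong[OF frechet_derivative_at[OF bounded_linear.has_derivative[OF bounded_linear_cnj F_deriv[of vs]]], of u]
      by (simp add: form_deriv_def)
    then have "flat_d (form_coord A c \<psi>) (snd c x) = cnj_form (flat_d (form_coord A c \<phi>) (snd c x))"
      by (simp add: fun_eq_iff flat_d_def cnj_form_def fc)
    then show ?thesis
      by (simp add: dH_eq ext_d_flat c_def cnj_form_simps cnj_form_wedge H_props(3)) (simp add: \<psi>_def)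
  qed
  have "fib.grade_proj x (- p + r) (- q + r') (cnj_form (dH \<phi> x)) = 0"
    unfolding d[symmetric] by (rule no_shiftD[OF assms W psi psiU x refl refl])
  then have "cnj_form (fib.grade_proj x (p + - r) (q + - r') (dH \<phi> x)) = 0"
    using fib.grade_proj_cnj[OF alt_form_dH[OF W x phi], of x "p - r" "q - r'"] by simp
  then show "fib.grade_proj x (p + - r) (q + - r') (dH \<phi> x) = 0"
    by (metis cnj_form_simps(4,6))
qed

text \<open>A section that is constant in a chart is projected to \<open>E\<close>; the projection
  depends smoothly on the point and fixes the prescribed value.\<close>

lemma E_extend:
  assumes "z \<in> E s x" "s = 1 \<or> s = -1" "c = chart_at A x" "open W" "W \<subseteq> fst c" "x \<in> W"
  obtains v where "smooth_section A W v" "\<And>q. v q \<in> E s q" "v x = z"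
proof
  have c: "c \<in> A" "x \<in> fst c" by (simp_all add: assms(3) chart_at)
  let ?v = "\<lambda>q. fib.PE q s (const_section c z q)"
  show "smooth_section A W ?v"
    by (rule smooth_PE[OF assms(4) smooth_const_section[OF c(1) assms(4,5)]])
  show "?v q \<in> E s q" for q
    unfolding E_def using adj_pair.idem(1)[OF fib.adj_pair_E[OF assms(2)]] by simp
  show "?v x = z"
    using assms(1,3) c by (simp add: const_section_def gtrans_self E_def)
qed

text \<open>One bidegree component of the derived bracket identity. Multiplication by
  \<open>v\<close> or \<open>w\<close> commutes with the projections up to the shift (1, s), so each
  term involves a component of d^H with the same shift relative to its argument.\<close>

lemma bracket_projection:
  assumes s: "s = 1 \<or> s = -1" and W: "open W" "x \<in> W"
    and v: "smooth_section A W v" "\<And>q. q \<in> W \<Longrightarrow> v q \<in> E s q"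
    and w: "smooth_section A W w" "\<And>q. q \<in> W \<Longrightarrow> w q \<in> E s q"
    and phi: "smooth_form A W \<phi>"
  shows "fib.grade_proj x (i + 2) (j + 2 * s) (dH (\<lambda>q. clifford (v q) (clifford (w q) (\<phi> q))) x)
    + clifford (v x) (fib.grade_proj x (i + 1) (j + s) (dH (\<lambda>q. clifford (w q) (\<phi> q)) x))
    - clifford (w x) (fib.grade_proj x (i + 1) (j + s) (dH (\<lambda>q. clifford (v q) (\<phi> q)) x))
    - clifford (w x) (clifford (v x) (fib.grade_proj x i j (dH \<phi> x)))
    = fib.grade_proj x (i + 2) (j + 2 * s) (clifford (courant A H v w x) (\<phi> x))"
proof -
  note wp = smooth_form_clifford[OF W(1) w(1) phi] and vp = smooth_form_clifford[OF W(1) v(1) phi]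
  note vwp = smooth_form_clifford[OF W(1) v(1) wp]
  note alt = alt_form_dH[OF W]
  have vx: "fib.PE x s (v x) = v x" and wx: "fib.PE x s (w x) = w x" using v w W by (auto simp: E_def)
  have c: "fib.grade_proj x (i' + 1) (j' + s) (clifford z \<psi>) = clifford z (fib.grade_proj x i' j' \<psi>)"
    if "fib.PE x s z = z" "alt_form \<psi>" for i' j' z \<psi>
    by (rule fib.grade_proj_clifford(1)[OF s that(2,1)])
  have c1: "fib.grade_proj x (i + 2) (j + 2 * s) (clifford z \<psi>) = clifford z (fib.grade_proj x (i + 1) (j + s) \<psi>)"
    if "fib.PE x s z = z" "alt_form \<psi>" for z \<psi>
    using c[OF that, of "i + 1" "j + s"] by (simp add: algebra_simps)
  show ?thesis
    unfolding courant_derived_bracket[OF W v(1) w(1) phi H_props(1,2), symmetric]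
    by (simp add: fib.grade_proj_diff fib.grade_proj_add alt_form_linear alt[OF phi] alt[OF wp] alt[OF vp] alt[OF vwp]
      c1[OF vx] c1[OF wx] c[OF vx])
qed

text \<open>The bracket enters only through \<open>br\<close>, the absence of a component with shift
  (r + 2, r' + 2 s). Either the shape of Clifford multiplication or involutivity can guarantee this,
  and both cases share the induction.\<close>

lemma no_shift_of_bracket:
  assumes s: "s = 1 \<or> s = -1"
    and br: "\<And>W v w x a b \<psi>. open W \<Longrightarrow> x \<in> W \<Longrightarrow> smooth_section A W v \<Longrightarrow> (\<And>q. q \<in> W \<Longrightarrow> v q \<in> E s q) \<Longrightarrow>
      smooth_section A W w \<Longrightarrow> (\<And>q. q \<in> W \<Longrightarrow> w q \<in> E s q) \<Longrightarrow> \<psi> \<in> fib.U x a b \<Longrightarrow>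
      fib.grade_proj x (a + (r + 2)) (b + (r' + 2 * s)) (clifford (courant A H v w x) \<psi>) = 0"
    and r: "r + s * r' \<le> -3"
  shows "no_shift r r'"
proof -
  have ss: "s * s = 1" using s by auto
  \<comment> \<open>The added 1 makes the measure strictly positive for all weights up to the top,
    so that it still decreases when the next step leaves the range in which U^{p,q} can be
    nonzero.\<close>
  have "fib.grade_proj x (p + r) (q + r') (dH \<phi> x) = 0"
    if "k = nat (int n - p - s * q + 1)" "open W" "smooth_form A W \<phi>" "\<And>x. x \<in> W \<Longrightarrow> \<phi> x \<in> fib.U x p q" "x \<in> W"
    for k p q W \<phi> x
    using that
  proof (induction k arbitrary: p q W \<phi> x rule: less_induct)
    case (less k)
    note W = less.prems(2) and phi = less.prems(3) and U = less.prems(4) and x = less.prems(5)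
    show ?case
    proof (cases "int n - p - s * q < 0")
      case True
      have "\<phi> y = 0" if "y \<in> W" for y
        using fib.U_nonneg[OF s U[OF that]] True by force
      then show ?thesis using dH_zero[OF W x] by simp
    next
      case False
      define c where "c = chart_at A x"
      have c: "c \<in> A" "x \<in> fst c" by (simp_all add: c_def chart_at)
      \<comment> \<open>Within a single chart domain the fibre elements \<open>z1\<close> and
        \<open>z2\<close> extend to sections of \<open>E\<close>.\<close>
      define W' where "W' = W \<inter> fst c"
      have W': "open W'" "W' \<subseteq> fst c" "x \<in> W'" "W' \<subseteq> W"
        using W chartD(1)[OF c(1)] c(2) x by (auto simp: W'_def)
      have phi': "smooth_form A W' \<phi>" by (rule smooth_form_restrict[OF phi W'(4)])
      have U': "\<phi> y \<in> fib.U y p q" if "y \<in> W'" for y using U W'(4) that by blast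
      have IH: "fib.grade_proj x (p' + r) (q' + r') (dH \<psi> x) = 0"
        if "smooth_form A W' \<psi>" "\<And>y. y \<in> W' \<Longrightarrow> \<psi> y \<in> fib.U y p' q'" "p' + s * q' > p + s * q" for \<psi> p' q'
      proof (rule less.IH[OF _ refl W'(1) that(1,2) W'(3)])
        show "nat (int n - p' - s * q' + 1) < k" unfolding less.prems(1) using that(3) False by simp
      qed
      show ?thesis
      proof (rule fib.E_injective[OF s])
        show "fib.grade_proj x (p + r) (q + r') (dH \<phi> x) \<in> fib.U x (p + r) (q + r')"
          by (rule fib.grade_proj_decomp(1)[OF alt_form_dH[OF W x phi]])
        show "3 \<le> int n - (p + r) - s * (q + r')"
          using False r by (simp add: algebra_simps)
        fix z1 z2 assume "fib.PE x s z1 = z1" "fib.PE x s z2 = z2"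
        then have z: "z1 \<in> E s x" "z2 \<in> E s x" by (simp_all add: E_def)
        obtain w where w: "smooth_section A W' w" "\<And>q. w q \<in> E s q" "w x = z1"
          using E_extend[OF z(1) s c_def W'(1-3)] by blast
        obtain v where v: "smooth_section A W' v" "\<And>q. v q \<in> E s q" "v x = z2"
          using E_extend[OF z(2) s c_def W'(1-3)] by blast
        have EU: "clifford z \<psi> \<in> fib.U y (a + 1) (b + s)" if "z \<in> E s y" "\<psi> \<in> fib.U y a b" for z \<psi> y a b
          by (rule fib.clifford_E[OF s _ that(2)]) (use that(1) in \<open>simp add: E_def\<close>)
        have wU: "clifford (w y) (\<phi> y) \<in> fib.U y (p + 1) (q + s)" and vU: "clifford (v y) (\<phi> y) \<in> fib.U y (p + 1) (q + s)"
          if "y \<in> W'" for y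
          using EU[OF w(2) U'[OF that]] EU[OF v(2) U'[OF that]] by auto
        have vwU: "clifford (v y) (clifford (w y) (\<phi> y)) \<in> fib.U y (p + 2) (q + 2 * s)" if "y \<in> W'" for y
          using EU[OF v(2) wU[OF that]] by (simp add: add.assoc)
        note wp = smooth_form_clifford[OF W'(1) w(1) phi'] and vp = smooth_form_clifford[OF W'(1) v(1) phi']
        have g1: "p + s * q < (p + 1) + s * (q + s)" "p + s * q < (p + 2) + s * (q + 2 * s)"
          using ss by (simp_all add: algebra_simps)
        have i1: "fib.grade_proj x (p + r + 1) (q + r' + s) (dH (\<lambda>y. clifford (w y) (\<phi> y)) x) = 0"
          using IH[OF wp wU g1(1)] by (simp add: algebra_simps)
        have i2: "fib.grade_proj x (p + r + 1) (q + r' + s) (dH (\<lambda>y. clifford (v y) (\<phi> y)) x) = 0"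
          using IH[OF vp vU g1(1)] by (simp add: algebra_simps)
        have i3: "fib.grade_proj x (p + r + 2) (q + r' + 2 * s) (dH (\<lambda>y. clifford (v y) (clifford (w y) (\<phi> y))) x) = 0"
          using IH[OF smooth_form_clifford[OF W'(1) v(1) wp] vwU g1(2)] by (simp add: algebra_simps)
        have i4: "fib.grade_proj x (p + r + 2) (q + r' + 2 * s) (clifford (courant A H v w x) (\<phi> x)) = 0"
          using br[OF W'(1,3) v(1) v(2) w(1) w(2) U'[OF W'(3)]] by (simp add: add.assoc)
        \<comment> \<open>In the projected bracket identity three of the d^H terms act on sections
          of larger weight and vanish by induction, and the bracket term vanishes by
          \<open>br\<close>; the remaining term is the claim.\<close>
        show "clifford z1 (clifford z2 (fib.grade_proj x (p + r) (q + r') (dH \<phi> x))) = 0"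
          using bracket_projection[OF s W'(1,3) v(1) v(2) w(1) w(2) phi', of "p + r" "q + r'"]
          unfolding i1 i2 i3 i4 v(3) w(3) by (simp add: clifford_linear)
      qed
    qed
  qed
  then show ?thesis unfolding no_shift_def by blast
qed

text \<open>The bracket acts as Clifford multiplication and shifts only by pairs of signs, whatever
  the sections. This excludes all strongly lowering components of d^H except three for each
  s.\<close>

lemma no_shift_general:
  assumes s: "s = 1 \<or> s = -1" and "r + s * r' \<le> -3" "(r + 2, r' + 2 * s) \<notin> {(1, 1), (1, -1), (-1, -1), (-1, 1)}"
  shows "no_shift r r'"
proof (rule no_shift_of_bracket[OF s _ assms(2)])
  fix W v w x a b and \<psi> :: "'n mform"
  assume "\<psi> \<in> fib.U x a b"
  then show "fib.grade_proj x (a + (r + 2)) (b + (r' + 2 * s)) (clifford (courant A H v w x) \<psi>) = 0"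
    by (rule fib.clifford_grades) (use assms(3) in auto)
qed

lemma no_shift_involutive:
  assumes s: "s = 1 \<or> s = -1" and inv: "involutive A H (E s)" and "r + s * r' \<le> -3" "(r + 2, r' + 2 * s) \<noteq> (1, s)"
  shows "no_shift r r'"
proof (rule no_shift_of_bracket[OF s _ assms(3)])
  fix W v w x a b and \<psi> :: "'n mform"
  assume W: "open W" "x \<in> W" and v: "smooth_section A W v" "\<And>q. q \<in> W \<Longrightarrow> v q \<in> E s q"
    and w: "smooth_section A W w" "\<And>q. q \<in> W \<Longrightarrow> w q \<in> E s q" and psi: "\<psi> \<in> fib.U x a b"
  have "courant A H v w x \<in> E s x" using inv W v w unfolding involutive_def by blast
  then have "clifford (courant A H v w x) \<psi> \<in> fib.U x (a + 1) (b + s)"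
    by (intro fib.clifford_E[OF s _ psi]) (simp add: E_def)
  from fib.grade_proj_U[OF this]
  show "fib.grade_proj x (a + (r + 2)) (b + (r' + 2 * s)) (clifford (courant A H v w x) \<psi>) = 0"
    using assms(4) by auto
qed

text \<open>Split a form that is constant in a chart: the number operators are smooth because they may be
  computed in the coordinate frame of the chart.\<close>

lemma U_extend:
  assumes psi: "\<psi> \<in> fib.U x a b" and c: "c = chart_at A x" and W: "open W" "W \<subseteq> fst c" "x \<in> W"
  obtains \<phi> where "smooth_form A W \<phi>" "\<And>q. q \<in> W \<Longrightarrow> \<phi> q \<in> fib.U q a b" "\<phi> x = \<psi>"
proof -
  have cA: "c \<in> A" "x \<in> fst c" by (simp_all add: c chart_at)
  define sc where "sc k \<phi> = (\<lambda>q. k *\<^sub>f \<phi> q)" for k and \<phi> :: "'a \<Rightarrow> 'n mform"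
  have vs: "vector_space sc"
    by standard (simp_all add: sc_def fun_eq_iff form_pt algebra_simps)
  interpret vector_space sc by (rule vs)
  \<comment> \<open>Fields are continued by zero outside \<open>W\<close>, so that eigenvalue
    equations on \<open>W\<close> become equations between functions on the whole manifold.\<close>
  define X where "X = {\<phi>. smooth_form A W \<phi> \<and> (\<forall>q. q \<notin> W \<longrightarrow> \<phi> q = 0)}"
  define T where "T \<phi> = (\<lambda>q. if q \<in> W then fib.N1 q (\<phi> q) else 0)" for \<phi>
  define S where "S \<phi> = (\<lambda>q. if q \<in> W then fib.N2 q (\<phi> q) else 0)" for \<phi>
  have alt: "alt_form (\<phi> q)" if "\<phi> \<in> X" for \<phi> q
    using that by (cases "q \<in> W") (auto simp: X_def smooth_form_def)
  have sub: "subspace X"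
  proof -
    have e: "(0 :: 'a \<Rightarrow> 'n mform) = (\<lambda>q. 0)" "\<phi> + \<psi> = (\<lambda>q. \<phi> q + \<psi> q)" for \<phi> \<psi> :: "'a \<Rightarrow> 'n mform"
      by (simp_all add: fun_eq_iff form_pt)
    show ?thesis unfolding subspace_def
    proof (intro conjI ballI allI)
      show "0 \<in> X" unfolding X_def e(1) using smooth_form_zero[OF W(1)] by blast
      show "\<phi> + \<psi> \<in> X" if "\<phi> \<in> X" "\<psi> \<in> X" for \<phi> \<psi>
        using that smooth_form_add[OF W(1), of \<phi> \<psi>] unfolding X_def e(2) by simp
      show "sc k \<phi> \<in> X" if "\<phi> \<in> X" for k \<phi>
        using that smooth_form_scale[OF W(1), of \<phi> k] unfolding X_def sc_def by (simp add: cscale_form_simps)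
    qed
  qed
  have num: "(\<lambda>q. if q \<in> W then number (P q) (Q q) (\<phi> q) else 0) \<in> X"
    if phi: "\<phi> \<in> X" and lin: "\<And>q. clin (P q)" "\<And>q. clin (Q q)"
      and sm: "\<And>u. smooth_section A W u \<Longrightarrow> smooth_section A W (\<lambda>q. P q (u q))"
        "\<And>u. smooth_section A W u \<Longrightarrow> smooth_section A W (\<lambda>q. Q q (u q))" for P Q \<phi>
  proof -
    have "smooth_form A W (\<lambda>q. \<Sum>k\<in>UNIV. clifford (Q q (const_section c (gt_basis k) q))
      (clifford (P q (const_section c (gt_cobasis k) q)) (\<phi> q)))"
      by (intro smooth_form_sum smooth_form_clifford sm smooth_const_section cA W) (use phi in \<open>simp add: X_def\<close>)
    then have "smooth_form A W (\<lambda>q. if q \<in> W then number (P q) (Q q) (\<phi> q) else 0)"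
    proof (rule smooth_form_cong[OF W(1), rotated])
      fix q assume q: "q \<in> W"
      have "number_op (\<lambda>k. const_section c (gt_basis k) q) (\<lambda>k. const_section c (gt_cobasis k) q) (P q) (Q q) (\<phi> q) = number (P q) (Q q) (\<phi> q)"
        by (rule tensor_frame_indep[OF const_section_frames dual_frames_gt_basis lin alt[OF phi]])
          (use q W cA in auto)
      then show "(\<Sum>k\<in>UNIV. clifford (Q q (const_section c (gt_basis k) q))
        (clifford (P q (const_section c (gt_cobasis k) q)) (\<phi> q))) = (if q \<in> W then number (P q) (Q q) (\<phi> q) else 0)"
        using q by (simp add: number_op_def)
    qed
    then show ?thesis by (simp add: X_def)
  qed
  let ?m = "Suc (number_bound TYPE('n))"
  have lin1: "clin (hol_part (J q))" "clin (ahol_part (J q))" for q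
    using adj_pair.lin[OF adj_pair_hol[OF fib.J]] by auto
  have lin2: "clin (hol_part (G q \<circ> J q))" "clin (ahol_part (G q \<circ> J q))" for q
    using adj_pair.lin[OF adj_pair_hol[OF fib.orth_cs_GJ]] by auto
  \<comment> \<open>The operators act fibre by fibre, so the product of factors annihilates fields
    because it annihilates each fibre.\<close>
  have killT: "kill sc T m \<phi> = (\<lambda>q. if q \<in> W then kill (*\<^sub>f) (fib.N1 q) m (\<phi> q) else 0)" if "\<And>q. q \<notin> W \<Longrightarrow> \<phi> q = 0" for m \<phi>
    using that
  proof (induction m arbitrary: \<phi>)
    case 0 then show ?case by auto
  next
    case (Suc m)
    show ?case unfolding kill.simps
      by (subst Suc.IH) (auto simp: T_def sc_def form_pt Suc.prems cscale_form_simps fun_diff_def cong: if_cong)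
  qed
  have killS: "kill sc S m \<phi> = (\<lambda>q. if q \<in> W then kill (*\<^sub>f) (fib.N2 q) m (\<phi> q) else 0)" if "\<And>q. q \<notin> W \<Longrightarrow> \<phi> q = 0" for m \<phi>
    using that
  proof (induction m arbitrary: \<phi>)
    case 0 then show ?case by auto
  next
    case (Suc m)
    show ?case unfolding kill.simps
      by (subst Suc.IH) (auto simp: S_def sc_def form_pt Suc.prems cscale_form_simps fun_diff_def cong: if_cong)
  qed
  define \<phi>0 where "\<phi>0 q = (if q \<in> W then const_form c \<psi> q else 0)" for q
  have "\<phi>0 \<in> X"
  proof -
    have "smooth_form A W \<phi>0"
      by (rule smooth_form_cong[OF W(1) _ smooth_const_form[OF cA(1) W(1,2) fib.U_alt[OF psi]]]) (simp add: \<phi>0_def)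
    then show ?thesis by (simp add: X_def \<phi>0_def)
  qed
  have "\<exists>f. (\<forall>i j. f i j \<in> X \<and> T (f i j) = sc (of_nat i) (f i j) \<and> S (f i j) = sc (of_nat j) (f i j)) \<and>
    \<phi>0 = (\<Sum>i<?m. \<Sum>j<?m. f i j)"
  proof (rule kill_decomp2[OF vs sub \<open>\<phi>0 \<in> X\<close>])
    fix \<phi> assume phi: "\<phi> \<in> X"
    show "T \<phi> \<in> X" unfolding T_def by (rule num[OF phi lin1 smooth_hol_part(1,2)[OF W(1)]])
    show "S \<phi> \<in> X" unfolding S_def by (rule num[OF phi lin2 smooth_hol_part(3,4)[OF W(1)]])
    have z: "\<phi> q = 0" if "q \<notin> W" for q using phi that by (simp add: X_def)
    have kT: "(\<lambda>q. if q \<in> W then kill (*\<^sub>f) (fib.N1 q) ?m (\<phi> q) else 0) = 0"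
      by (simp only: adj_pair.kill_number[OF adj_pair_hol[OF fib.J] dual_frames_gt_basis alt[OF phi]] if_cancel)
        (simp only: zero_fun_def)
    have kS: "(\<lambda>q. if q \<in> W then kill (*\<^sub>f) (fib.N2 q) ?m (\<phi> q) else 0) = 0"
      by (simp only: adj_pair.kill_number[OF adj_pair_hol[OF fib.orth_cs_GJ] dual_frames_gt_basis alt[OF phi]] if_cancel)
        (simp only: zero_fun_def)
    show "kill sc T ?m \<phi> = 0"
      by (rule trans[OF killT[OF z] kT])
    show "kill sc S ?m \<phi> = 0"
      by (rule trans[OF killS[OF z] kS])
    show "T (S \<phi>) = S (T \<phi>)"
      using fib.N1_N2_commute[OF alt[OF phi]] by (simp add: T_def S_def cong: if_cong)
    fix k \<chi>' assume chi: "\<chi>' \<in> X"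
    have "T (\<phi> - \<chi>') q = (T \<phi> - T \<chi>') q" "S (\<phi> - \<chi>') q = (S \<phi> - S \<chi>') q" for q
      by (cases "q \<in> W"; simp only: T_def S_def minus_apply number_op_linear if_True if_False diff_0_right)+
    then show "T (\<phi> - \<chi>') = T \<phi> - T \<chi>'" "S (\<phi> - \<chi>') = S \<phi> - S \<chi>'"
      by blast+
  next
    fix k \<phi>
    show "T (sc k \<phi>) = sc k (T \<phi>)" "S (sc k \<phi>) = sc k (S \<phi>)"
      by (auto simp: T_def S_def sc_def number_op_linear cscale_form_simps)
  qed
  then obtain f where f: "\<And>i j. f i j \<in> X" "\<And>i j. T (f i j) = sc (of_nat i) (f i j)" "\<And>i j. S (f i j) = sc (of_nat j) (f i j)"
    and f0: "\<phi>0 = (\<Sum>i<?m. \<Sum>j<?m. f i j)" by blast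
  have fU: "f i j q \<in> fib.U q (int n - int i) (int n - int j)" if "q \<in> W" for i j q
    using fun_cong[OF f(2)[of i j], of q] fun_cong[OF f(3)[of i j], of q] that alt[OF f(1)]
    by (simp add: fib.U_iff T_def S_def sc_def)
  \<comment> \<open>At most one index pair satisfies the condition; the sum extracts that
    eigen-component, and is zero if there is none.\<close>
  define \<phi> where "\<phi> q = (\<Sum>i<?m. \<Sum>j<?m. if a = int n - int i \<and> b = int n - int j then f i j q else 0)" for q
  have "smooth_form A W \<phi>"
    unfolding \<phi>_def
  proof (intro smooth_form_sum W(1))
    fix i j
    show "smooth_form A W (\<lambda>q. if a = int n - int i \<and> b = int n - int j then f i j q else 0)"
      using f(1)[of i j] smooth_form_zero[OF W(1)]
      by (cases "a = int n - int i \<and> b = int n - int j") (auto simp: X_def)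
  qed
  moreover have Usum: "(\<Sum>i\<in>I. g i) \<in> fib.U q a b" if "\<And>i. i \<in> I \<Longrightarrow> g i \<in> fib.U q a b" for I :: "nat set" and g q
    using that by (induction I rule: infinite_finite_induct) (auto intro: fib.U_subspace)
  have "\<phi> q \<in> fib.U q a b" if "q \<in> W" for q
    unfolding \<phi>_def by (intro Usum) (use fU[OF that] fib.U_subspace(1) in auto)
  moreover have "\<phi> x = \<psi>"
  proof -
    have ax: "alt_form (f i j x)" for i j by (rule alt[OF f(1)])
    have "\<psi> = \<phi>0 x" using W cA c by (simp add: \<phi>0_def const_form_def jacobian_self pullback_1)
    also have "\<dots> = (\<Sum>i<?m. \<Sum>j<?m. f i j x)" unfolding f0 by (simp only: sum_fun_apply)
    finally have e: "\<psi> = (\<Sum>i<?m. \<Sum>j<?m. f i j x)" .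
    have "\<psi> = fib.grade_proj x a b \<psi>" using fib.grade_proj_U[OF psi, of a b] by simp
    also have "\<dots> = (\<Sum>i<?m. fib.grade_proj x a b (\<Sum>j<?m. f i j x))"
      by (subst e, rule fib.grade_proj_sum) (intro finite_lessThan alt_form_sum ax)+
    also have "\<dots> = (\<Sum>i<?m. \<Sum>j<?m. fib.grade_proj x a b (f i j x))"
      by (intro sum.cong refl fib.grade_proj_sum finite_lessThan ax)
    also have "\<dots> = \<phi> x"
      unfolding \<phi>_def by (intro sum.cong refl) (simp only: fib.grade_proj_U[OF fU[OF W(3)]])
    finally show ?thesis by simp
  qed
  ultimately show ?thesis using that by blast
qed

text \<open>Multiplying by \<open>v\<close> and \<open>w\<close> moves source and target degree
  together, so all four d^H terms of the identity involve the component with shift (i - 2 - a, j - 2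
  s - b). If the bracket does not raise p + s q, this shift lowers it by at least 4 and the
  component vanishes. Since the bracket acts pointwise, an extension of \<psi> near \<open>x\<close>
  is all that is needed.\<close>

lemma involutive_no_shift:
  assumes s: "s = 1 \<or> s = -1" and ns: "\<And>r r'. r + s * r' \<le> -3 \<Longrightarrow> no_shift r r'"
  shows "involutive A H (E s)"
  unfolding involutive_def
proof (intro allI impI ballI)
  fix W v w x
  assume W: "open W" and v: "smooth_section A W v" "\<forall>p\<in>W. v p \<in> E s p"
    and w: "smooth_section A W w" "\<forall>p\<in>W. w p \<in> E s p" and x: "x \<in> W"
  have ss: "s * s = 1" using s by auto
  define c where "c = chart_at A x"
  have c: "c \<in> A" "x \<in> fst c" by (simp_all add: c_def chart_at)
  define W' where "W' = W \<inter> fst c"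
  have W': "open W'" "W' \<subseteq> fst c" "x \<in> W'" "W' \<subseteq> W"
    using W chartD(1)[OF c(1)] c(2) x by (auto simp: W'_def)
  have v': "smooth_section A W' v" "\<And>q. q \<in> W' \<Longrightarrow> v q \<in> E s q"
    using smooth_section_restrict[OF v(1) W'(4)] v(2) W'(4) by auto
  have w': "smooth_section A W' w" "\<And>q. q \<in> W' \<Longrightarrow> w q \<in> E s q"
    using smooth_section_restrict[OF w(1) W'(4)] w(2) W'(4) by auto
  have "fib.PE x s (courant A H v w x) = courant A H v w x"
  proof (rule fib.PE_of_grades[OF s])
    fix a b i j \<psi> assume psi: "\<psi> \<in> fib.U x a b" and le: "(i - a) + s * (j - b) \<le> 0"
    obtain \<phi> where phi: "smooth_form A W' \<phi>" "\<And>q. q \<in> W' \<Longrightarrow> \<phi> q \<in> fib.U q a b" "\<phi> x = \<psi>"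
      using U_extend[OF psi c_def W'(1-3)] by blast
    have N: "no_shift (i - 2 - a) (j - 2 * s - b)"
      by (rule ns) (use le ss in \<open>simp add: algebra_simps\<close>)
    have EU: "clifford z \<chi>' \<in> fib.U y (a + 1) (b + s)" if "z \<in> E s y" "\<chi>' \<in> fib.U y a b" for z \<chi>' y a b
      by (rule fib.clifford_E[OF s _ that(2)]) (use that(1) in \<open>simp add: E_def\<close>)
    have wU: "clifford (w y) (\<phi> y) \<in> fib.U y (a + 1) (b + s)" and vU: "clifford (v y) (\<phi> y) \<in> fib.U y (a + 1) (b + s)"
      if "y \<in> W'" for y
      using EU[OF w'(2)[OF that] phi(2)[OF that]] EU[OF v'(2)[OF that] phi(2)[OF that]] by auto
    have vwU: "clifford (v y) (clifford (w y) (\<phi> y)) \<in> fib.U y (a + 2) (b + 2 * s)" if "y \<in> W'" for y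
      using EU[OF v'(2)[OF that] wU[OF that]] by (simp add: add.assoc)
    note wp = smooth_form_clifford[OF W'(1) w'(1) phi(1)] and vp = smooth_form_clifford[OF W'(1) v'(1) phi(1)]
    note nD = no_shiftD[OF N W'(1) _ _ W'(3)]
    have i0: "fib.grade_proj x (i - 2) (j - 2 * s) (dH \<phi> x) = 0"
      by (rule nD[OF phi(1,2)]) auto
    have i1: "fib.grade_proj x (i - 2 + 1) (j - 2 * s + s) (dH (\<lambda>y. clifford (w y) (\<phi> y)) x) = 0"
      by (rule nD[OF wp wU]) auto
    have i2: "fib.grade_proj x (i - 2 + 1) (j - 2 * s + s) (dH (\<lambda>y. clifford (v y) (\<phi> y)) x) = 0"
      by (rule nD[OF vp vU]) auto
    have i3: "fib.grade_proj x (i - 2 + 2) (j - 2 * s + 2 * s) (dH (\<lambda>y. clifford (v y) (clifford (w y) (\<phi> y))) x) = 0"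
      by (rule nD[OF smooth_form_clifford[OF W'(1) v'(1) wp] vwU]) auto
    show "fib.grade_proj x i j (clifford (courant A H v w x) \<psi>) = 0"
      using bracket_projection[OF s W'(1,3) v' w' phi(1), of "i - 2" "j - 2 * s"]
      unfolding i0 i1 i2 i3 phi(3) by (simp add: clifford_linear)
  qed
  then show "courant A H v w x \<in> E s x" by (simp add: E_def)
qed

text \<open>The conjugate shifts (-1, -3), (-3, -1), (-3, -3) lower p + q by 4 or 6 and correspond
  to bracket shifts (1, -1), (-1, 1), (-1, -1), precisely those that involutivity forbids.\<close>

lemma involutive_E_plus:
  "involutive A H (E 1) \<longleftrightarrow> no_shift 1 3 \<and> no_shift 3 1 \<and> no_shift 3 3"
proof
  assume inv: "involutive A H (E 1)"
  have "no_shift (-1) (-3)" "no_shift (-3) (-1)" "no_shift (-3) (-3)"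
    by (rule no_shift_involutive[OF _ inv]; simp)+
  then show "no_shift 1 3 \<and> no_shift 3 1 \<and> no_shift 3 3"
    using no_shift_cnj[of "-1" "-3"] no_shift_cnj[of "-3" "-1"] no_shift_cnj[of "-3" "-3"] by simp
next
  assume "no_shift 1 3 \<and> no_shift 3 1 \<and> no_shift 3 3"
  then have c: "no_shift (-1) (-3)" "no_shift (-3) (-1)" "no_shift (-3) (-3)"
    using no_shift_cnj by force+
  show "involutive A H (E 1)"
  proof (rule involutive_no_shift)
    fix r r' :: int assume le: "r + 1 * r' \<le> - 3"
    show "no_shift r r'"
    proof (cases "(r + 2, r' + 2 * 1) \<in> {(1, 1), (1, -1), (-1, -1), (-1, 1)}")
      case True
      \<comment> \<open>The fourth pair (1, 1) would mean r = r' = -1, a lowering by 2 only, which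
        \<open>le\<close> rules out.\<close>
      then consider "r = -1" "r' = -3" | "r = -3" "r' = -3" | "r = -3" "r' = -1" using le by auto
      then show ?thesis using c by cases auto
    next
      case False
      then show ?thesis using le by (intro no_shift_general[of 1]) auto
    qed
  qed simp
qed

text \<open>The weight is now p - q. The shift (-1, 3) already lowers it and is used as it stands;
  only (3, -1) and (3, -3) have to be conjugated.\<close>

lemma involutive_E_minus:
  "involutive A H (E (-1)) \<longleftrightarrow> no_shift (-1) 3 \<and> no_shift 3 (-1) \<and> no_shift 3 (-3)"
proof
  assume inv: "involutive A H (E (-1))"
  have "no_shift (-1) 3" "no_shift (-3) 1" "no_shift (-3) 3"
    by (rule no_shift_involutive[OF _ inv]; simp)+
  then show "no_shift (-1) 3 \<and> no_shift 3 (-1) \<and> no_shift 3 (-3)"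
    using no_shift_cnj[of "-3" 1] no_shift_cnj[of "-3" 3] by simp
next
  assume "no_shift (-1) 3 \<and> no_shift 3 (-1) \<and> no_shift 3 (-3)"
  then have c: "no_shift (-1) 3" "no_shift (-3) 1" "no_shift (-3) 3"
    using no_shift_cnj[of 3 "-1"] no_shift_cnj[of 3 "-3"] by auto
  show "involutive A H (E (-1))"
  proof (rule involutive_no_shift)
    fix r r' :: int assume le: "r + - 1 * r' \<le> - 3"
    show "no_shift r r'"
    proof (cases "(r + 2, r' + 2 * - 1) \<in> {(1, 1), (1, -1), (-1, -1), (-1, 1)}")
      case True
      then consider "r = -1" "r' = 3" | "r = -3" "r' = 3" | "r = -3" "r' = 1" using le by auto
      then show ?thesis using c by cases auto
    next
      case False
      then show ?thesis using le by (intro no_shift_general[of "-1"]) auto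
    qed
  qed simp
qed

end

theorem proposition4p3:
  fixes A :: "('a::{t2_space,second_countable_topology}, 'n::finite) chart set"
    and n :: nat
    and H :: "'a \<Rightarrow> 'n mform"
    and G I_plus I_minus J1 :: "'a \<Rightarrow> (real, 'n) gtan \<Rightarrow> (real, 'n) gtan"
  assumes "smooth_atlas A"
    and "CARD('n) = 2 * n"
    and "real_closed_3form A H"
    and "generalized_metric A G"
    and "positive_almost_hermitian A G I_plus"
    and "negative_almost_hermitian A G I_minus"
    and "J1 = sum_structure G I_plus I_minus"
  shows "(positive_SKT A H G I_plus \<longleftrightarrow>
            torsion_vanishes N_2 A H G J1 \<and> torsion_vanishes N_3 A H G J1 \<and>
            torsion_vanishes N_plus A H G J1) \<and>
         (negative_SKT A H G I_minus \<longleftrightarrow>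
            torsion_vanishes N_1 A H G J1 \<and> torsion_vanishes N_4 A H G J1 \<and>
            torsion_vanishes N_minus A H G J1)"
proof -
  interpret skt_data A n H G I_plus I_minus
    by unfold_locales (use assms in auto)
  show ?thesis
    unfolding assms(7) N_1_def N_2_def N_3_def N_4_def N_plus_def N_minus_def torsion_vanishes_iff
      positive_SKT_def negative_SKT_def E_plus E_minus
    using assms(4-6) involutive_E_plus involutive_E_minus by simp
qed

end
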